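(* Let $P$ be a set of $m$ points in $\mathbb{R}^3$ and let $C$ be a set of $n$ anchored unit circles in $\mathbb{R}^3$. Then the number of incidences between $P$ and $C$ satisfies $$I(P,C)=O\left(m^{3/5}n^{3/5}+m+n\right),$$ where the implied constant is absolute.
   Context: An anchored unit circle (or anchored circle) in $\mathbb{R}^3$ is a circle of radius $1$ (lying in some plane of $\mathbb{R}^3$) that passes through the origin $o$. For a finite set $P$ of points and a finite set $C$ of curves, $I(P,C)=|\{(p,c)\mid p\in P,\ c\in C,\ p\in c\}|$. *)

theory Defs
  imports "HOL-Analysis.Analysis"
begin

definition circle_in_plane :: "(real^3) set \<Rightarrow> real^3 \<Rightarrow> real \<Rightarrow> (real^3) set" where
  "circle_in_plane H a r = H \<inter> sphere a r"

text \<open>The centre is required to lie in the plane: otherwise the intersection of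
  the plane with the unit sphere would be a circle of radius less than \<open>1\<close>,
  a point, or empty.\<close>

definition unit_circle :: "(real^3) set \<Rightarrow> bool" where
  "unit_circle c \<longleftrightarrow>
     (\<exists>H a. affine H \<and> aff_dim H = 2 \<and> a \<in> H \<and> c = circle_in_plane H a 1)"

definition anchored_unit_circle :: "(real^3) set \<Rightarrow> bool" where
  "anchored_unit_circle c \<longleftrightarrow> unit_circle c \<and> 0 \<in> c"

definition incidences :: "'a set \<Rightarrow> 'a set set \<Rightarrow> nat" where
  "incidences P C = card {(p, c). p \<in> P \<and> c \<in> C \<and> p \<in> c}"

end

theory Submission
  imports Defs "HOL-Homology.Homology" "HOL-Computational_Algebra.Polynomial"
begin

text \<open>
  Inversion in the origin turns anchored unit circles into tangent lines of a sphere, and a point \<open>p\<close>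
  lies on such a line only if the line touches the sphere on the horizon circle of \<open>p\<close>, orthogonally to it.
  After stereographic projection a tangent line becomes a contact element of the plane and \<open>p\<close> becomes
  two oriented circles; parametrising normals by the tangent of the half angle turns the latter
  into quadratic functions and the former into jets (abscissa, slope, value). So it suffices to bound
  the incidences between jets and quadratics.

  Both families are three-dimensional: a quadratic is a curve in the space of jets, and a jet is
  a line in the space of quadratics. In either space polynomial partitioning applies, and the curves inside
  the partitioning surface are harmless, because there are derivations lowering a (weighted) degree which see
  at most two curves through a point. Two quadratics share at most one jet, so that partitioning the jets gives
  \<open>I = O(N^(1/2) M^(3/4) + N + M)\<close> for \<open>N\<close> jets and \<open>M\<close> quadratics; partitioning
  the quadratics and using this bound inside the cells gives the exponents \<open>3/5\<close>.

  The partition rests on the ham sandwich theorem, hence on the Borsuk--Ulam theorem. The latter is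
  derived from the vanishing of the lower homology of the sphere, by counting modulo 2, as in Fan's lemma, the
  simplices with alternating labels in iterated subdivisions of chains of hemispheres.
\<close>

section \<open>The Borsuk--Ulam theorem\<close>

text \<open>The obstacle is a partitioning surface that contains many of the curves. In the space of
  jets (x, y, z), the fields d/dy and d/dx + y d/dz span the contact planes, to which every
  quadratic is tangent. Their commutator is d/dz up to sign, so only constants are killed by both;
  where one of them does not kill f, the surface f = 0 leaves room for a single tangent direction.
  In the space of quadratics the lines have directions (1, -x, x^2/2), which trace a conic, so a
  tangent plane contains at most two of them.

  Giving z the weight 2 on the jet side makes d/dx + y d/dz lower the degree by one and keeps the
  degree of a restriction to a quadratic equal to the weighted degree.

  Partitioning one side only, with pair counting in the cells, gives the exponents 1/2 and 3/4 in
  one order or the other. Using the bound from one side inside the cells of the other balances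
  them.\<close>

definition alternating_labels :: "int set \<Rightarrow> bool" where
  "alternating_labels L \<longleftrightarrow>
     inj_on abs L \<and> (\<forall>a\<in>L. sgn a = (-1) ^ card {b\<in>L. \<bar>b\<bar> < \<bar>a\<bar>})"

lemma alternating_labels_insert:
  fixes M :: int
  assumes fin: "finite L" and big: "\<And>y. y \<in> L \<Longrightarrow> \<bar>y\<bar> < \<bar>M\<bar>"
  shows "alternating_labels (insert M L) \<longleftrightarrow> alternating_labels L \<and> sgn M = (-1) ^ card L"
proof -
  have 1: "{b \<in> insert M L. \<bar>b\<bar> < \<bar>a\<bar>} = {b\<in>L. \<bar>b\<bar> < \<bar>a\<bar>}" if "a \<in> L" for a
    using big[OF that] by auto
  have 2: "{b \<in> insert M L. \<bar>b\<bar> < \<bar>M\<bar>} = L"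
    using big by auto
  have 3: "inj_on abs (insert M L) \<longleftrightarrow> inj_on abs L"
  proof -
    have "L - {M} = L" "\<bar>M\<bar> \<notin> abs ` L" using big by force+
    then show ?thesis by (simp add: inj_on_insert)
  qed
  show ?thesis
    unfolding alternating_labels_def 3 using 1 2 by auto
qed

lemma sgn_eq_minus_one_power: "(M::int) \<noteq> 0 \<Longrightarrow> sgn M = (-1)^k \<or> sgn M = (-1)^Suc k"
  by (cases "even k") (auto simp: sgn_if)

text \<open>Induction on the absolute value, with \<open>M\<close> the largest label. If
  \<open>M\<close> has the sign required in a facet that drops a lower label (\<open>e\<close>), the
  facets through \<open>M\<close> correspond to those of \<open>L\<close>, and the claim reduces to
  the one for \<open>L\<close>. Otherwise only \<open>L\<close> as a facet and
  \<open>insert M L\<close> can count, and they alternate together.\<close>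

lemma alternating_labels_facets:
  fixes L :: "int set"
  assumes "finite L" "inj_on abs L" "0 \<notin> L"
  shows "even (card {b\<in>L. alternating_labels (L - {b})} + of_bool (alternating_labels L)
           + of_bool (alternating_labels (uminus ` L)))"
  using assms
proof (induction L rule: finite_ranking_induct[where f=abs])
  case empty
  then show ?case by (simp add: alternating_labels_def)
next
  case (insert M L)
  have big: "\<bar>y\<bar> < \<bar>M\<bar>" if "y \<in> L - {M}" for y
  proof -
    have "\<bar>y\<bar> \<noteq> \<bar>M\<bar>" using that inj_onD[OF insert.prems(1), of y M] by auto
    then show ?thesis using insert.hyps(2)[of y] that by auto
  qed
  show ?case
  proof (cases "M \<in> L")
    case True
    then have "insert M L = L" by auto
    then show ?thesis using insert.IH insert.prems by metis
  next
    case False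
    have M0: "M \<noteq> 0" using insert.prems by auto
    let ?A = alternating_labels
    have big': "\<bar>y\<bar> < \<bar>M\<bar>" if "y \<in> L" for y
      using that big False by auto
    have IH: "even (card {b\<in>L. ?A (L - {b})} + of_bool (?A L) + of_bool (?A (uminus ` L)))"
      using insert.IH insert.prems inj_on_subset[OF insert.prems(1), of L] by blast
    \<comment> \<open>A facet that keeps \<open>M\<close> has only \<open>card L - 1\<close> labels
      below it, hence the parity shifted by one.\<close>
    define e where "e \<longleftrightarrow> sgn M = (-1) ^ Suc (card L)"
    have ne: "sgn M = (-1) ^ card L \<longleftrightarrow> \<not> e"
      using sgn_eq_minus_one_power[OF M0, of "card L"] by (auto simp: e_def)
    have P: "?A (insert M L) \<longleftrightarrow> ?A L \<and> \<not> e"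
      using alternating_labels_insert[OF insert.hyps(1) big'] ne by simp
    have "?A (insert (-M) (uminus ` L)) \<longleftrightarrow> ?A (uminus ` L) \<and> sgn (-M) = (-1) ^ card (uminus ` L)"
      by (rule alternating_labels_insert) (use insert.hyps(1) big' in auto)
    moreover have "card (uminus ` L) = card L" by (simp add: card_image)
    moreover have "sgn (-M) = (-1) ^ card L \<longleftrightarrow> e"
      unfolding e_def by (auto simp: sgn_minus minus_equation_iff[of "sgn M"])
    ultimately have N: "?A (uminus ` insert M L) \<longleftrightarrow> ?A (uminus ` L) \<and> e"
      by simp
    have eq: "{b\<in>insert M L. ?A (insert M L - {b})} =
        (if ?A L then {M} else {}) \<union> (if e then {b\<in>L. ?A (L - {b})} else {})"
    proof (rule Set.set_eqI)
      fix b
      have "?A (insert M L - {b}) \<longleftrightarrow> ?A (L - {b}) \<and> e" if b: "b \<in> L"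
      proof -
        have "insert M L - {b} = insert M (L - {b})" using b False by auto
        moreover have "?A (insert M (L - {b})) \<longleftrightarrow> ?A (L - {b}) \<and> sgn M = (-1) ^ card (L - {b})"
          by (rule alternating_labels_insert) (use insert.hyps(1) big' in auto)
        moreover have "card L = Suc (card (L - {b}))"
          using b insert.hyps(1) by (metis card_Suc_Diff1)
        ultimately show ?thesis by (simp only: e_def power_Suc minus_mult_minus mult_1 mult_minus_left minus_minus)
      qed
      moreover have "insert M L - {M} = L" using False by auto
      ultimately show "b \<in> {b\<in>insert M L. ?A (insert M L - {b})} \<longleftrightarrow>
          b \<in> (if ?A L then {M} else {}) \<union> (if e then {b\<in>L. ?A (L - {b})} else {})"
        using False by (cases "b = M"; cases "b \<in> L"; cases e) simp_all
    qed
    have "card {b\<in>insert M L. ?A (insert M L - {b})} =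
        of_bool (?A L) + (if e then card {b\<in>L. ?A (L - {b})} else 0)"
      unfolding eq by (subst card_Un_disjoint) (use False insert.hyps(1) in auto)
    moreover have "even ((if e then c else 0) + of_bool a + of_bool (a \<and> \<not> e) + of_bool (b \<and> e))"
      if "even (c + of_bool a + of_bool b)" for a b and c :: nat
      using that by (cases a; cases b; cases e) simp_all
    ultimately show ?thesis using IH unfolding P N by (simp add: ac_simps)
  qed
qed

definition alternating_on :: "nat set \<Rightarrow> (nat \<Rightarrow> int) \<Rightarrow> bool" where
  "alternating_on S l \<longleftrightarrow> inj_on l S \<and> alternating_labels (l ` S)"

text \<open>Read with \<open>i = j\<close>, the hypothesis also excludes the label 0. If two
  vertices share a label, only the facets omitting one of these two can be injective, and both carry
  the same labels, so they cancel modulo 2.\<close>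

lemma alternating_on_facets:
  fixes l :: "nat \<Rightarrow> int"
  assumes fin: "finite S" and nc: "\<And>i j. i \<in> S \<Longrightarrow> j \<in> S \<Longrightarrow> l i \<noteq> - l j"
  shows "even (card {j\<in>S. alternating_on (S - {j}) l} + of_bool (alternating_on S l)
           + of_bool (alternating_on S (\<lambda>i. - l i)))"
proof (cases "inj_on l S")
  case True
  have inja: "inj_on abs (l ` S)"
    using nc by (auto simp: inj_on_def abs_eq_iff)
  have 0: "0 \<notin> l ` S" using nc by force
  have eq: "alternating_on (S - {j}) l \<longleftrightarrow> alternating_labels (l ` S - {l j})" if "j \<in> S" for j
    using True that inj_on_subset[OF True, of "S - {j}"]
    by (simp add: alternating_on_def inj_on_image_set_diff[OF True, of S "{j}"] )
  have "card {j\<in>S. alternating_on (S - {j}) l} = card (l ` {j\<in>S. alternating_on (S - {j}) l})"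
    by (subst card_image) (use True in \<open>auto simp: inj_on_def\<close>)
  also have "l ` {j\<in>S. alternating_on (S - {j}) l} = {b \<in> l ` S. alternating_labels (l ` S - {b})}"
    using eq by auto
  finally have c: "card {j\<in>S. alternating_on (S - {j}) l} = card {b \<in> l ` S. alternating_labels (l ` S - {b})}" .
  have "(\<lambda>i. - l i) ` S = uminus ` l ` S" by auto
  moreover have "inj_on (\<lambda>i. - l i) S" using True by (auto simp: inj_on_def)
  ultimately show ?thesis
    using alternating_labels_facets[OF _ inja 0] fin True c by (simp add: alternating_on_def)
next
  case False
  then obtain i j where ij: "i \<in> S" "j \<in> S" "i \<noteq> j" "l i = l j"
    by (auto simp: inj_on_def)
  have F1: "\<not> alternating_on S l" "\<not> alternating_on S (\<lambda>i. - l i)"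
    using False by (auto simp: alternating_on_def inj_on_def)
  have sub: "{k\<in>S. alternating_on (S - {k}) l} \<subseteq> {i, j}"
    using ij by (auto simp: alternating_on_def inj_on_def)
  have "alternating_on (S - {j}) l \<longleftrightarrow> alternating_on (S - {i}) l"
  proof -
    have im: "l ` (S - {j}) = l ` (S - {i})"
      proof -
      have "S - {j} = insert i (S - {i, j})" "S - {i} = insert j (S - {i, j})"
        using ij by auto
      then show ?thesis using ij(4) by (metis image_insert)
    qed
    have "card (S - {j}) = card (S - {i})" using ij fin by simp
    then have "inj_on l (S - {j}) \<longleftrightarrow> inj_on l (S - {i})"
      using im fin by (metis card_image eq_card_imp_inj_on finite_Diff)
    then show ?thesis using im by (simp add: alternating_on_def)
  qed
  then have "{k\<in>S. alternating_on (S - {k}) l} = {} \<or> {k\<in>S. alternating_on (S - {k}) l} = {i, j}"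
    using sub ij by auto
  then have "even (card {k\<in>S. alternating_on (S - {k}) l})"
    using ij(3) by (elim disjE) (simp_all only: card.empty card_2_iff even_zero, simp_all)
  then show ?thesis using F1 by simp
qed

section \<open>Labelled simplices in singular chains\<close>

text \<open>The total coefficient of the simplices satisfying \<open>P\<close>. Extending linearly
  into the free group on one generator makes additivity immediate.\<close>

definition chain_count :: "('b \<Rightarrow> bool) \<Rightarrow> ('b \<Rightarrow>\<^sub>0 int) \<Rightarrow> int" where
  "chain_count P c = Poly_Mapping.lookup (frag_extend (\<lambda>f. if P f then frag_of () else 0) c) ()"

lemma chain_count_0 [simp]: "chain_count P 0 = 0"
  by (simp add: chain_count_def)

lemma chain_count_add: "chain_count P (a + b) = chain_count P a + chain_count P b"
  by (simp add: chain_count_def frag_extend_add lookup_add)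

lemma chain_count_diff: "chain_count P (a - b) = chain_count P a - chain_count P b"
  by (simp add: chain_count_def frag_extend_diff lookup_minus)

lemma chain_count_cmul: "chain_count P (frag_cmul k a) = k * chain_count P a"
  by (simp add: chain_count_def frag_extend_cmul)

lemma chain_count_of: "chain_count P (frag_of f) = of_bool (P f)"
  by (simp add: chain_count_def)

lemma chain_count_sum: "chain_count P (sum g I) = (\<Sum>i\<in>I. chain_count P (g i))"
  by (induction I rule: infinite_finite_induct) (auto simp: chain_count_add)

definition vtx :: "nat \<Rightarrow> nat \<Rightarrow> real" where
  "vtx i = (\<lambda>j. if j = i then 1 else 0)"

lemma vtx_in_standard_simplex: "i \<le> k \<Longrightarrow> vtx i \<in> standard_simplex k"
  by (auto simp: vtx_def standard_simplex_def)

lemma singular_face_vtx: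
  assumes "i \<le> k"
  shows "singular_face (Suc k) j f (vtx i) = f (vtx (if i < j then i else Suc i))"
proof -
  have "simplical_face j (vtx i) = vtx (if i < j then i else Suc i)"
    by (rule ext) (auto simp: simplical_face_def vtx_def)
  then show ?thesis
    using vtx_in_standard_simplex[OF assms] by (simp add: singular_face_def)
qed

definition alternating_simplex :: "('a \<Rightarrow> int) \<Rightarrow> nat \<Rightarrow> ((nat \<Rightarrow> real) \<Rightarrow> 'a) \<Rightarrow> bool" where
  "alternating_simplex lab k f \<longleftrightarrow> alternating_on {..k} (\<lambda>i. lab (f (vtx i)))"

lemma alternating_simplex_face:
  assumes j: "j \<le> Suc k"
  shows "alternating_simplex lab k (singular_face (Suc k) j f) \<longleftrightarrow>
     alternating_on ({..Suc k} - {j}) (\<lambda>i. lab (f (vtx i)))"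
proof -
  define s where "s = (\<lambda>i. if i < j then i else Suc i)"
  define l where "l = (\<lambda>i. lab (f (vtx i)))"
  have inj: "inj_on s {..k}" by (auto simp: inj_on_def s_def split: if_splits)
  have im: "s ` {..k} = {..Suc k} - {j}"
  proof
    show "s ` {..k} \<subseteq> {..Suc k} - {j}" by (auto simp: s_def)
    show "{..Suc k} - {j} \<subseteq> s ` {..k}"
    proof
      fix x assume x: "x \<in> {..Suc k} - {j}"
      show "x \<in> s ` {..k}"
      proof (cases "x < j")
        case True
        then have "x = s x" "x \<in> {..k}" using j by (auto simp: s_def)
        then show ?thesis by blast
      next
        case False
        then have "x = s (x - 1)" "x - 1 \<in> {..k}" using x by (auto simp: s_def)
        then show ?thesis by blast
      qed
    qed
  qed
  have "alternating_simplex lab k (singular_face (Suc k) j f) \<longleftrightarrow> alternating_on {..k} (l \<circ> s)"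
    unfolding alternating_simplex_def alternating_on_def
    by (intro arg_cong2[where f="(\<and>)"] inj_on_cong arg_cong[where f=alternating_labels] image_cong)
       (auto simp: singular_face_vtx l_def s_def)
  also have "\<dots> \<longleftrightarrow> alternating_on (s ` {..k}) l"
    unfolding alternating_on_def comp_inj_on_iff[OF inj] image_comp ..
  finally show ?thesis unfolding im l_def .
qed

text \<open>Modulo 2 the signs in the boundary disappear, so the facet count of a single simplex
  extends to chains by linearity.\<close>

lemma chain_count_boundary:
  assumes "Poly_Mapping.keys c \<subseteq> {f. \<forall>i\<le>Suc k. \<forall>j\<le>Suc k. lab (f (vtx i)) \<noteq> - lab (f (vtx j))}"
  shows "even (chain_count (alternating_simplex lab k) (chain_boundary (Suc k) c)
      + chain_count (alternating_simplex lab (Suc k)) c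
      + chain_count (alternating_simplex (\<lambda>x. - lab x) (Suc k)) c)"
  using assms
proof (induction c rule: frag_induction)
  case zero
  then show ?case by simp
next
  case (one f)
  define l where "l = (\<lambda>i. lab (f (vtx i)))"
  let ?x = "\<lambda>j. of_bool (alternating_on ({..Suc k} - {j}) l) :: int"
  have "even (card {j\<in>{..Suc k}. alternating_on ({..Suc k} - {j}) l} + of_bool (alternating_on {..Suc k} l)
           + of_bool (alternating_on {..Suc k} (\<lambda>i. - l i)))"
    by (rule alternating_on_facets) (use one in \<open>auto simp: l_def\<close>)
  then have 1: "even (int (card {j\<in>{..Suc k}. alternating_on ({..Suc k} - {j}) l}) + of_bool (alternating_on {..Suc k} l)
           + of_bool (alternating_on {..Suc k} (\<lambda>i. - l i)))"
    unfolding even_of_nat[where 'a=int, symmetric] by (simp only: of_nat_add of_nat_of_bool)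
  have 2: "int (card {j\<in>{..Suc k}. alternating_on ({..Suc k} - {j}) l}) = (\<Sum>j\<le>Suc k. ?x j)"
    by (simp add: sum_of_bool_eq Int_def del: sum.atMost_Suc)
  have 3: "even ((\<Sum>j\<le>Suc k. (-1)^j * ?x j) - (\<Sum>j\<le>Suc k. ?x j))"
    unfolding sum_subtractf[symmetric] by (intro dvd_sum) auto
  have 4: "chain_count (alternating_simplex lab k) (chain_boundary (Suc k) (frag_of f)) = (\<Sum>j\<le>Suc k. (-1)^j * ?x j)"
    unfolding chain_boundary_of l_def
    by (simp add: chain_count_sum chain_count_cmul chain_count_of alternating_simplex_face del: sum.atMost_Suc)
  show ?case
    unfolding 4 chain_count_of using 1 2 3 by (simp add: alternating_simplex_def l_def del: sum.atMost_Suc)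
next
  case (diff a b)
  have "even ((a1 - b1) + (a2 - b2) + (a3 - b3))" if "even (a1 + a2 + a3)" "even (b1 + b2 + b3)"
    for a1 a2 a3 b1 b2 b3 :: int
    using that by presburger
  then show ?case
    using diff by (simp add: chain_boundary_diff chain_count_diff)
qed

lemma chain_count_antipode:
  assumes "singular_chain p X c"
    and lab: "\<And>x. x \<in> topspace X \<Longrightarrow> lab (t x) = - lab x"
  shows "chain_count (alternating_simplex lab p) (chain_map p t c)
       = chain_count (alternating_simplex (\<lambda>x. - lab x) p) c"
  using assms(1) unfolding singular_chain_def
proof (induction c rule: frag_induction)
  case zero
  then show ?case by simp
next
  case (one f)
  have eq: "lab (simplex_map p t f (vtx i)) = - lab (f (vtx i))" if "i \<le> p" for i
  proof -
    have "f (vtx i) \<in> topspace X"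
      using one vtx_in_standard_simplex[OF that]
      by (auto simp: singular_simplex_def continuous_map_def)
    then show ?thesis
      using vtx_in_standard_simplex[OF that] lab by (simp add: simplex_map_def)
  qed
  have "alternating_simplex lab p (simplex_map p t f) \<longleftrightarrow> alternating_simplex (\<lambda>x. - lab x) p f"
    unfolding alternating_simplex_def alternating_on_def
    by (intro arg_cong2[where f="(\<and>)"] inj_on_cong arg_cong[where f=alternating_labels] image_cong)
       (auto simp: eq)
  then show ?case by (simp add: chain_count_of)
next
  case (diff a b)
  then show ?case by (simp add: chain_map_diff chain_count_diff)
qed

lemma chain_count_nonzeroD:
  assumes "chain_count P c \<noteq> 0"
  shows "\<exists>f \<in> Poly_Mapping.keys c. P f"
proof (rule ccontr)
  assume "\<not> ?thesis"
  then have "Poly_Mapping.keys c \<subseteq> {f. \<not> P f}" by auto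
  then have "chain_count P c = 0"
    by (induction c rule: frag_induction) (auto simp: chain_count_of chain_count_diff)
  with assms show False by simp
qed

text \<open>Let \<open>?P\<close> and \<open>?N\<close> count the simplices whose alternation starts
  with plus and with minus. The antipode exchanges the two, so the boundary of
  \<open>h (Suc k)\<close> contains, modulo 2, \<open>?P + ?N\<close> of \<open>h k\<close> many
  alternating simplices; the facet count passes this parity on to \<open>h (Suc k)\<close>. It is
  odd for the single vertex \<open>h 0\<close>.\<close>

lemma alternating_simplex_exists:
  fixes h :: "nat \<Rightarrow> 'a chain" and lab :: "'a \<Rightarrow> int"
  assumes chain: "\<And>i. i \<le> n \<Longrightarrow> singular_chain i X (h i)"
    and h0: "h 0 = frag_of v"
    and bd: "\<And>i. i < n \<Longrightarrow> chain_boundary (Suc i) (h (Suc i)) = h i + frag_cmul ((-1) ^ Suc i) (chain_map i t (h i))"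
    and lab: "\<And>x. x \<in> topspace X \<Longrightarrow> lab (t x) = - lab x" "\<And>x. x \<in> topspace X \<Longrightarrow> lab x \<noteq> 0"
    and nc: "\<And>p f i j. \<lbrakk>p \<le> n; f \<in> Poly_Mapping.keys (h p); i \<le> p; j \<le> p\<rbrakk> \<Longrightarrow> lab (f (vtx i)) \<noteq> - lab (f (vtx j))"
  shows "\<exists>f \<in> Poly_Mapping.keys (h n). inj_on (\<lambda>i. \<bar>lab (f (vtx i))\<bar>) {..n}"
proof -
  let ?P = "\<lambda>k. chain_count (alternating_simplex lab k)"
  let ?N = "\<lambda>k. chain_count (alternating_simplex (\<lambda>x. - lab x) k)"
  have "k \<le> n \<Longrightarrow> odd (?P k (h k) + ?N k (h k))" for k
  proof (induction k)
    case 0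
    have "singular_simplex 0 X v"
      using chain[of 0] by (simp add: h0 singular_chain_of)
    then have "v (vtx 0) \<in> topspace X"
      using vtx_in_standard_simplex[of 0 0] by (auto simp: singular_simplex_def continuous_map_def)
    then have "lab (v (vtx 0)) \<noteq> 0" using lab by auto
    moreover have "alternating_labels {a} \<longleftrightarrow> sgn a = 1" for a
    proof -
      have "alternating_labels {a} \<longleftrightarrow> sgn a = (-1) ^ card {b \<in> {a}. \<bar>b\<bar> < \<bar>a\<bar>}"
        by (simp add: alternating_labels_def)
      also have "{b \<in> {a}. \<bar>b\<bar> < \<bar>a\<bar>} = {}" by auto
      finally show ?thesis by simp
    qed
    ultimately show ?case
      by (simp add: h0 chain_count_of alternating_simplex_def alternating_on_def sgn_if)
  next
    case (Suc k)
    have "even (?P k (chain_boundary (Suc k) (h (Suc k))) + ?P (Suc k) (h (Suc k)) + ?N (Suc k) (h (Suc k)))"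
      by (rule chain_count_boundary) (use nc[of "Suc k"] Suc.prems in auto)
    moreover have "?P k (chain_boundary (Suc k) (h (Suc k))) = ?P k (h k) + (-1) ^ Suc k * ?N k (h k)"
      using Suc.prems bd[of k] chain_count_antipode[where lab=lab and t=t and p=k, OF chain[of k] lab(1)]
      by (simp add: chain_count_add chain_count_cmul)
    moreover have "odd (?P k (h k) + ?N k (h k))" using Suc by simp
    ultimately show ?case
      by (cases "even k") auto
  qed
  then have "odd (?P n (h n) + ?N n (h n))" by simp
  then have "?P n (h n) \<noteq> 0 \<or> ?N n (h n) \<noteq> 0" by auto
  then obtain f where f: "f \<in> Poly_Mapping.keys (h n)"
    "alternating_simplex lab n f \<or> alternating_simplex (\<lambda>x. - lab x) n f"
    using chain_count_nonzeroD[of "alternating_simplex lab n" "h n"]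
      chain_count_nonzeroD[of "alternating_simplex (\<lambda>x. - lab x) n" "h n"] by blast
  have "inj_on (\<lambda>i. \<bar>lab (f (vtx i))\<bar>) {..n}"
    using f(2)
  proof
    assume "alternating_simplex lab n f"
    then have "inj_on (\<lambda>i. lab (f (vtx i))) {..n}" "inj_on abs ((\<lambda>i. lab (f (vtx i))) ` {..n})"
      by (auto simp: alternating_simplex_def alternating_on_def alternating_labels_def)
    from comp_inj_on[OF this] show ?thesis by (simp add: o_def)
  next
    assume "alternating_simplex (\<lambda>x. - lab x) n f"
    then have "inj_on (\<lambda>i. - lab (f (vtx i))) {..n}" "inj_on abs ((\<lambda>i. - lab (f (vtx i))) ` {..n})"
      by (auto simp: alternating_simplex_def alternating_on_def alternating_labels_def)
    from comp_inj_on[OF this] show ?thesis by (simp add: o_def)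
  qed
  with f(1) show ?thesis by blast
qed

section \<open>Chains of hemispheres and their subdivision\<close>

lemma relboundary_if_trivial_homology:
  assumes "trivial_group (homology_group (int p) X)" "singular_relcycle p X {} c"
  shows "singular_relboundary p X {} c"
proof -
  have "homologous_rel_set p X {} c \<in> carrier (homology_group (int p) X)"
    using assms(2) by (simp add: carrier_relative_homology_group)
  then have "homologous_rel_set p X {} c = singular_relboundary_set p X {}"
    using assms(1) by (simp add: trivial_group_def)
  moreover have "c \<in> homologous_rel_set p X {} c" by (simp add: homologous_rel_refl)
  ultimately show ?thesis by blast
qed

lemma path_connected_space_nsphere:
  assumes "n \<noteq> 0"
  shows "path_connected_space (nsphere n)"
proof -
  have 1: "path_connected_space (subtopology (nsphere n) {x. x 0 \<ge> 0})"
    "path_connected_space (subtopology (nsphere n) {x. x 0 \<le> 0})"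
    using contractible_space_upper_hemisphere[of 0 n] contractible_space_lower_hemisphere[of 0 n]
    by (auto intro: contractible_imp_path_connected_space)
  then have 2: "path_connectedin (nsphere n) (topspace (nsphere n) \<inter> {x. x 0 \<ge> 0})"
    "path_connectedin (nsphere n) (topspace (nsphere n) \<inter> {x. x 0 \<le> 0})"
    unfolding path_connectedin_def by (simp_all add: subtopology_subtopology[symmetric])
  have "vtx 1 \<in> topspace (nsphere n)"
    using assms by (simp add: nsphere vtx_def power2_eq_square if_distrib [where f = "\<lambda>x. x * _"] cong: if_cong)
  then have "topspace (nsphere n) \<inter> {x. x 0 \<ge> 0} \<inter> (topspace (nsphere n) \<inter> {x. x 0 \<le> 0}) \<noteq> {}"
    by (auto simp: vtx_def)
  note * = path_connectedin_Un[OF 2 this]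
  have "path_connectedin (nsphere n) (topspace (nsphere n))"
  proof -
    have "topspace (nsphere n) \<inter> {x. x 0 \<ge> 0} \<union> topspace (nsphere n) \<inter> {x. x 0 \<le> 0} = topspace (nsphere n)"
      by auto
    then show ?thesis using * by (simp only:)
  qed
  then show ?thesis by (simp add: path_connectedin_topspace)
qed

abbreviation antipode :: "(nat \<Rightarrow> real) \<Rightarrow> nat \<Rightarrow> real" where
  "antipode x \<equiv> \<lambda>i. - x i"

lemma continuous_map_antipode: "continuous_map (nsphere n) (nsphere n) antipode"
  unfolding nsphere continuous_map_in_subtopology
  by (auto simp: continuous_map_componentwise_UNIV
      intro!: continuous_intros continuous_map_from_subtopology continuous_map_product_projection)

text \<open>The chain \<open>h i\<close> plays the role of a closed \<open>i\<close>-dimensional hemisphere; its existence only needs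
  that the homology of the sphere vanishes below the top dimension.\<close>

lemma hemisphere_chains:
  assumes "k \<le> n"
  shows "\<exists>h v. h 0 = frag_of v \<and> (\<forall>i\<le>k. singular_chain i (nsphere n) (h i)) \<and>
     (\<forall>i<k. chain_boundary (Suc i) (h (Suc i)) = h i + frag_cmul ((-1) ^ Suc i) (chain_map i antipode (h i)))"
  using assms
proof (induction k)
  case 0
  define v where "v = restrict (\<lambda>_. \<lambda>n::nat. if n = 0 then 1 else 0 :: real) (standard_simplex 0)"
  have "singular_simplex 0 (nsphere n) v"
    using in_topspace_nsphere[of n] unfolding singular_simplex_def v_def
    by (auto intro: continuous_map_eq[where f="\<lambda>_. \<lambda>n. if n = 0 then 1 else 0"])
  then show ?case by (intro exI[of _ "\<lambda>_. frag_of v"] exI[of _ v]) (simp add: singular_chain_of)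
next
  case (Suc k)
  let ?X = "nsphere n"
  obtain h v where h0: "h 0 = frag_of v" and sc: "\<And>i. i \<le> k \<Longrightarrow> singular_chain i ?X (h i)"
    and bd: "\<And>i. i < k \<Longrightarrow> chain_boundary (Suc i) (h (Suc i)) = h i + frag_cmul ((-1) ^ Suc i) (chain_map i antipode (h i))"
    using Suc by auto
  let ?z = "h k + frag_cmul ((-1) ^ Suc k) (chain_map k antipode (h k))"
  have "singular_relboundary k ?X {} ?z"
  \<comment> \<open>Homology in degree 0 does not vanish; there, path-connectedness makes a point
    homologous to its antipode.\<close>
  proof (cases "k = 0")
    case True
    have "homologous_rel 0 ?X {} (frag_of v) (frag_of (simplex_map 0 antipode v))"
    proof (rule iso_integer_zeroth_homology_group_aux)
      show "path_connected_space ?X" using Suc.prems by (intro path_connected_space_nsphere) auto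
      show v: "singular_simplex 0 ?X v" using sc[of 0] by (simp add: h0 singular_chain_of)
      show "singular_simplex 0 ?X (simplex_map 0 antipode v)"
        by (rule singular_simplex_simplex_map[OF v continuous_map_antipode])
    qed
    then show ?thesis using True by (simp add: homologous_rel_def h0)
  next
    case False
    then obtain j where k: "k = Suc j" by (metis not0_implies_Suc)
    let ?a = "chain_map j antipode (h j)"
    have scj: "singular_chain j ?X (h j)" "singular_chain k ?X (h k)" using sc k by auto
    have "chain_map j antipode ?a = chain_map j (antipode \<circ> antipode) (h j)"
      by (simp add: chain_map_compose)
    also have "\<dots> = h j" by (rule chain_map_id_gen[OF scj(1)]) (auto simp: fun_eq_iff)
    finally have aa: "chain_map j antipode ?a = h j" .
    have b: "chain_boundary k (h k) = h j + frag_cmul ((-1) ^ Suc j) ?a"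
      using bd[of j] k by simp
    \<comment> \<open>The antipode is an involution and consecutive dimensions carry opposite signs,
      so the contributions of \<open>h j\<close> and of its image cancel.\<close>
    have "chain_boundary k ?z = chain_boundary k (h k) + frag_cmul ((-1)^Suc k) (chain_map j antipode (chain_boundary k (h k)))"
      using chain_boundary_chain_map[OF scj(2), of antipode] k by (simp add: chain_boundary_add chain_boundary_cmul)
    also have "\<dots> = 0"
      unfolding b using k
      by (cases "even j") (simp_all add: chain_map_add chain_map_diff chain_map_minus chain_map_cmul frag_cmul_distrib2 aa)
    finally have "chain_boundary k ?z = 0" .
    moreover have "singular_chain k ?X ?z"
      by (intro singular_chain_add singular_chain_cmul singular_chain_chain_map[OF _ continuous_map_antipode] scj)
    ultimately have "singular_relcycle k ?X {} ?z"
      by (simp add: singular_cycle)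
    moreover have "trivial_group (homology_group (int k) ?X)"
      using trivial_reduced_homology_group_nsphere[of "int k" n] Suc.prems un_reduced_homology_group[of "int k" ?X] False
      by simp
    ultimately show ?thesis by (intro relboundary_if_trivial_homology)
  qed
  then obtain d where d: "singular_chain (Suc k) ?X d" "chain_boundary (Suc k) d = ?z"
    by (auto simp: singular_boundary)
  show ?case
    by (rule exI[of _ "h(Suc k := d)"], rule exI[of _ v])
       (use h0 sc bd d in \<open>auto simp: le_Suc_eq less_Suc_eq\<close>)
qed


text \<open>Subdivision commutes with the boundary and with the antipode, so the relations between
  the hemispheres survive it.\<close>

lemma iterated_subdivision:
  assumes "singular_chain p X c"
  shows "singular_chain p X ((singular_subdivision p ^^ N) c)"
    and "p = Suc q \<Longrightarrow> chain_boundary p ((singular_subdivision p ^^ N) c) = (singular_subdivision q ^^ N) (chain_boundary p c)"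
    and "continuous_map X X g \<Longrightarrow> (singular_subdivision p ^^ N) (chain_map p g c) = chain_map p g ((singular_subdivision p ^^ N) c)"
proof -
  show *: "singular_chain p X ((singular_subdivision p ^^ N) c)" for N
    by (induction N) (use assms in \<open>auto simp: singular_chain_singular_subdivision\<close>)
  show "chain_boundary p ((singular_subdivision p ^^ N) c) = (singular_subdivision q ^^ N) (chain_boundary p c)"
    if p: "p = Suc q"
    by (induction N) (simp_all add: chain_boundary_singular_subdivision[OF *[unfolded p]] p)
  show "(singular_subdivision p ^^ N) (chain_map p g c) = chain_map p g ((singular_subdivision p ^^ N) c)"
    if "continuous_map X X g"
    by (induction N) (auto simp: naturality_singular_subdivision[OF *])
qed

lemma iterated_subdivision_add_cmul:
  "(singular_subdivision p ^^ N) (a + frag_cmul ((-1) ^ k) b)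
    = (singular_subdivision p ^^ N) a + frag_cmul ((-1) ^ k) ((singular_subdivision p ^^ N) b)"
proof (induction N)
  case (Suc N)
  have "singular_subdivision p (- c) = - singular_subdivision p c" for c :: "'a chain"
    using singular_subdivision_diff[of p 0 c] by simp
  then show ?case using Suc
    by (cases "even k") (simp_all add: singular_subdivision_add singular_subdivision_diff)
qed simp

lemma small_hemisphere_chains:
  assumes op: "\<forall>U\<in>\<C>. openin (nsphere n) U" and cov: "topspace (nsphere n) \<subseteq> \<Union>\<C>"
  shows "\<exists>h v. h 0 = frag_of v \<and> (\<forall>i\<le>n. singular_chain i (nsphere n) (h i)) \<and>
     (\<forall>i<n. chain_boundary (Suc i) (h (Suc i)) = h i + frag_cmul ((-1) ^ Suc i) (chain_map i antipode (h i))) \<and>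
     (\<forall>i\<le>n. \<forall>f \<in> Poly_Mapping.keys (h i). \<exists>V\<in>\<C>. f \<in> standard_simplex i \<rightarrow> V)"
proof -
  obtain h v where h0: "h 0 = frag_of v" and sc: "\<And>i. i \<le> n \<Longrightarrow> singular_chain i (nsphere n) (h i)"
    and bd: "\<And>i. i < n \<Longrightarrow> chain_boundary (Suc i) (h (Suc i)) = h i + frag_cmul ((-1) ^ Suc i) (chain_map i antipode (h i))"
    using hemisphere_chains[of n n] by auto
  have "\<exists>N. \<forall>m f. N \<le> m \<and> f \<in> Poly_Mapping.keys ((singular_subdivision i ^^ m) (h i)) \<longrightarrow>
     (\<exists>V\<in>\<C>. f \<in> standard_simplex i \<rightarrow> V)" if i: "i \<le> n" for i
    using sufficient_iterated_singular_subdivision_exists[OF op[rule_format] cov sc[OF i]] by metis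
  then obtain N where N: "\<And>i m f. \<lbrakk>i \<le> n; N i \<le> m; f \<in> Poly_Mapping.keys ((singular_subdivision i ^^ m) (h i))\<rbrakk> \<Longrightarrow>
     \<exists>V\<in>\<C>. f \<in> standard_simplex i \<rightarrow> V" by metis
  \<comment> \<open>All dimensions are subdivided equally often; otherwise the boundary relation
    linking consecutive chains would be lost.\<close>
  define M where "M = Max (N ` {..n})"
  have M: "N i \<le> M" if "i \<le> n" for i unfolding M_def using that by (intro Max_ge) auto
  define g where "g = (\<lambda>i. (singular_subdivision i ^^ M) (h i))"
  have "singular_subdivision 0 (frag_of v) = frag_of v"
    using singular_subdivision_zero[of "nsphere n" "frag_of v"] sc[of 0] h0 by simp
  then have "(singular_subdivision 0 ^^ k) (frag_of v) = frag_of v" for k by (induction k) auto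
  then have "g 0 = frag_of v" by (simp add: g_def h0)
  moreover have "chain_boundary (Suc i) (g (Suc i)) = g i + frag_cmul ((-1) ^ Suc i) (chain_map i antipode (g i))"
    if "i < n" for i
    unfolding g_def using that
    by (simp only: iterated_subdivision(2)[OF sc] bd iterated_subdivision_add_cmul
        iterated_subdivision(3)[OF sc continuous_map_antipode] Suc_leI less_imp_le)
  moreover have "\<exists>V\<in>\<C>. f \<in> standard_simplex i \<rightarrow> V" if "i \<le> n" "f \<in> Poly_Mapping.keys (g i)" for i f
    using N[OF that(1) M[OF that(1)]] that(2) by (simp add: g_def)
  moreover have "singular_chain i (nsphere n) (g i)" if "i \<le> n" for i
    using iterated_subdivision(1)[OF sc[OF that]] by (simp add: g_def)
  ultimately show ?thesis by blast
qed

text \<open>Without a common zero, each point is labelled by the index of a coordinate that is large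
  after normalisation, with the sign of that coordinate. This labelling is odd and uses only n
  absolute values, whereas a fine chain of dimension n must contain a simplex with n + 1 of
  them.\<close>

theorem Borsuk_Ulam:
  fixes f :: "nat \<Rightarrow> (nat \<Rightarrow> real) \<Rightarrow> real"
  assumes cont: "\<And>j. j < n \<Longrightarrow> continuous_map (nsphere n) euclideanreal (f j)"
    and odd: "\<And>j x. \<lbrakk>j < n; x \<in> topspace (nsphere n)\<rbrakk> \<Longrightarrow> f j (antipode x) = - f j x"
  shows "\<exists>x \<in> topspace (nsphere n). \<forall>j<n. f j x = 0"
proof (rule ccontr)
  assume "\<not> ?thesis"
  then have nz: "\<exists>j<n. f j x \<noteq> 0" if "x \<in> topspace (nsphere n)" for x using that by auto
  define s where "s = (\<lambda>x. \<Sum>j<n. \<bar>f j x\<bar>)"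
  have s: "s x > 0" if x: "x \<in> topspace (nsphere n)" for x
  proof -
    obtain j where "j < n" "f j x \<noteq> 0" using nz[OF x] by auto
    then show ?thesis unfolding s_def by (intro sum_pos2[where i=j]) auto
  qed
  have n0: "0 < n" using nz[OF in_topspace_nsphere] by auto
  define g where "g = (\<lambda>j x. f j x / s x)"
  have contg: "continuous_map (nsphere n) euclideanreal (g j)" if "j < n" for j
    unfolding g_def s_def using s cont that
    by (intro continuous_intros) (auto simp: s_def less_le)
  have oddg: "g j (antipode x) = - g j x" if "j < n" "x \<in> topspace (nsphere n)" for j x
    using that odd by (simp add: g_def s_def)
  have big: "\<exists>j<n. \<bar>g j x\<bar> \<ge> 1 / n" if x: "x \<in> topspace (nsphere n)" for x
  proof (rule ccontr)
    assume "\<not> ?thesis"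
    then have "\<bar>g j x\<bar> < 1 / n" if "j < n" for j using that by auto
    then have "(\<Sum>j<n. \<bar>g j x\<bar>) < (\<Sum>j<n. 1 / n)" using n0 by (intro sum_strict_mono) auto
    moreover have "(\<Sum>j<n. \<bar>g j x\<bar>) = 1"
      using s[OF x] by (simp add: g_def abs_divide sum_divide_distrib[symmetric] s_def)
    ultimately show False using n0 by simp
  qed
  \<comment> \<open>Taking the least index makes the choice agree at antipodal points, as an odd
    labelling requires.\<close>
  define J where "J = (\<lambda>x. LEAST j. j < n \<and> \<bar>g j x\<bar> \<ge> 1 / n)"
  have J: "J x < n \<and> \<bar>g (J x) x\<bar> \<ge> 1 / n" if "x \<in> topspace (nsphere n)" for x
    unfolding J_def using LeastI_ex[OF big[OF that]] .
  define lab :: "(nat \<Rightarrow> real) \<Rightarrow> int" where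
    "lab = (\<lambda>x. (if g (J x) x > 0 then 1 else -1) * int (Suc (J x)))"
  have abslab: "\<bar>lab x\<bar> = int (Suc (J x))" for x by (simp add: lab_def)
  have lab0: "lab x \<noteq> 0" for x by (simp add: lab_def)
  have labodd: "lab (antipode x) = - lab x" if x: "x \<in> topspace (nsphere n)" for x
  proof -
    have "J (antipode x) = J x"
      unfolding J_def by (intro arg_cong[where f=Least] ext) (auto simp: oddg[OF _ x])
    moreover have "g (J x) x \<noteq> 0" using J[OF x] n0 by auto
    ultimately show ?thesis using J[OF x] oddg[OF _ x] by (auto simp: lab_def)
  qed
  \<comment> \<open>The radius fits the threshold: coordinates of two points of \<open>W x\<close>
    differ by less than 2/n, while opposite labels force a difference of at least 2/n.\<close>
  define W where "W = (\<lambda>x. {y \<in> topspace (nsphere n). \<forall>j<n. g j y \<in> ball (g j x) (1 / n)})"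
  have "openin (nsphere n) (W x)" for x
  proof -
    have "W x = topspace (nsphere n) \<inter> (\<Inter>j\<in>{..<n}. {y \<in> topspace (nsphere n). g j y \<in> ball (g j x) (1 / n)})"
      by (auto simp: W_def)
    moreover have "openin (nsphere n) {y \<in> topspace (nsphere n). g j y \<in> ball (g j x) (1 / n)}" if "j < n" for j
      by (rule openin_continuous_map_preimage[OF contg[OF that]]) (simp add: open_openin[symmetric])
    ultimately show ?thesis
      using n0 by (auto intro!: openin_Int openin_Inter)
  qed
  then have opW: "\<forall>U \<in> W ` topspace (nsphere n). openin (nsphere n) U"
    by auto
  have covW: "topspace (nsphere n) \<subseteq> \<Union> (W ` topspace (nsphere n))"
    using n0 by (auto simp: W_def)
  obtain h v where h: "h 0 = frag_of v" "\<forall>i\<le>n. singular_chain i (nsphere n) (h i)"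
     "\<forall>i<n. chain_boundary (Suc i) (h (Suc i)) = h i + frag_cmul ((-1) ^ Suc i) (chain_map i antipode (h i))"
     "\<forall>i\<le>n. \<forall>f \<in> Poly_Mapping.keys (h i). \<exists>V\<in>W ` topspace (nsphere n). f \<in> standard_simplex i \<rightarrow> V"
    using small_hemisphere_chains[of "W ` topspace (nsphere n)" n, OF opW covW] by - (elim exE conjE, rule that)
  note small = h(4)[rule_format]
  have "\<exists>\<sigma> \<in> Poly_Mapping.keys (h n). inj_on (\<lambda>i. \<bar>lab (\<sigma> (vtx i))\<bar>) {..n}"
  proof (rule alternating_simplex_exists[where X="nsphere n" and t=antipode and v=v])
    show "singular_chain i (nsphere n) (h i)" if "i \<le> n" for i using h(2) that by blast
    show "h 0 = frag_of v" by (rule h(1))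
    show "chain_boundary (Suc i) (h (Suc i)) = h i + frag_cmul ((-1) ^ Suc i) (chain_map i antipode (h i))"
      if "i < n" for i using h(3) that by blast
    show "lab (antipode x) = - lab x" "lab x \<noteq> 0" if "x \<in> topspace (nsphere n)" for x
      using labodd[OF that] lab0 by auto
  next
    fix p \<sigma> i j assume p: "p \<le> n" "\<sigma> \<in> Poly_Mapping.keys (h p)" "i \<le> p" "j \<le> p"
    obtain x where "\<sigma> \<in> standard_simplex p \<rightarrow> W x" using small[OF p(1,2)] by auto
    then have in_W: "\<sigma> (vtx i) \<in> W x" "\<sigma> (vtx j) \<in> W x"
      using vtx_in_standard_simplex p by blast+
    define a where "a = \<sigma> (vtx i)"
    define b where "b = \<sigma> (vtx j)"
    have ab: "a \<in> W x" "b \<in> W x" using in_W by (auto simp: a_def b_def)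
    then have top: "a \<in> topspace (nsphere n)" "b \<in> topspace (nsphere n)" by (auto simp: W_def)
    show "lab (\<sigma> (vtx i)) \<noteq> - lab (\<sigma> (vtx j))"
    proof
      assume "lab (\<sigma> (vtx i)) = - lab (\<sigma> (vtx j))"
      then have eq: "lab a = - lab b" by (simp add: a_def b_def)
      then have JJ: "J a = J b" using abslab[of a] abslab[of b] by simp
      let ?k = "J b"
      have k: "?k < n" "\<bar>g ?k a\<bar> \<ge> 1 / n" "\<bar>g ?k b\<bar> \<ge> 1 / n"
        using J[OF top(1)] J[OF top(2)] JJ by auto
      have opp: "(g ?k a > 0) \<noteq> (g ?k b > 0)"
        using eq JJ by (auto simp: lab_def split: if_splits)
      have "\<bar>g ?k a - g ?k x\<bar> < 1 / n" "\<bar>g ?k b - g ?k x\<bar> < 1 / n"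
        using ab k(1) by (auto simp: W_def dist_real_def abs_minus_commute)
      then show False using k opp by linarith
    qed
  qed
  then obtain \<sigma> where \<sigma>: "\<sigma> \<in> Poly_Mapping.keys (h n)" "inj_on (\<lambda>i. \<bar>lab (\<sigma> (vtx i))\<bar>) {..n}" by auto
  have "(\<lambda>i. \<bar>lab (\<sigma> (vtx i))\<bar>) ` {..n} \<subseteq> {1..int n}"
  proof clarify
    fix i assume i: "i \<le> n"
    obtain x where "\<sigma> \<in> standard_simplex n \<rightarrow> W x" using small[OF order_refl \<sigma>(1)] by auto
    then have "\<sigma> (vtx i) \<in> W x" using vtx_in_standard_simplex[OF i] by blast
    then have "\<sigma> (vtx i) \<in> topspace (nsphere n)" by (auto simp: W_def)
    from J[OF this] show "\<bar>lab (\<sigma> (vtx i))\<bar> \<in> {1..int n}" by (simp add: abslab)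
  qed
  then have "card {..n} \<le> card {1..int n}"
    by (metis \<sigma>(2) card_inj_on_le finite_atLeastAtMost_int)
  then show False by simp
qed

section \<open>Polynomial partitioning\<close>

text \<open>The odd functions below vanish exactly when no strict majority of \<open>S j\<close> lies on one
  side; summing over all majorities makes them continuous without any general position.\<close>

theorem discrete_ham_sandwich:
  fixes \<phi> :: "nat \<Rightarrow> 'p \<Rightarrow> real" and S :: "nat \<Rightarrow> 'p set"
  assumes fin: "\<And>j. j < n \<Longrightarrow> finite (S j)"
  shows "\<exists>x. (\<exists>i\<le>n. x i \<noteq> 0) \<and>
    (\<forall>j<n. 2 * card {p \<in> S j. (\<Sum>i\<le>n. x i * \<phi> i p) > 0} \<le> card (S j) \<and>
           2 * card {p \<in> S j. (\<Sum>i\<le>n. x i * \<phi> i p) < 0} \<le> card (S j))"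
proof -
  define F where "F = (\<lambda>x p. \<Sum>i\<le>n. x i * \<phi> i p)"
  define Maj where "Maj = (\<lambda>j. {T \<in> Pow (S j). card (S j) < 2 * card T})"
  define G where "G = (\<lambda>j x. \<Sum>T\<in>Maj j. \<Prod>p\<in>T. max (F x p) 0)"
  have F_odd: "F (antipode x) p = - F x p" for x p
    by (simp add: F_def sum_negf)
  have finMaj: "finite (Maj j)" if "j < n" for j using fin[OF that] by (simp add: Maj_def)
  have finT: "finite T" if "j < n" "T \<in> Maj j" for j T
    using fin[OF that(1)] that(2) by (auto simp: Maj_def intro: finite_subset)
  have contF: "continuous_map (nsphere n) euclideanreal (\<lambda>x. F x p)" for p
    unfolding F_def by (intro continuous_intros continuous_map_nsphere_projection) auto
  have contG: "continuous_map (nsphere n) euclideanreal (G j)" if "j < n" for j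
    unfolding G_def using finMaj[OF that] finT[OF that]
    by (intro continuous_intros contF) auto
  have contG': "continuous_map (nsphere n) euclideanreal (\<lambda>x. G j (antipode x))" if "j < n" for j
    using continuous_map_compose[OF continuous_map_antipode contG[OF that]] by (simp add: o_def)
  have G_nonneg: "G j x \<ge> 0" for j x
    unfolding G_def by (intro sum_nonneg prod_nonneg) auto
  have G_pos: "G j x > 0" if "j < n" "card (S j) < 2 * card {p \<in> S j. F x p > 0}" for j x
    unfolding G_def
    by (rule sum_pos2[where i="{p \<in> S j. F x p > 0}"])
       (use that finMaj in \<open>auto simp: Maj_def intro!: prod_pos prod_nonneg\<close>)
  have posG: "card (S j) < 2 * card {p \<in> S j. F x p > 0}" if j: "j < n" and "G j x \<noteq> 0" for j x
  proof -
    obtain T where T: "T \<in> Maj j" "(\<Prod>p\<in>T. max (F x p) 0) \<noteq> 0"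
      using \<open>G j x \<noteq> 0\<close> unfolding G_def by (rule sum.not_neutral_contains_not_neutral)
    then have "T \<subseteq> {p \<in> S j. F x p > 0}"
    proof -
      have nz: "max (F x p) 0 \<noteq> 0" if "p \<in> T" for p using T(2) finT[OF j T(1)] that by auto
      have "F x p > 0" if "p \<in> T" for p
        using nz[OF that] by (auto simp: max_def split: if_splits)
      moreover have "T \<subseteq> S j" using T(1) by (auto simp: Maj_def)
      ultimately show ?thesis by auto
    qed
    then have "card T \<le> card {p \<in> S j. F x p > 0}" using fin[OF j] by (intro card_mono) auto
    then show ?thesis using T(1) by (auto simp: Maj_def)
  qed
  have "\<exists>x \<in> topspace (nsphere n). \<forall>j<n. G j x - G j (antipode x) = 0"
  proof (rule Borsuk_Ulam)
    show "continuous_map (nsphere n) euclideanreal (\<lambda>x. G j x - G j (antipode x))" if "j < n" for j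
      by (intro continuous_intros contG contG' that)
  qed simp
  then obtain x where x: "x \<in> topspace (nsphere n)" "\<And>j. j < n \<Longrightarrow> G j x = G j (antipode x)"
    by auto
  have neg: "{p \<in> S j. F (antipode x) p > 0} = {p \<in> S j. F x p < 0}" for j
    by (simp add: F_odd)
  \<comment> \<open>The equality of the two values leaves no majority on either side or a strict
    majority on both, and two disjoint strict majorities do not fit into \<open>S j\<close>.\<close>
  have "G j x = 0" if j: "j < n" for j
  proof (rule ccontr)
    assume nz: "G j x \<noteq> 0"
    then have "G j (antipode x) \<noteq> 0" using x(2)[OF j] by simp
    define A B where "A = {p \<in> S j. F x p > 0}" and "B = {p \<in> S j. F x p < 0}"
    have "card (S j) < 2 * card A" "card (S j) < 2 * card B"
      using posG[OF j nz] posG[OF j \<open>G j (antipode x) \<noteq> 0\<close>] unfolding A_def B_def neg by auto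
    moreover have AB: "A \<subseteq> S j" "B \<subseteq> S j" "A \<inter> B = {}" by (auto simp: A_def B_def)
    then have "card (A \<union> B) = card A + card B"
      using fin[OF j] finite_subset by (metis card_Un_disjoint)
    moreover have "card (A \<union> B) \<le> card (S j)"
      using AB fin[OF j] by (intro card_mono) auto
    ultimately show False by simp
  qed
  then have "2 * card {p \<in> S j. F x p > 0} \<le> card (S j)" "2 * card {p \<in> S j. F x p < 0} \<le> card (S j)"
    if "j < n" for j
    using G_pos[OF that, of x] G_pos[OF that, of "antipode x"] x(2)[OF that] that
    unfolding neg by (metis less_irrefl not_less)+
  moreover have "\<exists>i\<le>n. x i \<noteq> 0"
  proof (rule ccontr)
    assume "\<not> ?thesis"
    then have "(\<Sum>i\<le>n. (x i)\<^sup>2) = 0" by (intro sum.neutral) auto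
    then show False using x(1) by (simp add: nsphere)
  qed
  ultimately show ?thesis unfolding F_def by blast
qed

section \<open>Weighted polynomials in three variables\<close>

type_synonym pt = "real \<times> real \<times> real"

definition mono3 :: "nat \<Rightarrow> nat \<Rightarrow> nat \<Rightarrow> pt \<Rightarrow> real" where
  "mono3 i j k = (\<lambda>(x, y, z). x ^ i * y ^ j * z ^ k)"

text \<open>Polynomial functions in which the third coordinate has weight \<open>w\<close>. The
  weight matches the curves used later, whose coordinates have degrees 1, 1 and \<open>w\<close> in
  the parameter: a restriction then has degree at most \<open>d\<close>.\<close>

inductive wpoly :: "nat \<Rightarrow> nat \<Rightarrow> (pt \<Rightarrow> real) \<Rightarrow> bool" for w d where
  zero: "wpoly w d (\<lambda>_. 0)"
| add: "wpoly w d f \<Longrightarrow> i + j + w * k \<le> d \<Longrightarrow> wpoly w d (\<lambda>p. f p + c * mono3 i j k p)"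

lemma wpoly_mono3: "i + j + w * k \<le> d \<Longrightarrow> wpoly w d (\<lambda>p. c * mono3 i j k p)"
  using wpoly.add[OF wpoly.zero, of i j w k d c] by simp

lemma wpoly_add:
  assumes "wpoly w d f" "wpoly w d g"
  shows "wpoly w d (\<lambda>p. f p + g p)"
  using assms(2)
proof induction
  case zero
  then show ?case using assms(1) by simp
next
  case (add g i j k c)
  then show ?case using wpoly.add[OF add.IH add.hyps(2), of c] by (simp add: algebra_simps)
qed

lemma wpoly_sum: "(\<And>i. i \<in> I \<Longrightarrow> wpoly w d (f i)) \<Longrightarrow> wpoly w d (\<lambda>p. \<Sum>i\<in>I. f i p)"
  by (induction I rule: infinite_finite_induct) (auto intro: wpoly.zero wpoly_add)

lemma wpoly_le: "wpoly w d f \<Longrightarrow> d \<le> d' \<Longrightarrow> wpoly w d' f"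
  by (induction rule: wpoly.induct) (auto intro: wpoly.intros)

lemma mono3_mult: "mono3 i j k p * mono3 i' j' k' p = mono3 (i + i') (j + j') (k + k') p"
  by (auto simp: mono3_def power_add split: prod.splits)

lemma wpoly_mult:
  assumes "wpoly w d f" "wpoly w e g"
  shows "wpoly w (d + e) (\<lambda>p. f p * g p)"
  using assms(2)
proof induction
  case zero
  then show ?case using wpoly.zero by simp
next
  case (add g i j k c)
  have "wpoly w (d + e) (\<lambda>p. f p * (c * mono3 i j k p))"
    using assms(1)
  proof induction
    case zero
    then show ?case using wpoly.zero by simp
  next
    case (add f i' j' k' c')
    have "wpoly w (d + e) (\<lambda>p. (c * c') * mono3 (i + i') (j + j') (k + k') p)"
      by (rule wpoly_mono3) (use add.hyps \<open>i + j + w * k \<le> e\<close> in \<open>simp add: algebra_simps\<close>)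
    from wpoly_add[OF add.IH this] show ?case
      by (simp add: algebra_simps mono3_mult[symmetric])
  qed
  from wpoly_add[OF add.IH this] show ?case by (simp add: algebra_simps)
qed

lemma continuous_on_wpoly:
  assumes "wpoly w d f" "continuous_on A g"
  shows "continuous_on A (\<lambda>t. f (g t))"
  using assms(1)
proof induction
  case (add f i j k c)
  have "continuous_on A (\<lambda>t. mono3 i j k (g t))"
    unfolding mono3_def case_prod_unfold by (intro continuous_intros assms(2))
  then show ?case using add by (intro continuous_intros)
qed (rule continuous_on_const)

lemma wpoly_compose_poly:
  fixes a b c :: "real poly"
  assumes "wpoly w d f" and deg: "degree a \<le> 1" "degree b \<le> 1" "degree c \<le> w"
  shows "\<exists>q. degree q \<le> d \<and> (\<forall>t. f (poly a t, poly b t, poly c t) = poly q t)"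
  using assms(1)
proof induction
  case zero
  then show ?case by (intro exI[of _ 0]) simp
next
  case (add f i j k e)
  then obtain q where q: "degree q \<le> d" "\<And>t. f (poly a t, poly b t, poly c t) = poly q t" by blast
  have pow: "degree (p ^ n) \<le> e * n" if "degree p \<le> e" for p :: "real poly" and n e
    by (rule order_trans[OF degree_power_le mult_right_mono[OF that]]) simp
  have "degree (a ^ i) \<le> i" "degree (b ^ j) \<le> j" "degree (c ^ k) \<le> w * k"
    using pow[OF deg(1), of i] pow[OF deg(2), of j] pow[OF deg(3), of k] by simp_all
  then have "degree (a ^ i * b ^ j * c ^ k) \<le> d"
    using degree_mult_le[of "a ^ i * b ^ j" "c ^ k"] degree_mult_le[of "a ^ i" "b ^ j"] add.hyps(2)
    by linarith
  then show ?case
    using q by (intro exI[of _ "q + Polynomial.smult e (a ^ i * b ^ j * c ^ k)"])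
      (auto simp: mono3_def intro!: degree_add_le order.trans[OF Polynomial.degree_smult_le])
qed

text \<open>On the line through p and q both functions become nonzero univariate polynomials, and
  these have no zero divisors. The line is an admissible curve because \<open>w\<close> is at least
  1.\<close>

lemma wpoly_mult_nonzero:
  assumes f: "wpoly w d f" "f p \<noteq> 0" and g: "wpoly w e g" "g q \<noteq> 0" and w: "w \<ge> 1"
  shows "\<exists>r. f r * g r \<noteq> 0"
proof -
  obtain p1 p2 p3 q1 q2 q3 where p: "p = (p1, p2, p3)" and q: "q = (q1, q2, q3)"
    by (metis prod_cases3)
  define L where "L = (\<lambda>u v. [:u, v - u:] :: real poly)"
  have deg: "degree (L u v) \<le> 1" "degree (L u v) \<le> w" for u v
    using w by (auto simp: L_def)
  obtain F where F: "\<And>t. f (poly (L p1 q1) t, poly (L p2 q2) t, poly (L p3 q3) t) = poly F t"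
    using wpoly_compose_poly[OF f(1) deg(1) deg(1) deg(2)] by blast
  obtain G where G: "\<And>t. g (poly (L p1 q1) t, poly (L p2 q2) t, poly (L p3 q3) t) = poly G t"
    using wpoly_compose_poly[OF g(1) deg(1) deg(1) deg(2)] by blast
  have "poly F 0 \<noteq> 0" "poly G 1 \<noteq> 0"
    using F[of 0] G[of 1] f(2) g(2) by (auto simp: L_def p q)
  then have "F * G \<noteq> 0" by auto
  then obtain t where "poly (F * G) t \<noteq> 0" by (metis poly_all_0_iff_0)
  then show ?thesis using F[of t] G[of t] by (metis poly_mult)
qed

lemma wpoly_degree_0: "wpoly w 0 f \<Longrightarrow> w \<ge> 1 \<Longrightarrow> \<exists>c. f = (\<lambda>_. c)"
proof (induction rule: wpoly.induct)
  case (add f i j k c)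
  then obtain c' where "f = (\<lambda>_. c')" by auto
  moreover have "mono3 i j k p = 1" for p using add by (auto simp: mono3_def split: prod.splits)
  ultimately show ?case by auto
qed auto

text \<open>The substitution \<open>(t, t ^ m, t ^ (m * m))\<close> turns the monomials of the box into the powers of \<open>t\<close>.\<close>

definition box_mono :: "nat \<Rightarrow> nat \<Rightarrow> pt \<Rightarrow> real" where
  "box_mono m i = mono3 (i mod m) (i div m mod m) (i div (m * m))"

lemma box_mono_nonzero:
  assumes "\<exists>i\<le>n. x i \<noteq> 0"
  shows "\<exists>p. (\<Sum>i\<le>n. x i * box_mono m i p) \<noteq> 0"
proof -
  have "box_mono m i (t, t ^ m, t ^ (m * m)) = t ^ i" for i and t :: real
  proof -
    have "i mod m + m * (i div m mod m) + m * m * (i div (m * m)) = i"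
      by (metis ab_semigroup_add_class.add_ac(1) add.commute div_mult2_eq mod_mult2_eq mult_div_mod_eq)
    then show ?thesis
      by (simp add: box_mono_def mono3_def power_mult[symmetric] power_add[symmetric])
  qed
  moreover obtain t where "(\<Sum>i\<le>n. x i * t ^ i) \<noteq> 0"
    using assms polyfun_eq_0[of x n] by blast
  ultimately show ?thesis by (intro exI[of _ "(t, t ^ m, t ^ (m * m))"]) simp
qed

text \<open>The three base-(q + 1) digits of i are at most q; the first two cost q each and the
  third at most 2q, which gives 4q.\<close>

lemma wpoly_box:
  assumes "n < (q + 1) ^ 3" "w \<le> 2"
  shows "wpoly w (4 * q) (\<lambda>p. \<Sum>i\<le>n. x i * box_mono (q + 1) i p)"
proof (rule wpoly_sum)
  fix i assume "i \<in> {..n}"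
  then have "i < (q + 1) * ((q + 1) * (q + 1))" using assms by (simp add: power3_eq_cube algebra_simps)
  then have k: "i div ((q + 1) * (q + 1)) \<le> q"
    by (metis Suc_eq_plus1 less_Suc_eq_le less_mult_imp_div_less)
  have "w * (i div ((q + 1) * (q + 1))) \<le> 2 * q"
    using mult_le_mono[OF assms(2) k] .
  moreover have "i mod (q + 1) < q + 1" "i div (q + 1) mod (q + 1) < q + 1"
    by (intro mod_less_divisor; simp)+
  ultimately show "wpoly w (4 * q) (\<lambda>p. x i * box_mono (q + 1) i p)"
    unfolding box_mono_def by (intro wpoly_mono3) linarith
qed

section \<open>Partitioning polynomials\<close>

lemma polynomial_ham_sandwich:
  fixes S :: "nat \<Rightarrow> pt set"
  assumes fin: "\<And>j. j < n \<Longrightarrow> finite (S j)" and n: "n < (q + 1) ^ 3" and w: "w \<le> 2"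
  shows "\<exists>f. wpoly w (4 * q) f \<and> (\<exists>p. f p \<noteq> 0) \<and>
    (\<forall>j<n. 2 * card {p \<in> S j. f p > 0} \<le> card (S j) \<and> 2 * card {p \<in> S j. f p < 0} \<le> card (S j))"
proof -
  obtain x where x: "\<exists>i\<le>n. x i \<noteq> 0"
    "\<forall>j<n. 2 * card {p \<in> S j. (\<Sum>i\<le>n. x i * box_mono (q + 1) i p) > 0} \<le> card (S j) \<and>
           2 * card {p \<in> S j. (\<Sum>i\<le>n. x i * box_mono (q + 1) i p) < 0} \<le> card (S j)"
    using discrete_ham_sandwich[of n S "box_mono (q + 1)"] fin by blast
  show ?thesis
    by (intro exI[of _ "\<lambda>p. \<Sum>i\<le>n. x i * box_mono (q + 1) i p"] conjI wpoly_box n w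
        box_mono_nonzero x)
qed

text \<open>Cells are indexed by the sign vector of the successive bisecting polynomials, so that a
  connected set avoiding the zeros of their product \<open>f\<close> stays in one cell.\<close>

definition cell_partition :: "nat \<Rightarrow> nat \<Rightarrow> pt set \<Rightarrow> nat \<Rightarrow> (pt \<Rightarrow> real) \<Rightarrow> (pt \<Rightarrow> nat) \<Rightarrow> bool" where
  "cell_partition w d S N f \<kappa> \<longleftrightarrow>
     wpoly w d f \<and> (\<exists>p. f p \<noteq> 0) \<and> (\<forall>p. \<kappa> p < N) \<and>
     (\<forall>i. N * card {p \<in> S. f p \<noteq> 0 \<and> \<kappa> p = i} \<le> card S) \<and>
     (\<forall>\<gamma> a b. a \<le> b \<longrightarrow> continuous_on {a..b} \<gamma> \<longrightarrow> (\<forall>t\<in>{a..b}. f (\<gamma> t) \<noteq> 0) \<longrightarrow> \<kappa> (\<gamma> a) = \<kappa> (\<gamma> (b::real)))"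

text \<open>One polynomial bisects all \<open>N\<close> cells simultaneously, so doubling their
  number costs a degree of order N^(1/3) only.\<close>

lemma cell_partition_refine:
  assumes S: "finite S" and P: "cell_partition w d S N f \<kappa>" and q: "N < (q + 1) ^ 3" and w: "1 \<le> w" "w \<le> 2"
  shows "\<exists>f \<kappa>. cell_partition w (d + 4 * q) S (2 * N) f \<kappa>"
proof -
  define T where "T = (\<lambda>i. {p \<in> S. f p \<noteq> 0 \<and> \<kappa> p = i})"
  have finT: "finite (T i)" for i using S by (simp add: T_def)
  have f: "wpoly w d f" "\<exists>p. f p \<noteq> 0" "\<And>p. \<kappa> p < N" "\<And>i. N * card (T i) \<le> card S"
    and conn: "\<And>\<gamma> a b. \<lbrakk>a \<le> b; continuous_on {a..b} \<gamma>; \<forall>t\<in>{a..b}. f (\<gamma> t) \<noteq> 0\<rbrakk> \<Longrightarrow> \<kappa> (\<gamma> a) = \<kappa> (\<gamma> (b::real))"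
    using P by (auto simp: cell_partition_def T_def)
  obtain g where g: "wpoly w (4 * q) g" "\<exists>p. g p \<noteq> 0"
    "\<And>i. i < N \<Longrightarrow> 2 * card {p \<in> T i. g p > 0} \<le> card (T i)"
    "\<And>i. i < N \<Longrightarrow> 2 * card {p \<in> T i. g p < 0} \<le> card (T i)"
    using polynomial_ham_sandwich[OF _ q w(2), of T] finT by blast
  define F where "F = (\<lambda>p. f p * g p)"
  \<comment> \<open>Zeros of \<open>g\<close> receive the bit 0. This is harmless, since cell sizes
    and paths are only considered off the zeros of \<open>F\<close>.\<close>
  define \<mu> where "\<mu> = (\<lambda>p. 2 * \<kappa> p + (if g p > 0 then 1 else 0))"
  have "wpoly w (d + 4 * q) F" unfolding F_def by (rule wpoly_mult[OF f(1) g(1)])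
  moreover have "\<exists>p. F p \<noteq> 0"
    unfolding F_def using wpoly_mult_nonzero[OF f(1) _ g(1) _ w(1)] f(2) g(2) by blast
  moreover have "\<mu> p < 2 * N" for p using f(3)[of p] by (simp add: \<mu>_def)
  moreover have "2 * N * card {p \<in> S. F p \<noteq> 0 \<and> \<mu> p = i} \<le> card S" for i
  proof (cases "i div 2 < N")
    case True
    have "{p \<in> S. F p \<noteq> 0 \<and> \<mu> p = i} \<subseteq>
        (if odd i then {p \<in> T (i div 2). g p > 0} else {p \<in> T (i div 2). g p < 0})"
      by (auto simp: F_def \<mu>_def T_def)
    then have "card {p \<in> S. F p \<noteq> 0 \<and> \<mu> p = i} \<le>
        card (if odd i then {p \<in> T (i div 2). g p > 0} else {p \<in> T (i div 2). g p < 0})"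
      using finT by (intro card_mono) (auto split: if_splits)
    then have "2 * card {p \<in> S. F p \<noteq> 0 \<and> \<mu> p = i} \<le> card (T (i div 2))"
      using g(3,4)[OF True] by (auto split: if_splits)
    then have "N * (2 * card {p \<in> S. F p \<noteq> 0 \<and> \<mu> p = i}) \<le> N * card (T (i div 2))"
      by (rule mult_le_mono2)
    also have "\<dots> \<le> card S" by (rule f(4))
    finally show ?thesis by (simp add: mult_ac)
  next
    case False
    have "\<mu> p div 2 < N" for p using f(3)[of p] by (simp add: \<mu>_def)
    then have "{p \<in> S. F p \<noteq> 0 \<and> \<mu> p = i} = {}" using False by auto
    then show ?thesis by (simp only: card.empty mult_0_right zero_le)
  qed
  moreover have "\<mu> (\<gamma> a) = \<mu> (\<gamma> b)"
    if ab: "a \<le> b" and cont: "continuous_on {a..b} \<gamma>" and nz: "\<forall>t\<in>{a..b}. F (\<gamma> t) \<noteq> 0" for \<gamma> and a b :: real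
  proof -
    have 1: "\<kappa> (\<gamma> a) = \<kappa> (\<gamma> b)" using conn[OF ab cont] nz by (auto simp: F_def)
    have contg: "continuous_on {a..b} (\<lambda>t. g (\<gamma> t))" by (rule continuous_on_wpoly[OF g(1) cont])
    have "g (\<gamma> a) > 0 \<longleftrightarrow> g (\<gamma> b) > 0"
    proof (rule ccontr)
      assume "\<not> ?thesis"
      then have "(g (\<gamma> a) \<le> 0 \<and> 0 \<le> g (\<gamma> b)) \<or> (g (\<gamma> b) \<le> 0 \<and> 0 \<le> g (\<gamma> a))" by auto
      then obtain t where "t \<in> {a..b}" "g (\<gamma> t) = 0"
        using IVT'[OF _ _ ab contg, of 0] IVT2'[OF _ _ ab contg, of 0] by auto
      then show False using nz by (auto simp: F_def)
    qed
    then show ?thesis using 1 by (simp add: \<mu>_def)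
  qed
  ultimately show ?thesis unfolding cell_partition_def by blast
qed

theorem cell_partition_exists:
  assumes S: "finite S" and w: "1 \<le> w" "w \<le> 2"
  shows "\<exists>f \<kappa>. cell_partition w (24 * 2 ^ L) S (8 ^ L) f \<kappa>"
proof -
  \<comment> \<open>The slack 24 lets the geometric sum close: a step from \<open>L\<close> to
    \<open>Suc L\<close> adds 24 * 2^L, exactly the growth of the bound.\<close>
  have "\<exists>f \<kappa> d. cell_partition w d S (8 ^ L) f \<kappa> \<and> d + 24 \<le> 24 * 2 ^ L"
  proof (induction L)
    case 0
    have "cell_partition w 0 S 1 (\<lambda>p. 1 * mono3 0 0 0 p) (\<lambda>_. 0)"
      unfolding cell_partition_def using card_mono[OF S]
      by (auto intro!: wpoly_mono3[of 0 0 w 0 0 1, simplified]) (auto simp: mono3_def)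
    then show ?case by (intro exI[of _ "\<lambda>p. 1 * mono3 0 0 0 p"] exI[of _ "\<lambda>_. 0"] exI[of _ 0]) simp
  next
    case (Suc L)
    then obtain f0 \<kappa>0 d where P0: "cell_partition w d S (8 ^ L) f0 \<kappa>0" and d: "d + 24 \<le> 24 * 2 ^ L"
      by blast
    \<comment> \<open>Three bisections multiply the number of cells by 8. They act on 8^L, 2 * 8^L
      and 4 * 8^L cells, all fewer than (q + 1)^3, so the same q serves each time.\<close>
    define q :: nat where "q = 2 ^ Suc L"
    have "8 * 8 ^ L = q ^ 3"
      by (simp add: q_def power_mult_distrib power_mult[symmetric] mult.commute[of L 3]) (simp add: power_mult)
    also have "q ^ 3 < (q + 1) ^ 3" by (rule power_strict_mono) auto
    finally have q: "8 * 8 ^ L < (q + 1) ^ 3" .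
    obtain f1 \<kappa>1 where P1: "cell_partition w (d + 4 * q) S (2 * 8 ^ L) f1 \<kappa>1"
      using cell_partition_refine[OF S P0 _ w, of q] q by auto
    obtain f2 \<kappa>2 where P2: "cell_partition w (d + 4 * q + 4 * q) S (2 * (2 * 8 ^ L)) f2 \<kappa>2"
      using cell_partition_refine[OF S P1 _ w, of q] q by auto
    obtain f3 \<kappa>3 where P3: "cell_partition w (d + 4 * q + 4 * q + 4 * q) S (2 * (2 * (2 * 8 ^ L))) f3 \<kappa>3"
      using cell_partition_refine[OF S P2 _ w, of q] q by auto
    have "cell_partition w (d + 12 * q) S (8 ^ Suc L) f3 \<kappa>3" using P3 by (simp add: algebra_simps)
    moreover have "d + 12 * q + 24 \<le> 24 * 2 ^ Suc L" using d by (simp add: q_def)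
    ultimately show ?case by blast
  qed
  then obtain f \<kappa> d where P: "cell_partition w d S (8 ^ L) f \<kappa>" and d: "d \<le> 24 * 2 ^ L" by auto
  from P have "cell_partition w (24 * 2 ^ L) S (8 ^ L) f \<kappa>"
    unfolding cell_partition_def using wpoly_le[OF _ d] by blast
  then show ?thesis by blast
qed

section \<open>Incidences with curves\<close>

lemma wpoly_mono3':
  assumes "c \<noteq> 0 \<Longrightarrow> i + j + w * k \<le> d"
  shows "wpoly w d (\<lambda>p. c * mono3 i j k p)"
  using assms wpoly_mono3[of i j w k d c] wpoly.zero[of w d] by (cases "c = 0") auto

text \<open>The three functions are the formal partial derivatives; all that is needed of them is
  the chain rule along curves and the degrees. For weight 2, differentiating in z loses two units
  and the factor y restores one, so \<open>fx + y fz\<close> is homogeneous of the same degree as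
  \<open>fy\<close>: both lose one.\<close>

lemma wpoly_chain_rule:
  assumes "wpoly w d f"
  obtains fx fy fz where
    "\<And>a b c a' b' c' t. \<lbrakk>(a has_real_derivative a') (at t); (b has_real_derivative b') (at t); (c has_real_derivative c') (at t)\<rbrakk>
      \<Longrightarrow> ((\<lambda>s. f (a s, b s, c s)) has_real_derivative
            fx (a t, b t, c t) * a' + fy (a t, b t, c t) * b' + fz (a t, b t, c t) * c') (at t)"
    "w = 1 \<Longrightarrow> wpoly w (d - 1) fx" "w = 1 \<Longrightarrow> wpoly w (d - 1) fz" "wpoly w (d - 1) fy"
    "w = 2 \<Longrightarrow> wpoly w (d - 1) (\<lambda>p. fx p + fst (snd p) * fz p)"
proof -
  have "\<exists>fx fy fz.
    (\<forall>a b c a' b' c' t. (a has_real_derivative a') (at t) \<longrightarrow> (b has_real_derivative b') (at t) \<longrightarrow> (c has_real_derivative c') (at t)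
      \<longrightarrow> ((\<lambda>s. f (a s, b s, c s)) has_real_derivative
            fx (a t, b t, c t) * a' + fy (a t, b t, c t) * b' + fz (a t, b t, c t) * c') (at t)) \<and>
    (w = 1 \<longrightarrow> wpoly w (d - 1) fx \<and> wpoly w (d - 1) fz) \<and> wpoly w (d - 1) fy \<and>
    (w = 2 \<longrightarrow> wpoly w (d - 1) (\<lambda>p. fx p + fst (snd p) * fz p))"
    using assms
  proof induction
    case zero
    show ?case
      by (intro exI[of _ "\<lambda>_. 0"]) (auto intro: wpoly.zero)
  next
    case (add f i j k e)
    then obtain fx fy fz where
      D: "\<And>a b c a' b' c' t. \<lbrakk>(a has_real_derivative a') (at t); (b has_real_derivative b') (at t); (c has_real_derivative c') (at t)\<rbrakk>
      \<Longrightarrow> ((\<lambda>s. f (a s, b s, c s)) has_real_derivative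
            fx (a t, b t, c t) * a' + fy (a t, b t, c t) * b' + fz (a t, b t, c t) * c') (at t)"
      and W1: "w = 1 \<Longrightarrow> wpoly w (d - 1) fx" "w = 1 \<Longrightarrow> wpoly w (d - 1) fz" "wpoly w (d - 1) fy"
      and W2: "w = 2 \<Longrightarrow> wpoly w (d - 1) (\<lambda>p. fx p + fst (snd p) * fz p)"
      by blast
    define gx where "gx = (\<lambda>p. fx p + (e * real i) * mono3 (i - 1) j k p)"
    define gy where "gy = (\<lambda>p. fy p + (e * real j) * mono3 i (j - 1) k p)"
    define gz where "gz = (\<lambda>p. fz p + (e * real k) * mono3 i j (k - 1) p)"
    have "((\<lambda>s. f (a s, b s, c s) + e * mono3 i j k (a s, b s, c s)) has_real_derivative
            gx (a t, b t, c t) * a' + gy (a t, b t, c t) * b' + gz (a t, b t, c t) * c') (at t)"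
      if d: "(a has_real_derivative a') (at t)" "(b has_real_derivative b') (at t)" "(c has_real_derivative c') (at t)"
      for a b c a' b' c' t
    proof -
      have "((\<lambda>s. e * (a s ^ i * b s ^ j * c s ^ k)) has_real_derivative
          e * ((a t ^ i * b t ^ j) * (real k * c t ^ (k - 1) * c') +
            (a t ^ i * (real j * b t ^ (j - 1) * b') + real i * a t ^ (i - 1) * a' * b t ^ j) * c t ^ k)) (at t)"
        by (auto intro!: derivative_eq_intros d simp: algebra_simps)
      from DERIV_add[OF D[OF d] this] show ?thesis
        unfolding mono3_def gx_def gy_def gz_def prod.case
        by (rule DERIV_cong) (simp add: algebra_simps)
    qed
    moreover have "wpoly w (d - 1) gy"
      unfolding gy_def by (rule wpoly_add[OF W1(3) wpoly_mono3']) (use add.hyps in auto)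
    moreover have "wpoly w (d - 1) gx" "wpoly w (d - 1) gz" if "w = 1"
      unfolding gx_def gz_def
      by (rule wpoly_add[OF W1(1)[OF that] wpoly_mono3'], use add.hyps that in force,
          rule wpoly_add[OF W1(2)[OF that] wpoly_mono3'], use add.hyps that in force)
    moreover have "wpoly w (d - 1) (\<lambda>p. gx p + fst (snd p) * gz p)" if "w = 2"
    proof -
      have y: "fst (snd p) * mono3 i j (k - 1) p = mono3 i (j + 1) (k - 1) p" for p
        by (auto simp: mono3_def split: prod.splits)
      have "wpoly w (d - 1) (\<lambda>p. (fx p + fst (snd p) * fz p) + (e * real i) * mono3 (i - 1) j k p + (e * real k) * mono3 i (j + 1) (k - 1) p)"
      proof (rule wpoly_add[OF wpoly_add[OF W2[OF that] wpoly_mono3'] wpoly_mono3'])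
        show "e * real i \<noteq> 0 \<Longrightarrow> i - 1 + j + w * k \<le> d - 1" using add.hyps by auto
        assume "e * real k \<noteq> 0"
        then obtain k' where "k = Suc k'" by (cases k) auto
        then show "i + (j + 1) + w * (k - 1) \<le> d - 1" using add.hyps that by auto
      qed
      moreover have "gx p + fst (snd p) * gz p =
         (fx p + fst (snd p) * fz p) + (e * real i) * mono3 (i - 1) j k p + (e * real k) * mono3 i (j + 1) (k - 1) p" for p
        unfolding gx_def gz_def y[symmetric] by (simp add: algebra_simps)
      ultimately show ?thesis by simp
    qed
    ultimately show ?case by blast
  qed
  then show thesis using that by blast
qed

definition incidence_count :: "('a \<Rightarrow> 'b \<Rightarrow> bool) \<Rightarrow> 'a set \<Rightarrow> 'b set \<Rightarrow> nat" where
  "incidence_count R P C = card {(p, c). p \<in> P \<and> c \<in> C \<and> R p c}"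

lemma incidence_count_right:
  assumes "finite P" "finite C"
  shows "incidence_count R P C = (\<Sum>c\<in>C. card {p \<in> P. R p c})"
proof -
  have "{(p, c). p \<in> P \<and> c \<in> C \<and> R p c} = (\<lambda>(c, p). (p, c)) ` (SIGMA c:C. {p \<in> P. R p c})"
    by auto
  moreover have "card \<dots> = card (SIGMA c:C. {p \<in> P. R p c})"
    by (rule card_image) (auto simp: inj_on_def)
  ultimately show ?thesis using assms by (simp add: incidence_count_def)
qed

lemma incidence_count_left:
  assumes "finite P" "finite C"
  shows "incidence_count R P C = (\<Sum>p\<in>P. card {c \<in> C. R p c})"
proof -
  have "{(p, c). p \<in> P \<and> c \<in> C \<and> R p c} = (SIGMA p:P. {c \<in> C. R p c})"
    by auto
  then show ?thesis using assms by (simp add: incidence_count_def)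
qed

lemma incidence_count_cover:
  assumes "finite P" "finite C" "P1 \<subseteq> P" "C1 \<subseteq> C"
  shows "incidence_count R P C \<le> incidence_count R P1 C + incidence_count R (P - P1) C1 + incidence_count R (P - P1) (C - C1)"
proof -
  have fin: "finite {(p, c). p \<in> P' \<and> c \<in> C' \<and> R p c}" if "P' \<subseteq> P" "C' \<subseteq> C" for P' C'
    by (rule finite_subset[of _ "P \<times> C"]) (use assms that in auto)
  have "card {(p, c). p \<in> P \<and> c \<in> C \<and> R p c} \<le>
    card (({(p, c). p \<in> P1 \<and> c \<in> C \<and> R p c} \<union> {(p, c). p \<in> P - P1 \<and> c \<in> C1 \<and> R p c})
      \<union> {(p, c). p \<in> P - P1 \<and> c \<in> C - C1 \<and> R p c})"
  proof (intro card_mono finite_UnI)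
    show "finite {(p, c). p \<in> P1 \<and> c \<in> C \<and> R p c}" "finite {(p, c). p \<in> P - P1 \<and> c \<in> C1 \<and> R p c}"
      "finite {(p, c). p \<in> P - P1 \<and> c \<in> C - C1 \<and> R p c}"
      by (rule fin; use assms in auto)+
  qed auto
  also have "\<dots> \<le> card {(p, c). p \<in> P1 \<and> c \<in> C \<and> R p c} + card {(p, c). p \<in> P - P1 \<and> c \<in> C1 \<and> R p c}
      + card {(p, c). p \<in> P - P1 \<and> c \<in> C - C1 \<and> R p c}"
    by (intro order_trans[OF card_Un_le] add_mono card_Un_le order_refl)
  finally show ?thesis by (simp add: incidence_count_def)
qed

lemma incidence_count_swap: "incidence_count R P C = incidence_count (\<lambda>c p. R p c) C P"
proof -
  have "{(c, p). c \<in> C \<and> p \<in> P \<and> R p c} = prod.swap ` {(p, c). p \<in> P \<and> c \<in> C \<and> R p c}" by auto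
  then show ?thesis by (simp add: incidence_count_def card_image)
qed

text \<open>The common interface of the two dual pictures. Curves are graphs over the first
  coordinate, so p lies on the curve indexed by c iff \<open>\<gamma> c (fst p) = p\<close>. The
  assumption \<open>derivations\<close> replaces any count of the curves inside a surface: off the
  common zeros of the lower-degree functions in \<open>D\<close>, at most two curves inside f = 0
  meet in a point.\<close>

locale curve_system =
  fixes w :: nat and \<gamma> :: "pt \<Rightarrow> real \<Rightarrow> pt"
  assumes weight: "1 \<le> w" "w \<le> 2"
    and curve_poly: "\<exists>b e. degree b \<le> 1 \<and> degree e \<le> w \<and> (\<forall>t. \<gamma> c t = (t, poly b t, poly e t))"
    and curve_unique: "\<lbrakk>p \<noteq> q; \<gamma> c (fst p) = p; \<gamma> c (fst q) = q; \<gamma> c' (fst p) = p; \<gamma> c' (fst q) = q\<rbrakk> \<Longrightarrow> c = c'"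
    and derivations: "wpoly w d f \<Longrightarrow> \<exists>D. (\<forall>g\<in>D. wpoly w (d - 1) g) \<and>
       ((\<forall>g\<in>D. \<forall>p. g p = 0) \<longrightarrow> (\<forall>p q. f p = f q)) \<and>
       (\<forall>g\<in>D. \<forall>p C. g p \<noteq> 0 \<longrightarrow> finite C \<longrightarrow> (\<forall>c\<in>C. \<gamma> c (fst p) = p \<and> (\<forall>t. f (\<gamma> c t) = 0)) \<longrightarrow> card C \<le> 2)"
begin

definition incident :: "pt \<Rightarrow> pt \<Rightarrow> bool" where
  "incident p c \<longleftrightarrow> \<gamma> c (fst p) = p"

lemma restrict_to_curve:
  assumes "wpoly w d f"
  obtains q where "degree q \<le> d" "\<And>t. f (\<gamma> c t) = poly q t"
proof -
  obtain b e where b: "degree b \<le> 1" "degree e \<le> w" "\<And>t. \<gamma> c t = (t, poly b t, poly e t)"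
    using curve_poly by blast
  obtain q where "degree q \<le> d" "\<And>t. f (poly [:0, 1:] t, poly b t, poly e t) = poly q t"
    using wpoly_compose_poly[OF assms, of "[:0, 1:]" b e] b by auto
  then show thesis using b(3) by (intro that[of q]) auto
qed

lemma card_incident_zeros:
  assumes f: "wpoly w d f" and nz: "\<exists>t. f (\<gamma> c t) \<noteq> 0" and Q: "\<And>p. p \<in> Q \<Longrightarrow> f p = 0"
  shows "card {p \<in> Q. incident p c} \<le> d"
proof -
  obtain q where q: "degree q \<le> d" "\<And>t. f (\<gamma> c t) = poly q t"
    using restrict_to_curve[OF f] by blast
  then have q0: "q \<noteq> 0" using nz by auto
  have "inj_on fst {p \<in> Q. incident p c}"
    by (auto simp: inj_on_def incident_def)
  moreover have "fst ` {p \<in> Q. incident p c} \<subseteq> {t. poly q t = 0}"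
    using q(2) Q by (auto simp: incident_def) (metis fst_conv)
  ultimately have "card {p \<in> Q. incident p c} \<le> card {t. poly q t = 0}"
    by (intro card_inj_on_le poly_roots_finite q0)
  also have "\<dots> \<le> degree q" by (rule card_poly_roots_bound[OF q0])
  finally show ?thesis using q(1) by simp
qed

text \<open>Induction on the degree: at a point where some derivation of \<open>f\<close> does not vanish at most
  two of the curves pass, and a curve on which some derivation does not vanish identically meets the
  remaining points at most \<open>d\<close> times. No bound on the number of singular curves is needed.\<close>

lemma incidences_on_surface:
  assumes "finite Q" "finite C" "wpoly w d f" "\<exists>p. f p \<noteq> 0" "\<And>c t. c \<in> C \<Longrightarrow> f (\<gamma> c t) = 0"
  shows "incidence_count incident Q C \<le> 2 * card Q + d * card C"
  using assms
proof (induction d arbitrary: f Q C)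
  case 0
  then obtain e where "f = (\<lambda>_. e)" using wpoly_degree_0 weight by blast
  then have "C = {}" using 0 by auto
  then show ?case by (simp add: incidence_count_def)
next
  case (Suc d)
  obtain D where D': "\<forall>g\<in>D. wpoly w (Suc d - 1) g" "(\<forall>g\<in>D. \<forall>p. g p = 0) \<longrightarrow> (\<forall>p q. f p = f q)"
    "\<forall>g\<in>D. \<forall>p C. g p \<noteq> 0 \<longrightarrow> finite C \<longrightarrow> (\<forall>c\<in>C. \<gamma> c (fst p) = p \<and> (\<forall>t. f (\<gamma> c t) = 0)) \<longrightarrow> card C \<le> 2"
    using derivations[OF Suc.prems(3)] by - (elim exE conjE, rule that)
  have D: "wpoly w d g" if "g \<in> D" for g using D'(1) that by simp
  note D2 = mp[OF D'(2)]
  have D3: "card C \<le> 2"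
    if "g \<in> D" "g p \<noteq> 0" "finite C" "\<forall>c\<in>C. \<gamma> c (fst p) = p \<and> (\<forall>t. f (\<gamma> c t) = 0)" for g p C
    using D'(3)[rule_format, OF that(1-3)] that(4) by blast
  show ?case
  proof (cases "\<forall>p q. f p = f q")
    case True
    then have "C = {}" using Suc.prems(4,5) by (metis ex_in_conv)
    then show ?thesis by (simp add: incidence_count_def)
  next
    case False
    then obtain g0 where g0: "g0 \<in> D" "\<exists>p. g0 p \<noteq> 0" using D2 by blast
    define Q1 where "Q1 = {p \<in> Q. \<exists>g\<in>D. g p \<noteq> 0}"
    define C1 where "C1 = {c \<in> C. \<exists>g\<in>D. \<exists>t. g (\<gamma> c t) \<noteq> 0}"
    have fin: "finite Q1" "finite (Q - Q1)" "finite C1" "finite (C - C1)"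
      using Suc.prems by (auto simp: Q1_def C1_def)
    have "incidence_count incident Q C \<le> incidence_count incident Q1 C
       + incidence_count incident (Q - Q1) C1 + incidence_count incident (Q - Q1) (C - C1)"
      by (rule incidence_count_cover) (use Suc.prems in \<open>auto simp: Q1_def C1_def\<close>)
    moreover have "incidence_count incident Q1 C \<le> (\<Sum>p\<in>Q1. 2)"
      unfolding incidence_count_left[OF fin(1) Suc.prems(2)]
    proof (rule sum_mono)
      fix p assume "p \<in> Q1"
      then obtain g where g: "g \<in> D" "g p \<noteq> 0" by (auto simp: Q1_def)
      show "card {c \<in> C. incident p c} \<le> 2"
        by (rule D3[OF g]) (use Suc.prems in \<open>auto simp: incident_def\<close>)
    qed
    moreover have "incidence_count incident (Q - Q1) C1 \<le> (\<Sum>c\<in>C1. d)"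
      unfolding incidence_count_right[OF fin(2) fin(3)]
    proof (rule sum_mono)
      fix c assume "c \<in> C1"
      then obtain g where g: "g \<in> D" "\<exists>t. g (\<gamma> c t) \<noteq> 0" by (auto simp: C1_def)
      show "card {p \<in> Q - Q1. incident p c} \<le> d"
        by (rule card_incident_zeros[OF D[OF g(1)] g(2)]) (use g in \<open>auto simp: Q1_def\<close>)
    qed
    \<comment> \<open>Every element of \<open>D\<close> vanishes along the curves of
      \<open>C - C1\<close>, so any one of them that is not identically zero can serve as the next
      surface.\<close>
    moreover have "incidence_count incident (Q - Q1) (C - C1) \<le> 2 * card (Q - Q1) + d * card (C - C1)"
      by (rule Suc.IH[OF fin(2) fin(4) D[OF g0(1)] g0(2)]) (use g0 in \<open>auto simp: C1_def\<close>)
    moreover have "card Q = card Q1 + card (Q - Q1)"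
      using Suc.prems(1) by (metis (no_types, lifting) Q1_def card_Diff_subset card_mono fin(1) le_add_diff_inverse mem_Collect_eq subsetI)
    moreover have "card C = card C1 + card (C - C1)"
      using Suc.prems(2) by (metis (no_types, lifting) C1_def card_Diff_subset card_mono fin(3) le_add_diff_inverse mem_Collect_eq subsetI)
    ultimately show ?thesis by (simp add: algebra_simps)
  qed
qed

end

section \<open>Optimising the number of cells\<close>

lemma ex_power_interval:
  fixes x b :: real
  assumes "1 < b" "1 \<le> x"
  shows "\<exists>L. b ^ L \<le> x \<and> x < b ^ Suc L"
proof -
  define n where "n = (LEAST n. x < b ^ n)"
  have n: "x < b ^ n"
    unfolding n_def using real_arch_pow[OF assms(1), of x] by (rule LeastI_ex)
  then have "n \<noteq> 0" using assms by (intro notI) simp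
  then obtain L where L: "n = Suc L" using not0_implies_Suc by blast
  have "\<not> x < b ^ L" using not_less_Least[of L "\<lambda>n. x < b ^ n"] L unfolding n_def by simp
  then show ?thesis using n L by (intro exI[of _ L]) auto
qed

text \<open>Equating 2^L * M with N^2 / 8^L gives 16^L = N^2 / M, whose fourth root is
  \<open>u\<close>. Rounding L down costs a factor 16 in the last term, hence 89 = 73 + 16.\<close>

lemma balance_first:
  fixes I N M :: real
  assumes N: "0 \<le> N" and M: "0 < M"
    and I: "\<And>L::nat. I \<le> 2 * N + 73 * 2 ^ L * M + N\<^sup>2 / 8 ^ L"
  shows "I \<le> 2 * N + 89 * M + 89 * (N powr (1/2) * M powr (3/4))"
proof (cases "N\<^sup>2 \<le> M")
  case True
  have "0 \<le> N powr (1/2) * M powr (3/4)" by simp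
  then show ?thesis using I[of 0] True M unfolding power_0 mult_1_right div_by_1 by linarith
next
  case False
  define x where "x = N\<^sup>2 / M"
  have x: "1 \<le> x" using False M by (simp add: x_def)
  have N0: "0 < N" using False M N by (cases "N = 0") auto
  obtain L where L: "16 ^ L \<le> x" "x < 16 ^ Suc L" using ex_power_interval[of 16 x] x by auto
  define u where "u = x powr (1/4)"
  have "(2 ^ L) powr 4 = (16 ^ L :: real)"
    by (simp add: power_mult[symmetric] mult.commute[of L] powr_numeral) (simp add: power_mult)
  moreover have "(2 ^ L :: real) = ((2 ^ L) powr 4) powr (1/4)"
    unfolding powr_powr by simp
  ultimately have "(2 ^ L :: real) = (16 ^ L) powr (1/4)" by (simp only:)
  also have "\<dots> \<le> u" unfolding u_def using L(1) by (intro powr_mono2) auto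
  finally have u: "2 ^ L \<le> u" .
  have "N\<^sup>2 / 8 ^ L = x * M / 8 ^ L" using M by (simp add: x_def)
  also have "\<dots> \<le> 16 ^ Suc L * M / 8 ^ L"
    using L(2) M by (intro divide_right_mono mult_right_mono) auto
  also have "\<dots> = 16 * 2 ^ L * M"
  proof -
    have "(16 ^ L :: real) = 8 ^ L * 2 ^ L" by (simp add: power_mult_distrib[symmetric])
    then show ?thesis by simp
  qed
  also have "\<dots> \<le> 16 * u * M" using u M by (intro mult_right_mono) auto
  finally have 1: "N\<^sup>2 / 8 ^ L \<le> 16 * u * M" .
  have 2: "73 * 2 ^ L * M \<le> 73 * u * M" using u M by (intro mult_right_mono) auto
  have uM: "u * M = N powr (1/2) * M powr (3/4)"
  proof -
    have "u = N powr (1/2) / M powr (1/4)"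
      using N0 M by (simp add: u_def x_def powr_divide powr_powr powr_numeral[symmetric] del: powr_numeral)
    moreover have "M = M powr (1/4) * M powr (3/4)" using M by (simp add: powr_add[symmetric])
    ultimately have "u * M = N powr (1/2) / M powr (1/4) * (M powr (1/4) * M powr (3/4))"
      by (rule arg_cong2)
    then show ?thesis using M by simp
  qed
  show ?thesis using I[of L] 1 2 M unfolding uM[symmetric] mult.assoc by linarith
qed

text \<open>\<open>X\<close> is the value of 2^L at which the last two terms have equal order. If it
  is below 1, no partition is made and the last term is at most a multiple of n. Otherwise rounding
  to a power of two costs at most a factor 2 in the last term, hence 988 = 98 + 2 * 445.\<close>

lemma balance_second:
  fixes I m n :: real
  assumes m: "0 < m" and n: "0 < n"
    and I: "\<And>L::nat. I \<le> 91 * m + 98 * 2 ^ L * n + 445 * (m powr (3/4) * n powr (1/2) / (2 ^ L) powr (1/4))"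
  shows "I \<le> 988 * (m powr (3/5) * n powr (3/5) + m + n)"
proof -
  define X where "X = m powr (3/5) / n powr (2/5)"
  have X0: "X > 0" using m n by (simp add: X_def)
  have Xn: "X * n = m powr (3/5) * n powr (3/5)"
  proof -
    have "n = n powr (2/5) * n powr (3/5)" using n by (simp add: powr_add[symmetric])
    with X_def have "X * n = m powr (3/5) / n powr (2/5) * (n powr (2/5) * n powr (3/5))"
      by (rule arg_cong2)
    then show ?thesis using n by simp
  qed
  have T: "m powr (3/4) * n powr (1/2) = X powr (5/4) * n"
  proof -
    have "X powr (5/4) = m powr (3/4) / n powr (1/2)" using m n by (simp add: X_def powr_divide powr_powr)
    moreover have "n = n powr (1/2) * n powr (1/2)" using n by (simp add: powr_add[symmetric])
    ultimately have "X powr (5/4) * n = m powr (3/4) / n powr (1/2) * (n powr (1/2) * n powr (1/2))"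
      by (rule arg_cong2)
    then show ?thesis using n by simp
  qed
  show ?thesis
  proof (cases "X < 1")
    case True
    have "X powr (5/4) \<le> 1 powr (5/4)" using True X0 by (intro powr_mono2) auto
    then have "m powr (3/4) * n powr (1/2) \<le> n" unfolding T using n by simp
    moreover have "0 \<le> m powr (3/5) * n powr (3/5)" by simp
    ultimately show ?thesis using I[of 0] m n unfolding power_0 mult_1_right div_by_1 powr_one_eq_one by argo
  next
    case False
    then obtain L where L: "2 ^ L \<le> X" "X < 2 ^ Suc L" using ex_power_interval[of 2 X] by auto
    have 1: "2 ^ L * n \<le> X * n" using L(1) n by (intro mult_right_mono) auto
    have "X powr (1/4) \<le> (2 * 2 ^ L) powr (1/4)" using L(2) X0 by (intro powr_mono2) auto
    also have "\<dots> = 2 powr (1/4) * (2 ^ L) powr (1/4)" by (simp add: powr_mult)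
    also have "\<dots> \<le> 2 * (2 ^ L) powr (1/4)"
    proof (rule mult_right_mono)
      have "2 powr (1/4) \<le> (2::real) powr 1" by (rule powr_mono) auto
      then show "2 powr (1/4) \<le> (2::real)" by simp
    qed simp
    finally have "X powr (1/4) \<le> 2 * (2 ^ L) powr (1/4)" .
    then have "X * n * X powr (1/4) \<le> X * n * (2 * (2 ^ L) powr (1/4))"
      using X0 n by (intro mult_left_mono) auto
    moreover have eq: "X powr (5/4) = X * X powr (1/4)"
      using X0 powr_add[of X 1 "1/4"] by simp
    ultimately have "X powr (5/4) * n \<le> (2 * (X * n)) * (2 ^ L) powr (1/4)"
      unfolding eq by (simp only: ac_simps)
    then have 2: "m powr (3/4) * n powr (1/2) / (2 ^ L) powr (1/4) \<le> 2 * (X * n)"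
      unfolding T by (simp add: divide_le_eq)
    have "I \<le> 988 * (r + m + n)" if "I \<le> 91 * m + 98 * p + 445 * q" "p \<le> r" "q \<le> 2 * r" for p q r
      using that m n by argo
    from this[OF _ 1 2] show ?thesis using I[of L] by (simp only: Xn mult.assoc)
  qed
qed

section \<open>Partitioning the points of a curve system\<close>

context curve_system begin

text \<open>A curve with k > 0 points carries at least k - 1 ordered pairs of distinct points, and
  no pair lies on two curves.\<close>

lemma incidences_pairs:
  assumes Q: "finite Q" and C: "finite C"
  shows "incidence_count incident Q C \<le> card C + (card Q)\<^sup>2"
proof -
  define W where "W = (\<lambda>c. {(p, q). p \<in> Q \<and> q \<in> Q \<and> p \<noteq> q \<and> incident p c \<and> incident q c})"
  have finW: "finite (W c)" for c
    by (rule finite_subset[of _ "Q \<times> Q"]) (use Q in \<open>auto simp: W_def\<close>)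
  have "card {p \<in> Q. incident p c} \<le> 1 + card (W c)" for c
  proof (cases "{p \<in> Q. incident p c} = {}")
    case True
    then show ?thesis by (simp only: card.empty)
  next
    case False
    then obtain p where p: "p \<in> Q" "incident p c" by auto
    have "card {p \<in> Q. incident p c} = Suc (card ({p \<in> Q. incident p c} - {p}))"
      using p Q by (intro card.remove) auto
    also have "card ({p \<in> Q. incident p c} - {p}) \<le> card (W c)"
    proof (rule card_inj_on_le)
      show "inj_on (\<lambda>q. (p, q)) ({p \<in> Q. incident p c} - {p})" by (auto simp: inj_on_def)
      show "(\<lambda>q. (p, q)) ` ({p \<in> Q. incident p c} - {p}) \<subseteq> W c" using p by (auto simp: W_def)
    qed (rule finW)
    finally show ?thesis by simp
  qed
  then have "incidence_count incident Q C \<le> (\<Sum>c\<in>C. 1 + card (W c))"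
    unfolding incidence_count_right[OF Q C] by (intro sum_mono)
  also have "\<dots> = card C + (\<Sum>c\<in>C. card (W c))" by (simp only: sum.distrib) simp
  also have "(\<Sum>c\<in>C. card (W c)) = card (\<Union>c\<in>C. W c)"
  proof (rule card_UN_disjoint[symmetric])
    show "\<forall>c\<in>C. \<forall>c'\<in>C. c \<noteq> c' \<longrightarrow> W c \<inter> W c' = {}"
      using curve_unique unfolding W_def incident_def by blast
  qed (use C finW in auto)
  also have "\<dots> \<le> card (Q \<times> Q)"
    by (rule card_mono) (use Q in \<open>auto simp: W_def\<close>)
  finally show ?thesis by (simp add: card_cartesian_product power2_eq_square)
qed

lemma curve_continuous: "continuous_on A (\<gamma> c)"
proof -
  obtain b e where "\<And>t. \<gamma> c t = (t, poly b t, poly e t)" using curve_poly by blast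
  then have "\<gamma> c = (\<lambda>t. (t, poly b t, poly e t))" by auto
  then show ?thesis by (simp add: continuous_intros)
qed

text \<open>Along the curve the cell can change only at a zero of f, and there are at most d
  zeros.\<close>

lemma card_cells_met:
  assumes P: "cell_partition w d S N f \<kappa>" and nz: "\<exists>t. f (\<gamma> c t) \<noteq> 0"
  shows "card ((\<lambda>t. \<kappa> (\<gamma> c t)) ` {t. f (\<gamma> c t) \<noteq> 0}) \<le> d + 1"
proof -
  obtain q where q: "degree q \<le> d" "\<And>t. f (\<gamma> c t) = poly q t"
    using restrict_to_curve[of d f c] P by (auto simp: cell_partition_def)
  then have q0: "q \<noteq> 0" using nz by auto
  define T where "T = {t. f (\<gamma> c t) \<noteq> 0}"
  define K where "K = (\<lambda>t. \<kappa> (\<gamma> c t))"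
  \<comment> \<open>From here on \<open>N\<close> no longer means the number of cells:
    \<open>N t\<close> counts the zeros to the left of t and so names the interval between zeros
    that contains t.\<close>
  define N where "N = (\<lambda>t. card {r. poly q r = 0 \<and> r < t})"
  have fin: "finite {r. poly q r = 0 \<and> r < t}" for t
    by (rule finite_subset[OF _ poly_roots_finite[OF q0]]) auto
  have KN: "K s = K t" if st: "s \<in> T" "t \<in> T" "N s = N t" "s < t" for s t
  proof -
    have eq: "{r. poly q r = 0 \<and> r < s} = {r. poly q r = 0 \<and> r < t}"
      by (rule card_subset_eq[OF fin]) (use st in \<open>auto simp: N_def\<close>)
    have "\<forall>r\<in>{s..t}. f (\<gamma> c r) \<noteq> 0"
    proof (intro ballI notI)
      fix r assume r: "r \<in> {s..t}" "f (\<gamma> c r) = 0"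
      then have "r \<noteq> t" using st(2) by (auto simp: T_def)
      then have "r \<in> {r. poly q r = 0 \<and> r < s}" unfolding eq using r q(2) by auto
      then show False using r by auto
    qed
    then show ?thesis
      using P st(4) curve_continuous unfolding cell_partition_def K_def by (meson less_imp_le)
  qed
  have KN': "K s = K t" if "s \<in> T" "t \<in> T" "N s = N t" for s t
  proof (cases s t rule: linorder_cases)
    case less
    then show ?thesis by (rule KN[OF that])
  next
    case greater
    then show ?thesis by (rule KN[OF that(2,1) that(3)[symmetric], symmetric])
  qed simp
  have NT: "N ` T \<subseteq> {..d}"
  proof
    fix n assume "n \<in> N ` T"
    then obtain t where "n = N t" by auto
    moreover have "N t \<le> card {r. poly q r = 0}"
      unfolding N_def by (intro card_mono poly_roots_finite q0) auto
    ultimately show "n \<in> {..d}" using card_poly_roots_bound[OF q0] q(1) by simp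
  qed
  have "card (K ` T) \<le> card (N ` T)"
  proof (rule surj_card_le)
    show "finite (N ` T)" using NT by (rule finite_subset) simp
    show "K ` T \<subseteq> (\<lambda>n. K (SOME t. t \<in> T \<and> N t = n)) ` (N ` T)"
    proof clarify
      fix t assume t: "t \<in> T"
      define s where "s = (SOME s. s \<in> T \<and> N s = N t)"
      have "s \<in> T \<and> N s = N t" unfolding s_def by (rule someI[of _ t]) (use t in auto)
      then have "K s = K t" using t by (intro KN') auto
      then show "K t \<in> (\<lambda>n. K (SOME t. t \<in> T \<and> N t = n)) ` (N ` T)" using t unfolding s_def by force
    qed
  qed
  also have "\<dots> \<le> card {..d}"
    by (rule card_mono[OF _ NT]) simp
  finally show ?thesis by (simp add: K_def T_def)
qed

text \<open>\<open>Cs i\<close> consists of the curves entering cell i. With d = 24 * 2^L, a curve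
  enters at most d + 1 cells, whence 25 * 2^L. On the surface, curves inside it and curves crossing
  it cost d each; bounding both numbers by \<open>card C\<close> gives 48 * 2^L.\<close>

lemma partition_incidences:
  assumes Q: "finite Q" and C: "finite C"
  obtains Qs :: "nat \<Rightarrow> pt set" and Cs :: "nat \<Rightarrow> pt set" where
    "\<And>i. Qs i \<subseteq> Q" "\<And>i. Cs i \<subseteq> C" "\<And>i. 8 ^ L * card (Qs i) \<le> card Q"
    "(\<Sum>i<8 ^ L. card (Qs i)) \<le> card Q"
    "(\<Sum>i<8 ^ L. card (Cs i)) \<le> 25 * 2 ^ L * card C"
    "incidence_count incident Q C \<le> 2 * card Q + 48 * 2 ^ L * card C
       + (\<Sum>i<8 ^ L. incidence_count incident (Qs i) (Cs i))"
proof -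
  define d :: nat where "d = 24 * 2 ^ L"
  obtain f \<kappa> where P: "cell_partition w d Q (8 ^ L) f \<kappa>"
    using cell_partition_exists[OF Q weight, of L] by (auto simp: d_def)
  have f: "wpoly w d f" "\<exists>p. f p \<noteq> 0" "\<And>p. \<kappa> p < 8 ^ L"
    "\<And>i. 8 ^ L * card {p \<in> Q. f p \<noteq> 0 \<and> \<kappa> p = i} \<le> card Q"
    using P by (auto simp: cell_partition_def)
  define Qs where "Qs = (\<lambda>i. {p \<in> Q. f p \<noteq> 0 \<and> \<kappa> p = i})"
  define Cs where "Cs = (\<lambda>i. {c \<in> C. \<exists>t. f (\<gamma> c t) \<noteq> 0 \<and> \<kappa> (\<gamma> c t) = i})"
  define Q0 where "Q0 = {p \<in> Q. f p = 0}"
  define C0 where "C0 = {c \<in> C. \<forall>t. f (\<gamma> c t) = 0}"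
  have fin: "finite Q0" "finite C0" "finite (C - C0)" "finite (Q - Q0)" "\<And>i. finite (Qs i)" "\<And>i. finite (Cs i)"
    using Q C by (auto simp: Q0_def C0_def Qs_def Cs_def)
  have sub: "Q0 \<subseteq> Q" "C0 \<subseteq> C" by (auto simp: Q0_def C0_def)
  have "(\<Sum>i<8 ^ L. card (Qs i)) = card (\<Union>i<8 ^ L. Qs i)"
    by (rule card_UN_disjoint[symmetric]) (use fin in \<open>auto simp: Qs_def\<close>)
  also have "\<dots> \<le> card Q" by (rule card_mono[OF Q]) (auto simp: Qs_def)
  finally have sumQ: "(\<Sum>i<8 ^ L. card (Qs i)) \<le> card Q" .
  have "(\<Sum>i<8 ^ L. card (Cs i)) = (\<Sum>c\<in>C. card {i \<in> {..<8 ^ L}. \<exists>t. f (\<gamma> c t) \<noteq> 0 \<and> \<kappa> (\<gamma> c t) = i})"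
    using incidence_count_right[of C "{..<8 ^ L}" "\<lambda>c i. \<exists>t. f (\<gamma> c t) \<noteq> 0 \<and> \<kappa> (\<gamma> c t) = i"]
      incidence_count_left[of C "{..<8 ^ L}" "\<lambda>c i. \<exists>t. f (\<gamma> c t) \<noteq> 0 \<and> \<kappa> (\<gamma> c t) = i"] C
    by (simp add: Cs_def)
  also have "\<dots> \<le> (\<Sum>c\<in>C. d + 1)"
  proof (rule sum_mono)
    fix c
    have eq: "{i \<in> {..<8 ^ L}. \<exists>t. f (\<gamma> c t) \<noteq> 0 \<and> \<kappa> (\<gamma> c t) = i} = (\<lambda>t. \<kappa> (\<gamma> c t)) ` {t. f (\<gamma> c t) \<noteq> 0}"
      by (auto intro: f(3))
    show "card {i \<in> {..<8 ^ L}. \<exists>t. f (\<gamma> c t) \<noteq> 0 \<and> \<kappa> (\<gamma> c t) = i} \<le> d + 1"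
    proof (cases "\<exists>t. f (\<gamma> c t) \<noteq> 0")
      case True
      then show ?thesis unfolding eq by (rule card_cells_met[OF P])
    qed simp
  qed
  also have "\<dots> = (d + 1) * card C" by simp
  also have "\<dots> \<le> 25 * 2 ^ L * card C"
    by (rule mult_le_mono1) (simp add: d_def)
  finally have sumC: "(\<Sum>i<8 ^ L. card (Cs i)) \<le> 25 * 2 ^ L * card C" .
  have "incidence_count incident Q C = incidence_count (\<lambda>c p. incident p c) C Q"
    by (rule incidence_count_swap)
  also have "\<dots> \<le> incidence_count (\<lambda>c p. incident p c) C (Q - Q0) + (incidence_count (\<lambda>c p. incident p c) C0 Q0
     + incidence_count (\<lambda>c p. incident p c) (C - C0) Q0)"
  proof -
    have "{(c, p). c \<in> C \<and> p \<in> Q \<and> incident p c} \<subseteq> {(c, p). c \<in> C \<and> p \<in> Q - Q0 \<and> incident p c} \<union>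
      ({(c, p). c \<in> C0 \<and> p \<in> Q0 \<and> incident p c} \<union> {(c, p). c \<in> C - C0 \<and> p \<in> Q0 \<and> incident p c})"
      by auto
    moreover have "finite ({(c, p). c \<in> C \<and> p \<in> Q - Q0 \<and> incident p c} \<union>
      ({(c, p). c \<in> C0 \<and> p \<in> Q0 \<and> incident p c} \<union> {(c, p). c \<in> C - C0 \<and> p \<in> Q0 \<and> incident p c}))"
      by (rule finite_subset[of _ "C \<times> Q"]) (use C Q sub in auto)
    ultimately have "card {(c, p). c \<in> C \<and> p \<in> Q \<and> incident p c} \<le> card ({(c, p). c \<in> C \<and> p \<in> Q - Q0 \<and> incident p c} \<union>
      ({(c, p). c \<in> C0 \<and> p \<in> Q0 \<and> incident p c} \<union> {(c, p). c \<in> C - C0 \<and> p \<in> Q0 \<and> incident p c}))"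
      by (intro card_mono)
    also have "\<dots> \<le> card {(c, p). c \<in> C \<and> p \<in> Q - Q0 \<and> incident p c} +
      (card {(c, p). c \<in> C0 \<and> p \<in> Q0 \<and> incident p c} + card {(c, p). c \<in> C - C0 \<and> p \<in> Q0 \<and> incident p c})"
      by (intro order_trans[OF card_Un_le] add_mono card_Un_le order_refl)
    finally show ?thesis unfolding incidence_count_def .
  qed
  also have "incidence_count (\<lambda>c p. incident p c) C0 Q0 = incidence_count incident Q0 C0"
    by (rule incidence_count_swap[symmetric])
  also have "incidence_count incident Q0 C0 \<le> 2 * card Q0 + d * card C0"
    by (rule incidences_on_surface[OF fin(1,2) f(1,2)]) (simp add: C0_def)
  also have "incidence_count (\<lambda>c p. incident p c) (C - C0) Q0 = incidence_count incident Q0 (C - C0)"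
    by (rule incidence_count_swap[symmetric])
  also have "incidence_count incident Q0 (C - C0) \<le> (\<Sum>c\<in>C - C0. d)"
    unfolding incidence_count_right[OF fin(1,3)]
    by (rule sum_mono, rule card_incident_zeros[OF f(1)]) (auto simp: C0_def Q0_def)
  also have "incidence_count (\<lambda>c p. incident p c) C (Q - Q0) = incidence_count incident (Q - Q0) C"
    by (rule incidence_count_swap[symmetric])
  also have "incidence_count incident (Q - Q0) C \<le> (\<Sum>i<8 ^ L. incidence_count incident (Qs i) (Cs i))"
  proof -
    have "{(p, c). p \<in> Q - Q0 \<and> c \<in> C \<and> incident p c} \<subseteq> (\<Union>i<8 ^ L. {(p, c). p \<in> Qs i \<and> c \<in> Cs i \<and> incident p c})"
    proof clarify
      fix p1 p2 p3 c assume p: "(p1, p2, p3) \<in> Q" "(p1, p2, p3) \<notin> Q0" "c \<in> C" "incident (p1, p2, p3) c"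
      then have "(p1, p2, p3) \<in> Qs (\<kappa> (p1, p2, p3))" "c \<in> Cs (\<kappa> (p1, p2, p3))"
        unfolding Qs_def Cs_def Q0_def incident_def by (auto intro!: exI[of _ p1])
      then show "((p1, p2, p3), c) \<in> (\<Union>i<8 ^ L. {(p, c). p \<in> Qs i \<and> c \<in> Cs i \<and> incident p c})"
        using p(4) f(3) by blast
    qed
    moreover have "finite {(p, c). p \<in> Qs i \<and> c \<in> Cs i \<and> incident p c}" for i
      by (rule finite_subset[of _ "Qs i \<times> Cs i"]) (use fin in auto)
    ultimately have "card {(p, c). p \<in> Q - Q0 \<and> c \<in> C \<and> incident p c} \<le> card (\<Union>i<8 ^ L. {(p, c). p \<in> Qs i \<and> c \<in> Cs i \<and> incident p c})"
      by (intro card_mono) auto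
    also have "\<dots> \<le> (\<Sum>i<8 ^ L. card {(p, c). p \<in> Qs i \<and> c \<in> Cs i \<and> incident p c})"
      by (rule card_UN_le) simp
    finally show ?thesis unfolding incidence_count_def .
  qed
  finally have "incidence_count incident Q C \<le> (\<Sum>i<8 ^ L. incidence_count incident (Qs i) (Cs i))
      + (2 * card Q0 + d * card C0 + d * card (C - C0))"
    by (simp add: mult.commute[of d])
  moreover have "card Q0 \<le> card Q" "card C0 \<le> card C" "card (C - C0) \<le> card C"
    using Q C sub by (auto intro!: card_mono)
  then have "2 * card Q0 + d * card C0 + d * card (C - C0) \<le> 2 * card Q + d * card C + d * card C"
    by (intro add_mono mult_le_mono order_refl)
  ultimately have "incidence_count incident Q C \<le> 2 * card Q + 48 * 2 ^ L * card C
       + (\<Sum>i<8 ^ L. incidence_count incident (Qs i) (Cs i))"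
    by (simp add: d_def algebra_simps)
  then show thesis
    using f(4) sumQ sumC by (intro that[of Qs Cs]) (auto simp: Qs_def Cs_def)
qed

text \<open>Pair counting in each cell. The linear terms add up to 48 + 25 = 73 times 2^L * card C;
  the squares are at most the cell size card Q / 8^L times the total card Q.\<close>

lemma incidences_first_bound:
  assumes Q: "finite Q" and C: "finite C"
  shows "real (incidence_count incident Q C) \<le>
    2 * real (card Q) + 89 * real (card C) + 89 * (real (card Q) powr (1/2) * real (card C) powr (3/4))"
proof (cases "C = {}")
  case True
  then show ?thesis by (simp add: incidence_count_def)
next
  case False
  show ?thesis
  proof (rule balance_first)
    show "real (card C) > 0" using False C by (simp add: card_gt_0_iff)
    fix L
    obtain Qs Cs :: "nat \<Rightarrow> pt set" where sub: "\<And>i. Qs i \<subseteq> Q" "\<And>i. Cs i \<subseteq> C" and small: "\<And>i. 8 ^ L * card (Qs i) \<le> card Q"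
      and sums: "(\<Sum>i<8 ^ L. card (Qs i)) \<le> card Q" "(\<Sum>i<8 ^ L. card (Cs i)) \<le> 25 * 2 ^ L * card C"
      and I: "incidence_count incident Q C \<le> 2 * card Q + 48 * 2 ^ L * card C
       + (\<Sum>i<8 ^ L. incidence_count incident (Qs i) (Cs i))"
      by (rule partition_incidences[OF Q C, of L]) (rule that; assumption)
    have fin: "finite (Qs i)" "finite (Cs i)" for i
      using sub Q C by (meson finite_subset)+
    have "(\<Sum>i<8 ^ L. incidence_count incident (Qs i) (Cs i)) \<le> (\<Sum>i<8 ^ L. card (Cs i) + (card (Qs i))\<^sup>2)"
      by (intro sum_mono incidences_pairs fin)
    also have "\<dots> \<le> 25 * 2 ^ L * card C + (\<Sum>i<8 ^ L. (card (Qs i))\<^sup>2)"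
      using sums(2) by (simp add: sum.distrib)
    finally have "incidence_count incident Q C \<le> 2 * card Q + 73 * 2 ^ L * card C + (\<Sum>i<8 ^ L. (card (Qs i))\<^sup>2)"
      using I by linarith
    then have "real (incidence_count incident Q C) \<le> real (2 * card Q + 73 * 2 ^ L * card C + (\<Sum>i<8 ^ L. (card (Qs i))\<^sup>2))"
      by (rule of_nat_mono)
    also have "\<dots> = 2 * real (card Q) + 73 * 2 ^ L * real (card C) + (\<Sum>i<8 ^ L. (real (card (Qs i)))\<^sup>2)"
      by simp
    also have "(\<Sum>i<8 ^ L. (real (card (Qs i)))\<^sup>2) \<le> (\<Sum>i<8 ^ L. (real (card Q) / 8 ^ L) * real (card (Qs i)))"
    proof (rule sum_mono)
      fix i
      have "real (8 ^ L * card (Qs i)) \<le> real (card Q)" using small[of i] by (rule of_nat_mono)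
      then have "real (card (Qs i)) \<le> real (card Q) / 8 ^ L" by (simp add: field_simps)
      then show "(real (card (Qs i)))\<^sup>2 \<le> (real (card Q) / 8 ^ L) * real (card (Qs i))"
        unfolding power2_eq_square by (rule mult_right_mono) simp
    qed
    also have "\<dots> = (real (card Q) / 8 ^ L) * real (\<Sum>i<8 ^ L. card (Qs i))"
      by (simp add: sum_distrib_left)
    also have "\<dots> \<le> (real (card Q) / 8 ^ L) * real (card Q)"
      using sums(1) by (intro mult_left_mono) (simp_all only: of_nat_le_iff, simp)
    finally show "real (incidence_count incident Q C) \<le> 2 * real (card Q) + 73 * 2 ^ L * real (card C) + (real (card Q))\<^sup>2 / 8 ^ L"
      by (simp add: power2_eq_square)
  qed simp
qed

end

section \<open>Jets and quadratics\<close>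

text \<open>A point \<open>(s, b, c)\<close> stands for the function \<open>s t\<^sup>2 / 2 + b t + c\<close>, a point \<open>(x, y, z)\<close> for
  the condition of having slope \<open>y\<close> and value \<open>z\<close> at \<open>x\<close>.\<close>

definition quad_graph :: "pt \<Rightarrow> real \<Rightarrow> pt" where
  "quad_graph = (\<lambda>(s, b, c) t. (t, s * t + b, s * t\<^sup>2 / 2 + b * t + c))"

definition jet_line :: "pt \<Rightarrow> real \<Rightarrow> pt" where
  "jet_line = (\<lambda>(x, y, z) t. (t, y - t * x, z - x * y + t * x\<^sup>2 / 2))"

text \<open>The duality: exchanging points and curves turns one system into the other, so either one
  can count the same incidences.\<close>

lemma jet_line_quad_graph: "jet_line p (fst c) = c \<longleftrightarrow> quad_graph c (fst p) = p"
proof -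
  obtain x y z where p: "p = (x, y, z)" by (metis prod_cases3)
  obtain s b e where c: "c = (s, b, e)" by (metis prod_cases3)
  have "z - x * y + s * x\<^sup>2 / 2 = e \<longleftrightarrow> s * x\<^sup>2 / 2 + b * x + e = z" if "b = y - s * x"
    unfolding that by (auto simp: algebra_simps power2_eq_square)
  then show ?thesis unfolding p c by (auto simp: jet_line_def quad_graph_def)
qed

text \<open>Applied to curves through one point inside f = 0: the first parameter distinguishes
  them, and tangency to the surface makes it a root of \<open>q\<close>.\<close>

lemma card_by_root:
  assumes "finite C" and inj: "inj_on fst C" and q: "q \<noteq> 0" "degree q \<le> 2"
    and root: "\<And>c. c \<in> C \<Longrightarrow> poly q (fst c) = (0::real)"
  shows "card C \<le> 2"
proof -
  have "card C \<le> card {x. poly q x = 0}"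
    by (rule card_inj_on_le[OF inj]) (use root poly_roots_finite[OF q(1)] in auto)
  then show ?thesis using card_poly_roots_bound[OF q(1)] q(2) by linarith
qed

lemma jet_system: "curve_system 2 quad_graph"
proof
  show "\<exists>b e. degree b \<le> 1 \<and> degree e \<le> 2 \<and> (\<forall>t. quad_graph c t = (t, poly b t, poly e t))" for c
    by (rule exI[of _ "[:fst (snd c), fst c:]"], rule exI[of _ "[:snd (snd c), fst (snd c), fst c / 2:]"])
       (auto simp: quad_graph_def algebra_simps power2_eq_square split: prod.splits)
next
  fix p q c c' assume pq: "p \<noteq> q" and i: "quad_graph c (fst p) = p" "quad_graph c (fst q) = q"
    "quad_graph c' (fst p) = p" "quad_graph c' (fst q) = q"
  obtain s b e where c: "c = (s, b, e)" by (metis prod_cases3)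
  obtain s' b' e' where c': "c' = (s', b', e')" by (metis prod_cases3)
  define x where "x = fst p"
  define x' where "x' = fst q"
  have "x \<noteq> x'" using pq i(1,2) unfolding x_def x'_def by metis
  have 1: "quad_graph c x = quad_graph c' x" "quad_graph c x' = quad_graph c' x'"
    using i unfolding x_def x'_def by simp_all
  then have 2: "s * x + b = s' * x + b'" "s * x' + b = s' * x' + b'"
    "s * x\<^sup>2 / 2 + b * x + e = s' * x\<^sup>2 / 2 + b' * x + e'"
    by (auto simp: quad_graph_def c c')
  then have "(s - s') * (x - x') = 0" by (simp add: algebra_simps)
  then have "s = s'" using \<open>x \<noteq> x'\<close> by simp
  then show "c = c'" using 2 by (simp add: c c')
next
  fix d f assume wf: "wpoly 2 d f"
  obtain fx fy fz where
    chain: "\<And>a b c a' b' c' t. \<lbrakk>(a has_real_derivative a') (at t); (b has_real_derivative b') (at t); (c has_real_derivative c') (at t)\<rbrakk>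
      \<Longrightarrow> ((\<lambda>s. f (a s, b s, c s)) has_real_derivative
            fx (a t, b t, c t) * a' + fy (a t, b t, c t) * b' + fz (a t, b t, c t) * c') (at t)"
    and degs: "(2::nat) = 1 \<Longrightarrow> wpoly 2 (d - 1) fx" "(2::nat) = 1 \<Longrightarrow> wpoly 2 (d - 1) fz" "wpoly 2 (d - 1) fy"
      "(2::nat) = 2 \<Longrightarrow> wpoly 2 (d - 1) (\<lambda>p. fx p + fst (snd p) * fz p)"
    by (rule wpoly_chain_rule[OF wf]) (rule that; assumption)
  note deg = degs(3) degs(4)[OF refl]
  define X where "X = (\<lambda>p. fx p + fst (snd p) * fz p)"
  have const: "f p = f q" if z: "\<And>p. fy p = 0" "\<And>p. X p = 0" for p q
  proof -
    have Y: "f (x, y, z) = f (x, y', z)" for x y y' z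
      by (rule DERIV_isconst_all[of "\<lambda>y. f (x, y, z)"])
         (use chain[of "\<lambda>_. x" 0 _ "\<lambda>s. s" 1 "\<lambda>_. z" 0] z(1) in auto)
    have T: "f (t, y, z + t * y) = f (t', y, z + t' * y)" for t t' y z
    proof (rule DERIV_isconst_all[of "\<lambda>t. f (t, y, z + t * y)"], rule allI)
      fix t
      have "((\<lambda>t. f (t, y, z + t * y)) has_real_derivative
          fx (t, y, z + t * y) * 1 + fy (t, y, z + t * y) * 0 + fz (t, y, z + t * y) * y) (at t)"
        by (rule chain) (auto intro!: derivative_eq_intros)
      then show "((\<lambda>t. f (t, y, z + t * y)) has_real_derivative 0) (at t)"
        using z(2)[of "(t, y, z + t * y)"] by (simp add: X_def mult.commute)
    qed
    \<comment> \<open>Moves along the two fields reach the origin from everywhere. Raising y to 1,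
      sliding and lowering y again changes z, which reflects the nonzero commutator.\<close>
    have "f (x, y, z) = f (0, 0, 0)" for x y z
    proof -
      have "f (x, y, z) = f (x, 0, z)" by (rule Y)
      also have "\<dots> = f (0, 0, z)" using T[of x 0 z 0] by simp
      also have "\<dots> = f (0, 1, z)" by (rule Y)
      also have "\<dots> = f (- z, 1, 0)" using T[of 0 1 z "- z"] by simp
      also have "\<dots> = f (- z, 0, 0)" by (rule Y)
      also have "\<dots> = f (0, 0, 0)" using T[of "- z" 0 0 0] by simp
      finally show ?thesis .
    qed
    then show ?thesis by (metis prod_cases3)
  qed
  have two: "card C \<le> 2" if nz: "fy p \<noteq> 0 \<or> X p \<noteq> 0" and fin: "finite C"
    and C: "\<forall>c\<in>C. quad_graph c (fst p) = p \<and> (\<forall>t. f (quad_graph c t) = 0)" for p C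
  proof (rule card_by_root[OF fin, where q="[:X p, fy p:]"])
    show "inj_on fst C"
    proof (rule inj_onI)
      fix c c' assume cc: "c \<in> C" "c' \<in> C" "fst c = fst c'"
      then have "quad_graph c (fst p) = quad_graph c' (fst p)" using C by metis
      then show "c = c'" using cc(3) by (auto simp: quad_graph_def split: prod.splits)
    qed
    show "[:X p, fy p:] \<noteq> 0" "degree [:X p, fy p:] \<le> 2" using nz by auto
    fix c assume c: "c \<in> C"
    obtain s b e where c': "c = (s, b, e)" by (metis prod_cases3)
    obtain x y z where p: "p = (x, y, z)" by (metis prod_cases3)
    have on: "s * x + b = y" "s * x\<^sup>2 / 2 + b * x + e = z"
      using C c by (auto simp: c' p quad_graph_def)
    have "((\<lambda>t. f (t, s * t + b, s * t\<^sup>2 / 2 + b * t + e)) has_real_derivative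
        fx (x, s * x + b, s * x\<^sup>2 / 2 + b * x + e) * 1 + fy (x, s * x + b, s * x\<^sup>2 / 2 + b * x + e) * s
        + fz (x, s * x + b, s * x\<^sup>2 / 2 + b * x + e) * (s * x + b)) (at x)"
      by (rule chain) (auto intro!: derivative_eq_intros)
    moreover have "(\<lambda>t. f (t, s * t + b, s * t\<^sup>2 / 2 + b * t + e)) = (\<lambda>_. 0)"
      using C c by (auto simp: c' quad_graph_def)
    ultimately have "fx p * 1 + fy p * s + fz p * y = 0"
      unfolding on p by (metis DERIV_const DERIV_unique)
    then show "poly [:X p, fy p:] (fst c) = 0" by (simp add: X_def p c' algebra_simps)
  qed
  show "\<exists>D. (\<forall>g\<in>D. wpoly 2 (d - 1) g) \<and>
       ((\<forall>g\<in>D. \<forall>p. g p = 0) \<longrightarrow> (\<forall>p q. f p = f q)) \<and>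
       (\<forall>g\<in>D. \<forall>p C. g p \<noteq> 0 \<longrightarrow> finite C \<longrightarrow> (\<forall>c\<in>C. quad_graph c (fst p) = p \<and> (\<forall>t. f (quad_graph c t) = 0)) \<longrightarrow> card C \<le> 2)"
  proof (intro exI[of _ "{fy, X}"] conjI impI)
    show "\<forall>g\<in>{fy, X}. wpoly 2 (d - 1) g" using deg by (simp add: X_def)
    show "\<forall>p q. f p = f q" if "\<forall>g\<in>{fy, X}. \<forall>p. g p = 0"
      using that by (intro allI const) blast+
    show "\<forall>g\<in>{fy, X}. \<forall>p C. g p \<noteq> 0 \<longrightarrow> finite C \<longrightarrow> (\<forall>c\<in>C. quad_graph c (fst p) = p \<and> (\<forall>t. f (quad_graph c t) = 0)) \<longrightarrow> card C \<le> 2"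
      by (intro ballI allI impI) (rule two; blast)
  qed
qed simp_all

text \<open>With weight 1 every partial derivative lowers the degree. Differentiating along the line
  of a jet with abscissa x yields \<open>fx - x fy + (x^2/2) fz\<close>, so the lines inside f = 0
  through a point correspond to roots of a quadratic unless the gradient vanishes.\<close>

lemma quad_system: "curve_system 1 jet_line"
proof
  show "\<exists>b e. degree b \<le> 1 \<and> degree e \<le> 1 \<and> (\<forall>t. jet_line c t = (t, poly b t, poly e t))" for c
    by (rule exI[of _ "[:fst (snd c), - fst c:]"],
        rule exI[of _ "[:snd (snd c) - fst c * fst (snd c), fst c * fst c / 2:]"])
       (auto simp: jet_line_def algebra_simps power2_eq_square split: prod.splits)
next
  fix p q c c' assume pq: "p \<noteq> q" and i: "jet_line c (fst p) = p" "jet_line c (fst q) = q"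
    "jet_line c' (fst p) = p" "jet_line c' (fst q) = q"
  obtain x y z where c: "c = (x, y, z)" by (metis prod_cases3)
  obtain x' y' z' where c': "c' = (x', y', z')" by (metis prod_cases3)
  define s where "s = fst p"
  define s' where "s' = fst q"
  have "s \<noteq> s'" using pq i(1,2) unfolding s_def s'_def by metis
  have "jet_line c s = jet_line c' s" "jet_line c s' = jet_line c' s'"
    using i unfolding s_def s'_def by simp_all
  then have 2: "y - s * x = y' - s * x'" "y - s' * x = y' - s' * x'"
    "z - x * y + s * x\<^sup>2 / 2 = z' - x' * y' + s * x'\<^sup>2 / 2"
    by (auto simp: jet_line_def c c')
  then have "(s - s') * (x - x') = 0" by (simp add: algebra_simps)
  then have "x = x'" using \<open>s \<noteq> s'\<close> by simp
  then show "c = c'" using 2 by (simp add: c c')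
next
  fix d f assume wf: "wpoly 1 d f"
  obtain fx fy fz where
    chain: "\<And>a b c a' b' c' t. \<lbrakk>(a has_real_derivative a') (at t); (b has_real_derivative b') (at t); (c has_real_derivative c') (at t)\<rbrakk>
      \<Longrightarrow> ((\<lambda>s. f (a s, b s, c s)) has_real_derivative
            fx (a t, b t, c t) * a' + fy (a t, b t, c t) * b' + fz (a t, b t, c t) * c') (at t)"
    and degs: "(1::nat) = 1 \<Longrightarrow> wpoly 1 (d - 1) fx" "(1::nat) = 1 \<Longrightarrow> wpoly 1 (d - 1) fz" "wpoly 1 (d - 1) fy"
      "(1::nat) = 2 \<Longrightarrow> wpoly 1 (d - 1) (\<lambda>p. fx p + fst (snd p) * fz p)"
    by (rule wpoly_chain_rule[OF wf]) (rule that; assumption)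
  note deg = degs(1)[OF refl] degs(3) degs(2)[OF refl]
  have const: "f p = f q" if z: "\<And>p. fx p = 0" "\<And>p. fy p = 0" "\<And>p. fz p = 0" for p q
  proof -
    obtain p1 p2 p3 where p: "p = (p1, p2, p3)" by (metis prod_cases3)
    obtain q1 q2 q3 where q: "q = (q1, q2, q3)" by (metis prod_cases3)
    define g where "g = (\<lambda>t. f (p1 + t * (q1 - p1), p2 + t * (q2 - p2), p3 + t * (q3 - p3)))"
    have "g 0 = g 1"
    proof (rule DERIV_isconst_all[of g], rule allI)
      fix t
      show "(g has_real_derivative 0) (at t)"
        unfolding g_def
        by (rule DERIV_cong[OF chain[where a'="q1 - p1" and b'="q2 - p2" and c'="q3 - p3"]])
           (auto intro!: derivative_eq_intros simp: z)
    qed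
    then show ?thesis by (simp add: g_def p q)
  qed
  have two: "card C \<le> 2" if nz: "fx p \<noteq> 0 \<or> fy p \<noteq> 0 \<or> fz p \<noteq> 0" and fin: "finite C"
    and C: "\<forall>c\<in>C. jet_line c (fst p) = p \<and> (\<forall>t. f (jet_line c t) = 0)" for p C
  proof (rule card_by_root[OF fin, where q="[:fx p, - fy p, fz p / 2:]"])
    show "inj_on fst C"
    proof (rule inj_onI)
      fix c c' assume cc: "c \<in> C" "c' \<in> C" "fst c = fst c'"
      then have "jet_line c (fst p) = jet_line c' (fst p)" using C by metis
      then show "c = c'" using cc(3) by (auto simp: jet_line_def split: prod.splits)
    qed
    show "[:fx p, - fy p, fz p / 2:] \<noteq> 0" "degree [:fx p, - fy p, fz p / 2:] \<le> 2" using nz by auto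
    fix c assume c: "c \<in> C"
    obtain x y z where c': "c = (x, y, z)" by (metis prod_cases3)
    obtain s b e where p: "p = (s, b, e)" by (metis prod_cases3)
    have on: "y - s * x = b" "z - x * y + s * x\<^sup>2 / 2 = e"
      using C c by (auto simp: c' p jet_line_def)
    have "((\<lambda>t. f (t, y - t * x, z - x * y + t * x\<^sup>2 / 2)) has_real_derivative
        fx (s, y - s * x, z - x * y + s * x\<^sup>2 / 2) * 1 + fy (s, y - s * x, z - x * y + s * x\<^sup>2 / 2) * (- x)
        + fz (s, y - s * x, z - x * y + s * x\<^sup>2 / 2) * (x\<^sup>2 / 2)) (at s)"
      by (rule chain) (auto intro!: derivative_eq_intros)
    moreover have "(\<lambda>t. f (t, y - t * x, z - x * y + t * x\<^sup>2 / 2)) = (\<lambda>_. 0)"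
      using C c by (auto simp: c' jet_line_def)
    ultimately have "fx p * 1 + fy p * (- x) + fz p * (x\<^sup>2 / 2) = 0"
      unfolding on p by (metis DERIV_const DERIV_unique)
    then show "poly [:fx p, - fy p, fz p / 2:] (fst c) = 0"
      by (simp add: p c' algebra_simps power2_eq_square)
  qed
  show "\<exists>D. (\<forall>g\<in>D. wpoly 1 (d - 1) g) \<and>
       ((\<forall>g\<in>D. \<forall>p. g p = 0) \<longrightarrow> (\<forall>p q. f p = f q)) \<and>
       (\<forall>g\<in>D. \<forall>p C. g p \<noteq> 0 \<longrightarrow> finite C \<longrightarrow> (\<forall>c\<in>C. jet_line c (fst p) = p \<and> (\<forall>t. f (jet_line c t) = 0)) \<longrightarrow> card C \<le> 2)"
  proof (intro exI[of _ "{fx, fy, fz}"] conjI impI)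
    show "\<forall>g\<in>{fx, fy, fz}. wpoly 1 (d - 1) g" using deg by simp
    show "\<forall>p q. f p = f q" if "\<forall>g\<in>{fx, fy, fz}. \<forall>p. g p = 0"
      using that by (intro allI const) blast+
    show "\<forall>g\<in>{fx, fy, fz}. \<forall>p C. g p \<noteq> 0 \<longrightarrow> finite C \<longrightarrow> (\<forall>c\<in>C. jet_line c (fst p) = p \<and> (\<forall>t. f (jet_line c t) = 0)) \<longrightarrow> card C \<le> 2"
      by (intro ballI allI impI) (rule two; blast)
  qed
qed simp_all


section \<open>Partitioning the quadratics\<close>

lemma sum_sqrt_le:
  fixes a b :: "nat \<Rightarrow> nat"
  shows "(\<Sum>i\<in>S. sqrt (a i) * sqrt (b i)) \<le> sqrt (\<Sum>i\<in>S. a i) * sqrt (\<Sum>i\<in>S. b i)"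
proof -
  have "(\<Sum>i\<in>S. sqrt (a i) * sqrt (b i))\<^sup>2 \<le> (\<Sum>i\<in>S. (sqrt (a i))\<^sup>2) * (\<Sum>i\<in>S. (sqrt (b i))\<^sup>2)"
    by (rule Cauchy_Schwarz_ineq_sum)
  also have "\<dots> = real (\<Sum>i\<in>S. a i) * real (\<Sum>i\<in>S. b i)" by simp
  finally have "sqrt ((\<Sum>i\<in>S. sqrt (a i) * sqrt (b i))\<^sup>2) \<le> sqrt (real (\<Sum>i\<in>S. a i) * real (\<Sum>i\<in>S. b i))"
    by (rule real_sqrt_le_mono)
  then show ?thesis by (simp add: real_sqrt_mult sum_nonneg)
qed

text \<open>Write b^(3/4) as b^(1/4) * b^(1/2), bound the first factor by the cell size and apply
  Cauchy-Schwarz to the rest. The 5 is the square root of 25, and the exponent of 2^L is 1/2 - 3/4 =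
  -1/4.\<close>

lemma sum_cells_le:
  fixes a b :: "nat \<Rightarrow> nat" and m n :: real
  assumes m: "0 < m" and n: "0 < n"
    and small: "\<And>i. 8 ^ L * real (b i) \<le> m" and sa: "real (\<Sum>i\<in>S. a i) \<le> 25 * 2 ^ L * n"
    and sb: "real (\<Sum>i\<in>S. b i) \<le> m"
  shows "(\<Sum>i\<in>S. real (a i) powr (1/2) * real (b i) powr (3/4))
     \<le> 5 * (m powr (3/4) * n powr (1/2) / (2 ^ L) powr (1/4))"
proof -
  define y where "y = (2::real) ^ L"
  have y0: "y > 0" by (simp add: y_def)
  have y3: "8 ^ L = y powr 3"
    by (simp add: y_def power_mult[symmetric] mult.commute[of L]) (simp add: power_mult)
  have "(\<Sum>i\<in>S. real (a i) powr (1/2) * real (b i) powr (3/4))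
      \<le> (\<Sum>i\<in>S. (m / 8 ^ L) powr (1/4) * (sqrt (a i) * sqrt (b i)))"
  proof (rule sum_mono)
    fix i
    have "real (b i) powr (3/4) = real (b i) powr (1/4) * sqrt (b i)"
      by (cases "b i = 0") (simp_all add: powr_half_sqrt[symmetric] powr_add[symmetric])
    moreover have "real (b i) powr (1/4) \<le> (m / 8 ^ L) powr (1/4)"
      using small[of i] by (intro powr_mono2) (auto simp: field_simps)
    ultimately have "real (b i) powr (3/4) \<le> (m / 8 ^ L) powr (1/4) * sqrt (b i)"
      by (simp add: mult_right_mono)
    then have "sqrt (a i) * real (b i) powr (3/4) \<le> sqrt (a i) * ((m / 8 ^ L) powr (1/4) * sqrt (b i))"
      by (rule mult_left_mono) simp
    then show "real (a i) powr (1/2) * real (b i) powr (3/4) \<le> (m / 8 ^ L) powr (1/4) * (sqrt (a i) * sqrt (b i))"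
      by (simp add: powr_half_sqrt mult_ac)
  qed
  also have "\<dots> = (m / 8 ^ L) powr (1/4) * (\<Sum>i\<in>S. sqrt (a i) * sqrt (b i))"
    by (simp add: sum_distrib_left)
  also have "\<dots> \<le> (m / 8 ^ L) powr (1/4) * (sqrt (25 * y * n) * sqrt m)"
  proof (rule mult_left_mono)
    have "(\<Sum>i\<in>S. sqrt (a i) * sqrt (b i)) \<le> sqrt (\<Sum>i\<in>S. a i) * sqrt (\<Sum>i\<in>S. b i)"
      by (rule sum_sqrt_le)
    also have "\<dots> \<le> sqrt (25 * y * n) * sqrt m"
      using sa sb m n y0 by (intro mult_mono real_sqrt_le_mono) (auto simp: y_def sum_nonneg)
    finally show "(\<Sum>i\<in>S. sqrt (a i) * sqrt (b i)) \<le> sqrt (25 * y * n) * sqrt m" .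
  qed simp
  also have "\<dots> = 5 * ((m powr (1/4) * sqrt m) * sqrt n * (sqrt y / (y powr 3) powr (1/4)))"
    using m y0 by (simp add: y3 powr_divide real_sqrt_mult)
  also have "m powr (1/4) * sqrt m = m powr (3/4)"
    using m by (simp add: powr_half_sqrt[symmetric] powr_add[symmetric])
  also have "sqrt y / (y powr 3) powr (1/4) = 1 / y powr (1/4)"
  proof -
    have "(y powr 3) powr (1/4) = sqrt y * y powr (1/4)"
      unfolding powr_powr using y0 by (simp add: powr_half_sqrt[symmetric] powr_add[symmetric])
    then show ?thesis using y0 by simp
  qed
  finally show ?thesis using n by (simp add: y_def powr_half_sqrt)
qed

text \<open>The partitioned points are the quadratics and the curves are the lines of the jets;
  inside the cells the roles are exchanged and the first bound applies. The constants are 91 = 2 +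
  89, 98 = 48 + 2 * 25 and 445 = 89 * 5.\<close>

theorem jet_quadratic_incidences:
  assumes A: "finite A" and B: "finite B"
  shows "real (incidence_count (\<lambda>p c. quad_graph c (fst p) = p) A B)
    \<le> 988 * (real (card A) powr (3/5) * real (card B) powr (3/5) + real (card A) + real (card B))"
proof (cases "A = {} \<or> B = {}")
  case True
  then show ?thesis by (auto simp: incidence_count_def)
next
  case False
  let ?R = "\<lambda>p c. quad_graph c (fst p) = p"
  let ?I = "real (incidence_count ?R A B)"
  let ?m = "real (card B)" and ?n = "real (card A)"
  have m: "0 < ?m" and n: "0 < ?n" using False A B by (simp_all add: card_gt_0_iff)
  have eqR: "curve_system.incident quad_graph = ?R"
    by (intro ext) (simp add: curve_system.incident_def[OF jet_system])
  have swap: "incidence_count (curve_system.incident jet_line) B' A' = incidence_count (curve_system.incident quad_graph) A' B'"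
    for A' B'
    by (subst incidence_count_swap)
       (simp add: curve_system.incident_def[OF quad_system] eqR jet_line_quad_graph)
  have "?I \<le> 988 * (?m powr (3/5) * ?n powr (3/5) + ?m + ?n)"
  proof (rule balance_second[OF m n])
    fix L
    obtain Bs As :: "nat \<Rightarrow> pt set" where sub: "\<And>i. Bs i \<subseteq> B" "\<And>i. As i \<subseteq> A"
      and small: "\<And>i. 8 ^ L * card (Bs i) \<le> card B"
      and sums: "(\<Sum>i<8 ^ L. card (Bs i)) \<le> card B" "(\<Sum>i<8 ^ L. card (As i)) \<le> 25 * 2 ^ L * card A"
      and I: "incidence_count (curve_system.incident jet_line) B A \<le> 2 * card B + 48 * 2 ^ L * card A
       + (\<Sum>i<8 ^ L. incidence_count (curve_system.incident jet_line) (Bs i) (As i))"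
      by (rule curve_system.partition_incidences[OF quad_system B A, of L]) (rule that; assumption)
    have fin: "finite (As i)" "finite (Bs i)" for i
      using sub A B by (meson finite_subset)+
    have rsums: "real (\<Sum>i<8 ^ L. card (Bs i)) \<le> ?m" "real (\<Sum>i<8 ^ L. card (As i)) \<le> 25 * 2 ^ L * ?n"
      using of_nat_mono[OF sums(1), where 'a=real] of_nat_mono[OF sums(2), where 'a=real] by simp_all
    have rsmall: "8 ^ L * real (card (Bs i)) \<le> ?m" for i
      using of_nat_mono[OF small[of i], where 'a=real] by simp
    let ?T = "\<lambda>i. real (card (As i)) powr (1/2) * real (card (Bs i)) powr (3/4)"
    have "real (incidence_count ?R A B) \<le> real (2 * card B + 48 * 2 ^ L * card A + (\<Sum>i<8 ^ L. incidence_count ?R (As i) (Bs i)))"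
      using I unfolding swap eqR by (rule of_nat_mono)
    also have "\<dots> = 2 * ?m + 48 * 2 ^ L * ?n + (\<Sum>i<8 ^ L. real (incidence_count ?R (As i) (Bs i)))"
      by simp
    also have "(\<Sum>i<8 ^ L. real (incidence_count ?R (As i) (Bs i)))
        \<le> (\<Sum>i<8 ^ L. 2 * real (card (As i)) + 89 * real (card (Bs i)) + 89 * ?T i)"
      using curve_system.incidences_first_bound[OF jet_system fin] unfolding eqR by (rule sum_mono)
    also have "\<dots> = 2 * real (\<Sum>i<8 ^ L. card (As i)) + 89 * real (\<Sum>i<8 ^ L. card (Bs i)) + 89 * (\<Sum>i<8 ^ L. ?T i)"
      by (simp add: sum.distrib sum_distrib_left)
    also have "\<dots> \<le> 2 * (25 * 2 ^ L * ?n) + 89 * ?m + 89 * (5 * (?m powr (3/4) * ?n powr (1/2) / (2 ^ L) powr (1/4)))"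
      by (intro add_mono mult_left_mono rsums sum_cells_le[OF m n rsmall]) simp_all
    finally show "?I \<le> 91 * ?m + 98 * 2 ^ L * ?n + 445 * (?m powr (3/4) * ?n powr (1/2) / (2 ^ L) powr (1/4))"
      by (simp add: algebra_simps)
  qed
  then show ?thesis by (simp add: ac_simps)
qed

section \<open>Anchored circles\<close>

text \<open>For orthonormal a and v this is the unit circle with centre a in the plane of a and v,
  the equation being |p - a| = 1 in these coordinates. Inversion in the unit sphere turns it into
  the line of direction v that touches the sphere of radius 1/2 about the origin at a/2.\<close>

definition circ :: "real^3 \<Rightarrow> real^3 \<Rightarrow> (real^3) set" where
  "circ a v = {\<alpha> *\<^sub>R a + \<beta> *\<^sub>R v | \<alpha> \<beta>. \<alpha>\<^sup>2 + \<beta>\<^sup>2 = 2 * \<alpha>}"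

lemma circ_minus: "circ a (- v) = circ a v"
proof -
  have "circ a (- v) \<subseteq> circ a v" for v
    unfolding circ_def by (clarsimp, rule_tac x=\<alpha> in exI, rule_tac x="- \<beta>" in exI) simp
  from this[of v] this[of "- v"] show ?thesis by simp
qed

lemma orthonormal_norm:
  fixes a v :: "'a::real_inner"
  assumes "norm a = 1" "norm v = 1" "a \<bullet> v = 0"
  shows "(norm (\<alpha> *\<^sub>R a + \<beta> *\<^sub>R v))\<^sup>2 = \<alpha>\<^sup>2 + \<beta>\<^sup>2"
proof -
  have "a \<bullet> a = 1" "v \<bullet> v = 1" "v \<bullet> a = 0"
    using assms by (simp_all add: dot_square_norm inner_commute)
  then show ?thesis
    unfolding power2_norm_eq_inner using assms(3)
    by (simp add: inner_add_left inner_add_right power2_eq_square)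
qed

text \<open>Containing the origin makes the plane a linear subspace and the centre a unit vector in
  it; one Gram-Schmidt step provides v.\<close>

lemma anchored_unit_circle_circ:
  assumes "anchored_unit_circle c"
  obtains a v where "norm a = 1" "norm v = 1" "a \<bullet> v = 0" "c = circ a v"
proof -
  obtain H a where H: "affine H" "aff_dim H = 2" "a \<in> H" and c: "c = H \<inter> sphere a 1" and 0: "0 \<in> c"
    using assms by (auto simp: anchored_unit_circle_def unit_circle_def circle_in_plane_def)
  have a: "norm a = 1" using 0 c by simp
  have sub: "subspace H" using H(1) 0 c by (auto simp: subspace_affine)
  have dim: "dim H = 2" using aff_dim_subspace[OF sub] H(2) by simp
  have "\<not> H \<subseteq> span {a}"
  proof
    assume "H \<subseteq> span {a}"
    then have "dim H \<le> card {a}" by (rule dim_le_card) simp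
    then show False using dim by simp
  qed
  then obtain y where y: "y \<in> H" "y \<notin> span {a}" by auto
  define e where "e = y - (y \<bullet> a) *\<^sub>R a"
  have "e \<noteq> 0"
  proof
    assume "e = 0"
    then have "y = (y \<bullet> a) *\<^sub>R a" by (simp add: e_def)
    also have "\<dots> \<in> span {a}" by (intro span_mul span_base) simp
    finally show False using y(2) by simp
  qed
  have aa: "a \<bullet> a = 1" using a by (simp add: dot_square_norm)
  have "a \<bullet> e = 0" by (simp add: e_def inner_diff_right aa inner_commute)
  define v where "v = e /\<^sub>R norm e"
  have v: "norm v = 1" "a \<bullet> v = 0" using \<open>e \<noteq> 0\<close> \<open>a \<bullet> e = 0\<close> by (simp_all add: v_def)
  have "v \<in> H"
    unfolding v_def e_def using sub y(1) H(3) by (intro subspace_scale subspace_diff)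
  have "a \<noteq> v" using aa v by auto
  have "independent {a, v}"
  proof (rule pairwise_orthogonal_independent)
    show "pairwise orthogonal {a, v}"
      using v by (auto simp: pairwise_def orthogonal_def inner_commute)
    show "0 \<notin> {a, v}" using a v by auto
  qed
  then have "dim (span {a, v}) = 2" using \<open>a \<noteq> v\<close> by (simp add: dim_eq_card_independent)
  moreover have "span {a, v} \<subseteq> H" using sub H(3) \<open>v \<in> H\<close> by (intro span_minimal) auto
  ultimately have "span {a, v} = H"
    using sub dim by (intro subspace_dim_equal) auto
  moreover have "span {a, v} = {\<alpha> *\<^sub>R a + \<beta> *\<^sub>R v | \<alpha> \<beta>. True}"
    by (auto simp: span_insert span_singleton algebra_simps)
  ultimately have Heq: "H = {\<alpha> *\<^sub>R a + \<beta> *\<^sub>R v | \<alpha> \<beta>. True}" by simp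
  have sph: "\<alpha> *\<^sub>R a + \<beta> *\<^sub>R v \<in> sphere a 1 \<longleftrightarrow> \<alpha>\<^sup>2 + \<beta>\<^sup>2 = 2 * \<alpha>" for \<alpha> \<beta>
  proof -
    have "a - (\<alpha> *\<^sub>R a + \<beta> *\<^sub>R v) = (1 - \<alpha>) *\<^sub>R a + (- \<beta>) *\<^sub>R v"
      by (simp add: algebra_simps)
    then have "(dist a (\<alpha> *\<^sub>R a + \<beta> *\<^sub>R v))\<^sup>2 = (1 - \<alpha>)\<^sup>2 + (- \<beta>)\<^sup>2"
      using orthonormal_norm[OF a v] by (simp only: dist_norm)
    moreover have "dist a (\<alpha> *\<^sub>R a + \<beta> *\<^sub>R v) = 1 \<longleftrightarrow> (dist a (\<alpha> *\<^sub>R a + \<beta> *\<^sub>R v))\<^sup>2 = 1"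
      by (metis abs_of_nonneg one_power2 power2_eq_iff_nonneg zero_le_dist zero_le_one)
    ultimately show ?thesis by (auto simp: power2_eq_square algebra_simps)
  qed
  have "c = circ a v" unfolding c Heq circ_def using sph by blast
  with a v show thesis using that by blast
qed

text \<open>The horizon circle of \<open>p\<close> passes through the pole \<open>w\<close> of the stereographic projection
  iff \<open>2 p \<bullet> w = |p|\<^sup>2\<close>; each nonzero point excludes at most four points of the curve \<open>w\<close> below.\<close>

lemma generic_pole:
  fixes P :: "(real^3) set"
  assumes "finite P" "0 \<notin> P"
  obtains w where "norm w = 1" "\<And>p. p \<in> P \<Longrightarrow> (norm p)\<^sup>2 \<noteq> 2 * (p \<bullet> w)"
proof -
  define D where "D = (\<lambda>t::real. 1 + t\<^sup>2 + t ^ 4)"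
  have D: "D t > 0" for t unfolding D_def by (intro add_pos_nonneg) auto
  \<comment> \<open>The inverse stereographic image of the point (t, t^2) of a parabola.\<close>
  define w :: "real \<Rightarrow> real^3" where
    "w = (\<lambda>t. vector [2 * t / D t, 2 * t\<^sup>2 / D t, (t ^ 4 + t\<^sup>2 - 1) / D t])"
  have "norm (w t) = 1" for t
  proof -
    have "w t \<bullet> w t = ((2 * t)\<^sup>2 + (2 * t\<^sup>2)\<^sup>2 + (t ^ 4 + t\<^sup>2 - 1)\<^sup>2) / (D t)\<^sup>2"
      by (simp add: w_def inner_vec_def sum_3 power2_eq_square add_divide_distrib)
    also have "(2 * t)\<^sup>2 + (2 * t\<^sup>2)\<^sup>2 + (t ^ 4 + t\<^sup>2 - 1)\<^sup>2 = (D t)\<^sup>2"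
      by (simp add: D_def algebra_simps power2_eq_square power4_eq_xxxx)
    finally show ?thesis using D[of t] by (simp add: norm_eq_1)
  qed
  moreover have "\<exists>t. \<forall>p\<in>P. (norm p)\<^sup>2 \<noteq> 2 * (p \<bullet> w t)"
  proof -
    \<comment> \<open>This is \<open>2 * (p \<bullet> w t) - (norm p)\<^sup>2\<close> multiplied by
      \<open>D t\<close>. Its constant and leading coefficients add up to -2 |p|^2, so it is nonzero
      for p distinct from the origin.\<close>
    define q :: "real^3 \<Rightarrow> real poly" where
      "q = (\<lambda>p. [: - 2 * p$3 - (norm p)\<^sup>2, 4 * p$1, 4 * p$2 + 2 * p$3 - (norm p)\<^sup>2, 0, 2 * p$3 - (norm p)\<^sup>2 :])"
    have q0: "q p \<noteq> 0" if "p \<in> P" for p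
    proof
      assume "q p = 0"
      then have "- 2 * p$3 - (norm p)\<^sup>2 = 0" "2 * p$3 - (norm p)\<^sup>2 = 0"
        unfolding q_def pCons_eq_0_iff by blast+
      then have "(norm p)\<^sup>2 = 0" by linarith
      then show False using that assms(2) by simp
    qed
    have "finite (\<Union>p\<in>P. {t. poly (q p) t = 0})"
      using assms(1) q0 poly_roots_finite by blast
    then obtain t where t: "t \<notin> (\<Union>p\<in>P. {t. poly (q p) t = 0})"
      using ex_new_if_finite infinite_UNIV_char_0 by blast
    have "(norm p)\<^sup>2 \<noteq> 2 * (p \<bullet> w t)" if "p \<in> P" for p
    proof
      assume eq: "(norm p)\<^sup>2 = 2 * (p \<bullet> w t)"
      have "p \<bullet> w t * D t = p$1 * (2 * t) + p$2 * (2 * t\<^sup>2) + p$3 * (t ^ 4 + t\<^sup>2 - 1)"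
        using D[of t] by (simp add: w_def inner_vec_def sum_3 field_simps)
      then have "poly (q p) t = 2 * (p \<bullet> w t) * D t - (norm p)\<^sup>2 * D t"
        by (simp add: q_def D_def algebra_simps power2_eq_square power4_eq_xxxx)
      then have "poly (q p) t = 0" by (simp add: eq)
      then show False using t that by blast
    qed
    then show ?thesis by blast
  qed
  ultimately show thesis using that by blast
qed

section \<open>Contact elements as jets\<close>

text \<open>For orthonormal a and v, (\<zeta>1, \<zeta>2) is the stereographic image of a from the
  pole (0, 0, 1), and N = (N1, N2) is the rescaled image of v under the differential. N is a unit
  vector and x the tangent of half its angle. The last two entries are the slope and the value at t
  = x of (1 - t^2) \<zeta>1 + 2 t \<zeta>2, which is 1 + t^2 times the inner product of \<zeta> with
  the unit vector of half-angle parameter t.\<close>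

definition jet :: "real^3 \<Rightarrow> real^3 \<Rightarrow> real \<times> real \<times> real" where
  "jet a v = (let \<zeta>1 = a$1 / (1 - a$3); \<zeta>2 = a$2 / (1 - a$3); N1 = v$1 + \<zeta>1 * v$3; N2 = v$2 + \<zeta>2 * v$3; x = N2 / (1 + N1)
     in (x, 2 * \<zeta>2 - 2 * x * \<zeta>1, (1 - x\<^sup>2) * \<zeta>1 + 2 * x * \<zeta>2))"

text \<open>The last two conditions exclude the zero denominators of \<open>jet\<close>: a at the
  pole, and N = (-1, 0), whose half-angle has no tangent.\<close>

definition contact_frame :: "real^3 \<Rightarrow> real^3 \<Rightarrow> bool" where
  "contact_frame a v \<longleftrightarrow> norm a = 1 \<and> norm v = 1 \<and> a \<bullet> v = 0 \<and> a$3 \<noteq> 1 \<and> 1 + (v$1 + a$1 / (1 - a$3) * v$3) \<noteq> 0"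

lemma contact_frame_coordinates:
  assumes "contact_frame a v"
  obtains \<zeta>1 \<zeta>2 N1 N2 x where
    "a$1 = (1 - a$3) * \<zeta>1" "a$2 = (1 - a$3) * \<zeta>2"
    "N1 = v$1 + \<zeta>1 * v$3" "N2 = v$2 + \<zeta>2 * v$3"
    "a$3 * (\<zeta>1\<^sup>2 + \<zeta>2\<^sup>2 + 1) = \<zeta>1\<^sup>2 + \<zeta>2\<^sup>2 - 1"
    "v$3 = (1 - a$3) * (\<zeta>1 * N1 + \<zeta>2 * N2)"
    "N2 = x * (1 + N1)" "x\<^sup>2 * (1 + N1) = 1 - N1"
    "jet a v = (x, 2 * \<zeta>2 - 2 * x * \<zeta>1, (1 - x\<^sup>2) * \<zeta>1 + 2 * x * \<zeta>2)"
proof -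
  define \<zeta>1 where "\<zeta>1 = a$1 / (1 - a$3)"
  define \<zeta>2 where "\<zeta>2 = a$2 / (1 - a$3)"
  define N1 where "N1 = v$1 + \<zeta>1 * v$3"
  define N2 where "N2 = v$2 + \<zeta>2 * v$3"
  define x where "x = N2 / (1 + N1)"
  have k: "1 - a$3 \<noteq> 0" and N1: "1 + N1 \<noteq> 0"
    using assms by (auto simp: contact_frame_def N1_def \<zeta>1_def)
  have "a \<bullet> a = 1" "v \<bullet> v = 1" "a \<bullet> v = 0"
    using assms by (simp_all add: contact_frame_def dot_square_norm)
  then have aa: "(a$1)\<^sup>2 + (a$2)\<^sup>2 + (a$3)\<^sup>2 = 1" and vv: "(v$1)\<^sup>2 + (v$2)\<^sup>2 + (v$3)\<^sup>2 = 1"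
    and av: "a$1 * v$1 + a$2 * v$2 + a$3 * v$3 = 0"
    by (simp_all add: inner_vec_def sum_3 power2_eq_square)
  have a12: "a$1 = (1 - a$3) * \<zeta>1" "a$2 = (1 - a$3) * \<zeta>2"
    using k by (simp_all add: \<zeta>1_def \<zeta>2_def)
  have "(1 - a$3) * ((1 - a$3) * (\<zeta>1\<^sup>2 + \<zeta>2\<^sup>2) - (1 + a$3)) = 0"
    using aa unfolding a12 by (simp add: algebra_simps power2_eq_square)
  then have z: "(1 - a$3) * (\<zeta>1\<^sup>2 + \<zeta>2\<^sup>2) = 1 + a$3" using k by simp
  have zv: "(1 - a$3) * (\<zeta>1 * v$1 + \<zeta>2 * v$2) = - (a$3 * v$3)"
    using av unfolding a12 by (simp add: algebra_simps)
  have "(1 - a$3) * (\<zeta>1 * N1 + \<zeta>2 * N2)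
      = (1 - a$3) * (\<zeta>1 * v$1 + \<zeta>2 * v$2) + (1 - a$3) * (\<zeta>1\<^sup>2 + \<zeta>2\<^sup>2) * v$3"
    unfolding N1_def N2_def by (simp add: algebra_simps power2_eq_square)
  also have "\<dots> = v$3" unfolding z zv by (simp add: algebra_simps)
  finally have v3: "v$3 = (1 - a$3) * (\<zeta>1 * N1 + \<zeta>2 * N2)" by (rule sym)
  have "N1\<^sup>2 + N2\<^sup>2 = (v$1)\<^sup>2 + (v$2)\<^sup>2 + v$3 * (2 * (\<zeta>1 * v$1 + \<zeta>2 * v$2) + (\<zeta>1\<^sup>2 + \<zeta>2\<^sup>2) * v$3)"
    unfolding N1_def N2_def by (simp add: algebra_simps power2_eq_square)
  moreover have "2 * (\<zeta>1 * v$1 + \<zeta>2 * v$2) + (\<zeta>1\<^sup>2 + \<zeta>2\<^sup>2) * v$3 = v$3"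
  proof -
    have "(1 - a$3) * (2 * (\<zeta>1 * v$1 + \<zeta>2 * v$2) + (\<zeta>1\<^sup>2 + \<zeta>2\<^sup>2) * v$3)
      = 2 * ((1 - a$3) * (\<zeta>1 * v$1 + \<zeta>2 * v$2)) + (1 - a$3) * (\<zeta>1\<^sup>2 + \<zeta>2\<^sup>2) * v$3"
      by (simp add: algebra_simps)
    also have "\<dots> = (1 - a$3) * v$3" unfolding z zv by (simp add: algebra_simps)
    finally show ?thesis using k by simp
  qed
  \<comment> \<open>Conformality of the stereographic projection, in coordinates.\<close>
  ultimately have NN: "N1\<^sup>2 + N2\<^sup>2 = 1" using vv by (simp add: power2_eq_square)
  have xN: "N2 = x * (1 + N1)" using N1 by (simp add: x_def)
  have "(1 + N1) * (x\<^sup>2 * (1 + N1) - (1 - N1)) = 0"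
    using NN unfolding xN by (simp add: algebra_simps power2_eq_square)
  then have xx: "x\<^sup>2 * (1 + N1) = 1 - N1" using N1 by simp
  have a3: "a$3 * (\<zeta>1\<^sup>2 + \<zeta>2\<^sup>2 + 1) = \<zeta>1\<^sup>2 + \<zeta>2\<^sup>2 - 1"
  proof -
    have "t * (S + 1) = S - 1" if "(1 - t) * S = 1 + t" for t S :: real
      using that unfolding left_diff_distrib distrib_left by linarith
    from this[OF z] show ?thesis .
  qed
  have "jet a v = (x, 2 * \<zeta>2 - 2 * x * \<zeta>1, (1 - x\<^sup>2) * \<zeta>1 + 2 * x * \<zeta>2)"
    by (simp add: jet_def Let_def \<zeta>1_def \<zeta>2_def N1_def N2_def x_def)
  then show thesis by (rule that[OF a12 N1_def N2_def a3 v3 xN xx])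
qed

text \<open>The abscissa x determines N by the half-angle formulas; slope and value are two linear
  equations for \<zeta> whose determinant is a nonzero multiple of 1 + x^2. From \<zeta> and N the
  inverse projection recovers a and v.\<close>

lemma jet_inj:
  assumes "contact_frame a v" "contact_frame a' v'" "jet a v = jet a' v'"
  shows "a = a' \<and> v = v'"
proof -
  obtain \<zeta>1 \<zeta>2 N1 N2 x where f: "a$1 = (1 - a$3) * \<zeta>1" "a$2 = (1 - a$3) * \<zeta>2"
    "N1 = v$1 + \<zeta>1 * v$3" "N2 = v$2 + \<zeta>2 * v$3"
    "a$3 * (\<zeta>1\<^sup>2 + \<zeta>2\<^sup>2 + 1) = \<zeta>1\<^sup>2 + \<zeta>2\<^sup>2 - 1"
    "v$3 = (1 - a$3) * (\<zeta>1 * N1 + \<zeta>2 * N2)"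
    "N2 = x * (1 + N1)" "x\<^sup>2 * (1 + N1) = 1 - N1"
    "jet a v = (x, 2 * \<zeta>2 - 2 * x * \<zeta>1, (1 - x\<^sup>2) * \<zeta>1 + 2 * x * \<zeta>2)"
    using contact_frame_coordinates[OF assms(1)] by blast
  obtain \<zeta>1' \<zeta>2' N1' N2' x' where g: "a'$1 = (1 - a'$3) * \<zeta>1'" "a'$2 = (1 - a'$3) * \<zeta>2'"
    "N1' = v'$1 + \<zeta>1' * v'$3" "N2' = v'$2 + \<zeta>2' * v'$3"
    "a'$3 * (\<zeta>1'\<^sup>2 + \<zeta>2'\<^sup>2 + 1) = \<zeta>1'\<^sup>2 + \<zeta>2'\<^sup>2 - 1"
    "v'$3 = (1 - a'$3) * (\<zeta>1' * N1' + \<zeta>2' * N2')"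
    "N2' = x' * (1 + N1')" "x'\<^sup>2 * (1 + N1') = 1 - N1'"
    "jet a' v' = (x', 2 * \<zeta>2' - 2 * x' * \<zeta>1', (1 - x'\<^sup>2) * \<zeta>1' + 2 * x' * \<zeta>2')"
    using contact_frame_coordinates[OF assms(2)] by blast
  have x: "x' = x" and yz: "2 * \<zeta>2 - 2 * x * \<zeta>1 = 2 * \<zeta>2' - 2 * x * \<zeta>1'"
    "(1 - x\<^sup>2) * \<zeta>1 + 2 * x * \<zeta>2 = (1 - x\<^sup>2) * \<zeta>1' + 2 * x * \<zeta>2'"
    using assms(3) unfolding f(9) g(9) by auto
  have pos: "1 + x\<^sup>2 \<noteq> 0" by (simp add: add_nonneg_eq_0_iff)
  have d2: "\<zeta>2 = \<zeta>2' + x * (\<zeta>1 - \<zeta>1')" using yz(1) by (simp add: algebra_simps)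
  have "(1 + x\<^sup>2) * (\<zeta>1 - \<zeta>1') = 0"
    using yz(2) unfolding d2 by (simp add: algebra_simps power2_eq_square)
  then have z1: "\<zeta>1' = \<zeta>1" using pos by simp
  then have z2: "\<zeta>2' = \<zeta>2" using yz(1) by simp
  have "(1 + x\<^sup>2) * (N1 - N1') = 0"
    using f(8) g(8) unfolding x by (simp add: algebra_simps)
  then have N1: "N1' = N1" using pos by simp
  then have N2: "N2' = N2" using f(7) g(7) x by simp
  have "\<zeta>1\<^sup>2 + \<zeta>2\<^sup>2 + 1 > 0" by (intro add_nonneg_pos) auto
  moreover have "(a'$3 - a$3) * (\<zeta>1\<^sup>2 + \<zeta>2\<^sup>2 + 1) = 0"
    using f(5) g(5) unfolding z1 z2 by (simp add: algebra_simps)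
  ultimately have a3: "a'$3 = a$3" by simp
  have v3: "v'$3 = v$3" using f(6) g(6) by (simp only: a3 z1 z2 N1 N2)
  have "a'$1 = a$1" "a'$2 = a$2" using f(1,2) g(1,2) by (simp_all only: a3 z1 z2)
  moreover have "v'$1 = v$1" "v'$2 = v$2" using f(3,4) g(3,4) unfolding N1 N2 z1 z2 v3 by simp_all
  ultimately show ?thesis using a3 v3 by (simp add: vec_eq_iff forall_3)
qed

section \<open>Horizon circles as quadratics\<close>

text \<open>The horizon circle of p consists of the unit vectors a with |p|^2 = 2 (p . a). With k =
  \<open>pole_power p\<close>, its stereographic image has centre (2/k) (p1, p2) and, up to sign,
  radius \<open>horizon_radius p\<close>; k vanishes iff the pole satisfies the horizon
  equation.\<close>

definition pole_power :: "real^3 \<Rightarrow> real" where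
  "pole_power p = (norm p)\<^sup>2 - 2 * p$3"

definition horizon_radius :: "real^3 \<Rightarrow> real" where
  "horizon_radius p = sqrt (4 * (norm p)\<^sup>2 - (norm p) ^ 4) / pole_power p"

text \<open>The quadratic (1 - t^2) M1 + 2 t M2 - r (1 + t^2): up to the factor 1 + t^2, the support
  function of an oriented circle with centre M. The sign of r is such that a contact at \<zeta> with
  normal N means M = \<zeta> + r N.\<close>

definition horizon_quad :: "real^3 \<Rightarrow> real \<Rightarrow> real \<times> real \<times> real" where
  "horizon_quad p r = (let M1 = 2 * p$1 / pole_power p; M2 = 2 * p$2 / pole_power p
     in (- 2 * (M1 + r), 2 * M2, M1 - r))"

text \<open>The contact has r = 2 \<beta> / k, the sign of \<beta> selecting the orientation.
  Subtracting (1 - t^2) \<zeta>1 + 2 t \<zeta>2 from the horizon quadratic leaves -r (1 + N1) (t -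
  x)^2; the double zero at x gives equal value and slope.\<close>

lemma circ_incidence:
  assumes fr: "contact_frame a v" and p: "p \<in> circ a v" and k: "pole_power p \<noteq> 0"
  shows "\<exists>r\<in>{horizon_radius p, - horizon_radius p}.
    quad_graph (horizon_quad p r) (fst (jet a v)) = jet a v"
proof -
  obtain \<alpha> \<beta> where ab: "p = \<alpha> *\<^sub>R a + \<beta> *\<^sub>R v" "\<alpha>\<^sup>2 + \<beta>\<^sup>2 = 2 * \<alpha>"
    using p by (auto simp: circ_def)
  obtain \<zeta>1 \<zeta>2 N1 N2 x where f: "a$1 = (1 - a$3) * \<zeta>1" "a$2 = (1 - a$3) * \<zeta>2"
    "N1 = v$1 + \<zeta>1 * v$3" "N2 = v$2 + \<zeta>2 * v$3"
    "a$3 * (\<zeta>1\<^sup>2 + \<zeta>2\<^sup>2 + 1) = \<zeta>1\<^sup>2 + \<zeta>2\<^sup>2 - 1"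
    "v$3 = (1 - a$3) * (\<zeta>1 * N1 + \<zeta>2 * N2)"
    "N2 = x * (1 + N1)" "x\<^sup>2 * (1 + N1) = 1 - N1"
    "jet a v = (x, 2 * \<zeta>2 - 2 * x * \<zeta>1, (1 - x\<^sup>2) * \<zeta>1 + 2 * x * \<zeta>2)"
    using contact_frame_coordinates[OF fr] by blast
  have "(norm (\<alpha> *\<^sub>R a + \<beta> *\<^sub>R v))\<^sup>2 = \<alpha>\<^sup>2 + \<beta>\<^sup>2"
    by (rule orthonormal_norm) (use fr in \<open>auto simp: contact_frame_def\<close>)
  then have q: "(norm p)\<^sup>2 = 2 * \<alpha>" unfolding ab(1) by (simp only: ab(2))
  define k where "k = pole_power p"
  define r where "r = 2 * \<beta> / k"
  have k0: "k \<noteq> 0" using k by (simp add: k_def)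
  have kk: "k = 2 * \<alpha> - 2 * (\<alpha> * a$3 + \<beta> * v$3)"
  proof -
    have "p$3 = \<alpha> * a$3 + \<beta> * v$3" by (simp add: ab(1))
    then show ?thesis by (simp only: k_def pole_power_def q)
  qed
  have "k * \<zeta>1 + 2 * \<beta> * N1 = 2 * p$1" "k * \<zeta>2 + 2 * \<beta> * N2 = 2 * p$2"
    unfolding kk f(3,4) by (simp_all add: ab(1) f(1,2) algebra_simps)
  then have M: "2 * p$1 / k = \<zeta>1 + r * N1" "2 * p$2 / k = \<zeta>2 + r * N2"
    using k0 by (simp_all add: r_def field_simps)
  have "(norm p) ^ 4 = ((norm p)\<^sup>2)\<^sup>2" by simp
  then have "4 * (norm p)\<^sup>2 - (norm p) ^ 4 = (2 * \<beta>)\<^sup>2"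
  proof -
    have "\<beta>\<^sup>2 = 2 * \<alpha> - \<alpha>\<^sup>2" using ab(2) by simp
    with \<open>(norm p) ^ 4 = ((norm p)\<^sup>2)\<^sup>2\<close> show ?thesis unfolding q by (simp add: power_mult_distrib)
  qed
  then have "sqrt (4 * (norm p)\<^sup>2 - (norm p) ^ 4) = \<bar>2 * \<beta>\<bar>" by (simp only: real_sqrt_abs)
  then have "r \<in> {horizon_radius p, - horizon_radius p}"
    by (auto simp: horizon_radius_def r_def k_def abs_if)
  moreover have "quad_graph (horizon_quad p r) (fst (jet a v)) = jet a v"
  proof -
    have 1: "- 2 * (\<zeta>1 + r * N1 + r) * x + 2 * (\<zeta>2 + r * N2) = 2 * \<zeta>2 - 2 * x * \<zeta>1"
      unfolding f(7) by (simp add: algebra_simps)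
    have 2: "- 2 * (\<zeta>1 + r * N1 + r) * x\<^sup>2 / 2 + 2 * (\<zeta>2 + r * N2) * x + (\<zeta>1 + r * N1 - r)
        = (1 - x\<^sup>2) * \<zeta>1 + 2 * x * \<zeta>2"
    proof -
      have "- ((\<zeta>1 + r * N1 + r) * x\<^sup>2) + 2 * (\<zeta>2 + r * N2) * x + (\<zeta>1 + r * N1 - r)
          - ((1 - x\<^sup>2) * \<zeta>1 + 2 * x * \<zeta>2) = r * (x\<^sup>2 * (1 + N1) - (1 - N1))"
        unfolding f(7) by (simp add: algebra_simps power2_eq_square)
      moreover have "- 2 * u * x\<^sup>2 / 2 = - (u * x\<^sup>2)" for u by simp
      ultimately show ?thesis using f(8) by (simp only: diff_self mult_zero_right right_minus_eq)
    qed
    show ?thesis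
      unfolding f(9) horizon_quad_def Let_def k_def[symmetric] M quad_graph_def
      using 1 2 by simp
  qed
  ultimately show ?thesis by blast
qed

text \<open>The quadratic returns M and r, and so n = |M|^2 - r^2. Up to the factor k these give the
  coordinates of p; inserting them into k = |p|^2 - 2 p3 and cancelling k leaves 8 (1 + n) = k W,
  which determines k because 1 + n is a nonzero multiple of |p|^2.\<close>

lemma horizon_quad_inj:
  assumes p: "p \<noteq> 0" "norm p \<le> 2" "pole_power p \<noteq> 0" "r \<in> {horizon_radius p, - horizon_radius p}"
    and p': "p' \<noteq> 0" "norm p' \<le> 2" "pole_power p' \<noteq> 0" "r' \<in> {horizon_radius p', - horizon_radius p'}"
    and eq: "horizon_quad p r = horizon_quad p' r'"
  shows "p = p'"
proof -
  have key: "2 * p$1 = k * M1 \<and> 2 * p$2 = k * M2 \<and> 4 * p$3 = k * (n - 1) \<and> 8 * (1 + n) = k * (4 * (M1\<^sup>2 + M2\<^sup>2) + (n - 1)\<^sup>2) \<and> 1 + n \<noteq> 0"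
    if p: "p \<noteq> 0" "norm p \<le> 2" "pole_power p \<noteq> 0" "r \<in> {horizon_radius p, - horizon_radius p}"
      and k: "k = pole_power p" and M: "M1 = 2 * p$1 / k" "M2 = 2 * p$2 / k" and n: "n = M1\<^sup>2 + M2\<^sup>2 - r\<^sup>2"
    for p r k M1 M2 n
  proof -
    have k0: "k \<noteq> 0" using p(3) k by simp
    have M': "2 * p$1 = k * M1" "2 * p$2 = k * M2" using M k0 by simp_all
    define q where "q = (norm p)\<^sup>2"
    have q3: "q = (p$1)\<^sup>2 + (p$2)\<^sup>2 + (p$3)\<^sup>2"
      unfolding q_def power2_norm_eq_inner by (simp add: inner_vec_def sum_3 power2_eq_square)
    have q0: "q \<noteq> 0" using p(1) by (simp add: q_def)
    have kq: "k = q - 2 * p$3" by (simp add: k pole_power_def q_def)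
    \<comment> \<open>The bound \<open>norm p \<le> 2\<close> makes the radicand in
      \<open>horizon_radius\<close> nonnegative, so that squaring removes the root.\<close>
    have "(norm p)\<^sup>2 \<le> 2\<^sup>2" using p(2) by (intro power_mono) auto
    then have "q * q \<le> 4 * q" by (intro mult_right_mono) (simp_all add: q_def)
    then have "4 * (norm p)\<^sup>2 - (norm p) ^ 4 \<ge> 0" by (simp add: q_def power4_eq_xxxx power2_eq_square)
    then have rad: "(horizon_radius p)\<^sup>2 = (4 * (norm p)\<^sup>2 - (norm p) ^ 4) / k\<^sup>2"
      by (simp add: horizon_radius_def power_divide k)
    have p4: "(norm p) ^ 4 = q\<^sup>2" by (simp add: q_def)
    have "r\<^sup>2 = (horizon_radius p)\<^sup>2" using p(4) by auto
    then have "r\<^sup>2 = (4 * q - q\<^sup>2) / k\<^sup>2" by (simp only: rad p4 q_def[symmetric])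
    then have r: "k\<^sup>2 * r\<^sup>2 = 4 * q - q\<^sup>2" using k0 by simp
    have M2': "(k * M1)\<^sup>2 + (k * M2)\<^sup>2 = 4 * q - 4 * (p$3)\<^sup>2"
      unfolding M'[symmetric] q3 by (simp add: power_mult_distrib)
    have "k * (k * n) = (k * M1)\<^sup>2 + (k * M2)\<^sup>2 - k\<^sup>2 * r\<^sup>2"
      unfolding n by (simp add: power2_eq_square algebra_simps)
    also have "\<dots> = q\<^sup>2 - 4 * (p$3)\<^sup>2" unfolding M2' r by simp
    also have "\<dots> = k * (q + 2 * p$3)" unfolding kq by (simp add: power2_eq_square algebra_simps)
    finally have kn: "k * n = q + 2 * p$3" using k0 by simp
    have p3: "4 * p$3 = k * (n - 1)" and qq: "2 * q = k * (1 + n)"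
      unfolding right_diff_distrib distrib_left kn using kq by simp_all
    have "k * (8 * (1 + n)) = 8 * (k * (1 + n))" by (rule mult.left_commute)
    also have "\<dots> = 16 * q" unfolding qq[symmetric] by simp
    also have "\<dots> = 4 * ((k * M1)\<^sup>2 + (k * M2)\<^sup>2) + (4 * p$3)\<^sup>2"
      unfolding M2' by (simp add: power_mult_distrib)
    also have "\<dots> = k * (k * (4 * (M1\<^sup>2 + M2\<^sup>2) + (n - 1)\<^sup>2))"
      unfolding p3 by (simp add: power2_eq_square algebra_simps)
    finally have "k * (8 * (1 + n)) = k * (k * (4 * (M1\<^sup>2 + M2\<^sup>2) + (n - 1)\<^sup>2))" .
    then have "8 * (1 + n) = k * (4 * (M1\<^sup>2 + M2\<^sup>2) + (n - 1)\<^sup>2)" using k0 by simp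
    moreover have "1 + n \<noteq> 0" using qq q0 by auto
    ultimately show ?thesis using M' p3 by blast
  qed
  define k where "k = pole_power p"
  define k' where "k' = pole_power p'"
  define M1 where "M1 = 2 * p$1 / k"
  define M2 where "M2 = 2 * p$2 / k"
  have e: "M1 + r = 2 * p'$1 / k' + r'" "M2 = 2 * p'$2 / k'" "M1 - r = 2 * p'$1 / k' - r'"
    using eq unfolding horizon_quad_def Let_def M1_def M2_def k_def k'_def by simp_all
  then have r: "r' = r" and M1': "M1 = 2 * p'$1 / k'" by argo+
  define n where "n = M1\<^sup>2 + M2\<^sup>2 - r\<^sup>2"
  define W where "W = 4 * (M1\<^sup>2 + M2\<^sup>2) + (n - 1)\<^sup>2"
  have K: "2 * p$1 = k * M1" "2 * p$2 = k * M2" "4 * p$3 = k * (n - 1)" "8 * (1 + n) = k * W" "1 + n \<noteq> 0"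
    using key[OF p k_def M1_def M2_def n_def] by (simp_all add: W_def)
  have K': "2 * p'$1 = k' * M1" "2 * p'$2 = k' * M2" "4 * p'$3 = k' * (n - 1)" "8 * (1 + n) = k' * W"
    using key[OF p' k'_def M1' e(2), of n] r by (simp_all add: W_def n_def)
  have "W \<noteq> 0" using K(4,5) by auto
  then have "k = k'" using K(4) K'(4) by simp
  then have "p$1 = p'$1" "p$2 = p'$2" "p$3 = p'$3" using K(1-3) K'(1-3) by simp_all
  then show ?thesis by (simp add: vec_eq_iff forall_3)
qed

lemma circ_linear_image:
  assumes "linear T" "p \<in> circ a v"
  shows "T p \<in> circ (T a) (T v)"
proof -
  obtain \<alpha> \<beta> where p: "p = \<alpha> *\<^sub>R a + \<beta> *\<^sub>R v" "\<alpha>\<^sup>2 + \<beta>\<^sup>2 = 2 * \<alpha>"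
    using assms(2) by (auto simp: circ_def)
  have "T p = \<alpha> *\<^sub>R T a + \<beta> *\<^sub>R T v" using assms(1) by (simp add: p(1) linear_add linear_scale)
  then show ?thesis unfolding circ_def using p(2) by blast
qed

lemma circ_bounds:
  assumes "norm a = 1" "norm v = 1" "a \<bullet> v = 0" "p \<in> circ a v"
  shows "(norm p)\<^sup>2 = 2 * (p \<bullet> a)" "norm p \<le> 2"
proof -
  obtain \<alpha> \<beta> where p: "p = \<alpha> *\<^sub>R a + \<beta> *\<^sub>R v" "\<alpha>\<^sup>2 + \<beta>\<^sup>2 = 2 * \<alpha>"
    using assms(4) by (auto simp: circ_def)
  have "(norm (\<alpha> *\<^sub>R a + \<beta> *\<^sub>R v))\<^sup>2 = \<alpha>\<^sup>2 + \<beta>\<^sup>2"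
    by (rule orthonormal_norm[OF assms(1-3)])
  then have q: "(norm p)\<^sup>2 = 2 * \<alpha>" unfolding p(1) by (simp only: p(2))
  have "a \<bullet> a = 1" using assms(1) by (simp add: dot_square_norm)
  then have "p \<bullet> a = \<alpha>"
    unfolding p(1) using assms(3) by (simp add: inner_add_left inner_commute[of v a])
  then show "(norm p)\<^sup>2 = 2 * (p \<bullet> a)" using q by simp
  have "\<alpha>\<^sup>2 \<le> 2 * \<alpha>" using p(2) zero_le_power2[of \<beta>] by linarith
  then have "\<alpha> * (2 - \<alpha>) \<ge> 0" by (simp add: power2_eq_square algebra_simps)
  then have "\<alpha> \<le> 2" by (auto simp: zero_le_mult_iff)
  then have "(norm p)\<^sup>2 \<le> 2\<^sup>2" using q by simp
  then show "norm p \<le> 2" by (rule power2_le_imp_le) simp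
qed

text \<open>Reversing v negates N1, which cannot be -1 both times. The circle itself does not depend
  on the sign of v.\<close>

lemma contact_frame_choice:
  assumes "norm a = 1" "norm v = 1" "a \<bullet> v = 0" "a$3 \<noteq> 1"
  shows "contact_frame a v \<or> contact_frame a (- v)"
proof (rule ccontr)
  assume "\<not> ?thesis"
  then have "1 + (v$1 + a$1 / (1 - a$3) * v$3) = 0" "1 - (v$1 + a$1 / (1 - a$3) * v$3) = 0"
    using assms by (auto simp: contact_frame_def)
  then show False by linarith
qed

section \<open>Reduction of anchored circles to jets and quadratics\<close>

text \<open>A rotation takes a generic direction to the pole. Each incidence with a nonzero point
  then maps injectively to an incidence between the jet of the circle and one of the two quadratics
  of the point. Two quadratics per point and one unit per circle for the origin give the
  coefficients 1976, 1976 and 989, all below 2000.\<close>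

theorem anchored_circle_incidences:
  fixes P :: "(real^3) set" and C :: "(real^3) set set"
  assumes P: "finite P" and C: "finite C" and anchored: "\<And>c. c \<in> C \<Longrightarrow> anchored_unit_circle c"
  shows "real (incidences P C) \<le> 2000 * (real (card P) powr (3/5) * real (card C) powr (3/5) + real (card P) + real (card C))"
proof -
  obtain w where w: "norm w = 1" "\<And>p. p \<in> P - {0} \<Longrightarrow> (norm p)\<^sup>2 \<noteq> 2 * (p \<bullet> w)"
    using generic_pole[of "P - {0}"] P by auto
  have "norm (axis 3 1 :: real^3) = 1" by simp
  from orthogonal_transformation_exists_1[OF w(1) this]
  obtain T :: "real^3 \<Rightarrow> real^3" where T: "orthogonal_transformation T" "T w = axis 3 1"
    by blast
  have lin: "linear T" and iso: "norm (T p) = norm p" "T p \<bullet> T q = p \<bullet> q" for p q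
    using T(1) orthogonal_transformation[of T] orthogonal_transformation_def[of T] by blast+
  have T3: "(T p)$3 = p \<bullet> w" for p
    using iso(2)[of p w] unfolding T(2) by (simp add: inner_axis)
  have injT: "p = q" if "T p = T q" for p q
    using iso(1)[of "p - q"] that lin by (simp add: linear_diff)
  \<comment> \<open>Nothing is required when \<open>T a\<close> is the pole: by the choice of w such
    a circle contains no point of \<open>P - {0}\<close>.\<close>
  define Fr where "Fr = (\<lambda>c a v. c = circ a v \<and> norm a = 1 \<and> norm v = 1 \<and> a \<bullet> v = 0
    \<and> ((T a)$3 \<noteq> 1 \<longrightarrow> contact_frame (T a) (T v)))"
  have "\<exists>a v. Fr c a v" if c: "c \<in> C" for c
  proof -
    obtain a v where av: "norm a = 1" "norm v = 1" "a \<bullet> v = 0" "c = circ a v"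
      using anchored_unit_circle_circ[OF anchored[OF c]] by blast
    show ?thesis
    proof (cases "(T a)$3 \<noteq> 1 \<and> \<not> contact_frame (T a) (T v)")
      case True
      then have "contact_frame (T a) (T (- v))"
        using contact_frame_choice[of "T a" "T v"] av iso lin by (simp add: linear_neg)
      then show ?thesis unfolding Fr_def using av circ_minus[of a v] by (intro exI[of _ a] exI[of _ "- v"]) simp
    next
      case False
      then show ?thesis unfolding Fr_def using av by blast
    qed
  qed
  then have "\<forall>c\<in>C. \<exists>av. Fr c (fst av) (snd av)" by simp
  from bchoice[OF this] obtain F where F: "\<forall>c\<in>C. Fr c (fst (F c)) (snd (F c))" by blast
  define A V where "A = (\<lambda>c. fst (F c))" and "V = (\<lambda>c. snd (F c))"
  have AV: "\<And>c. c \<in> C \<Longrightarrow> c = circ (A c) (V c)" "\<And>c. c \<in> C \<Longrightarrow> norm (A c) = 1"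
    "\<And>c. c \<in> C \<Longrightarrow> norm (V c) = 1" "\<And>c. c \<in> C \<Longrightarrow> A c \<bullet> V c = 0"
    "\<And>c. c \<in> C \<Longrightarrow> (T (A c))$3 \<noteq> 1 \<Longrightarrow> contact_frame (T (A c)) (T (V c))"
    using F unfolding Fr_def A_def V_def by blast+
  define S where "S = {(p, c). p \<in> P - {0} \<and> c \<in> C \<and> p \<in> c}"
  define J where "J = (\<lambda>c. jet (T (A c)) (T (V c)))"
  define B where "B = (\<lambda>p. horizon_quad (T p) (horizon_radius (T p))) ` P \<union> (\<lambda>p. horizon_quad (T p) (- horizon_radius (T p))) ` P"
  have S: "contact_frame (T (A c)) (T (V c)) \<and> T p \<in> circ (T (A c)) (T (V c)) \<and> pole_power (T p) \<noteq> 0 \<and> T p \<noteq> 0 \<and> norm (T p) \<le> 2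
      \<and> p \<in> P \<and> c \<in> C"
    if pc: "(p, c) \<in> S" for p c
  proof -
    have p: "p \<in> P - {0}" "c \<in> C" "p \<in> circ (A c) (V c)" using pc AV(1) by (auto simp: S_def)
    have b: "(norm p)\<^sup>2 = 2 * (p \<bullet> A c)" "norm p \<le> 2"
      using circ_bounds[OF AV(2-4)[OF p(2)] p(3)] .
    have "A c \<noteq> w" using b(1) w(2)[OF p(1)] by auto
    have "(T (A c))$3 \<noteq> 1"
    proof
      assume "(T (A c))$3 = 1"
      then have "A c \<bullet> w = 1" by (simp add: T3)
      moreover have "A c \<bullet> A c = 1" "w \<bullet> w = 1"
        using AV(2)[OF p(2)] w(1) by (simp_all add: dot_square_norm)
      ultimately have "(A c - w) \<bullet> (A c - w) = 0"
        by (simp add: inner_diff_left inner_diff_right inner_commute[of w "A c"])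
      then show False using \<open>A c \<noteq> w\<close> by (simp only: inner_eq_zero_iff right_minus_eq)
    qed
    moreover have "pole_power (T p) \<noteq> 0"
      using w(2)[OF p(1)] by (simp add: pole_power_def iso T3)
    moreover have "T p \<noteq> 0" using p(1) iso(1)[of p] by auto
    ultimately show ?thesis
      using AV(5)[OF p(2)] p b(2) circ_linear_image[OF lin p(3)] by (simp add: iso)
  qed
  have "\<forall>x\<in>S. \<exists>r. r \<in> {horizon_radius (T (fst x)), - horizon_radius (T (fst x))} \<and>
      quad_graph (horizon_quad (T (fst x)) r) (fst (J (snd x))) = J (snd x)"
  proof clarify
    fix p c assume "(p, c) \<in> S"
    note s = S[OF this]
    have "\<exists>r\<in>{horizon_radius (T p), - horizon_radius (T p)}. quad_graph (horizon_quad (T p) r) (fst (J c)) = J c"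
      unfolding J_def using s by (intro circ_incidence) blast+
    then show "\<exists>r. r \<in> {horizon_radius (T (fst (p, c))), - horizon_radius (T (fst (p, c)))} \<and>
      quad_graph (horizon_quad (T (fst (p, c))) r) (fst (J (snd (p, c)))) = J (snd (p, c))"
      unfolding fst_conv snd_conv by blast
  qed
  from bchoice[OF this] obtain Rf where Rf: "\<forall>x\<in>S. Rf x \<in> {horizon_radius (T (fst x)), - horizon_radius (T (fst x))} \<and>
      quad_graph (horizon_quad (T (fst x)) (Rf x)) (fst (J (snd x))) = J (snd x)"
    by blast
  define R where "R = (\<lambda>p c. Rf (p, c))"
  have R: "R p c \<in> {horizon_radius (T p), - horizon_radius (T p)}"
    "quad_graph (horizon_quad (T p) (R p c)) (fst (J c)) = J c" if "(p, c) \<in> S" for p c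
    using bspec[OF Rf that] unfolding R_def fst_conv snd_conv by blast+
  let ?F = "\<lambda>(p, c). (J c, horizon_quad (T p) (R p c))"
  have inj: "inj_on ?F S"
  proof (rule inj_onI, clarify)
    fix p c p' c' assume s: "(p, c) \<in> S" "(p', c') \<in> S"
      and e: "J c = J c'" "horizon_quad (T p) (R p c) = horizon_quad (T p') (R p' c')"
    have "T p = T p'"
      using horizon_quad_inj[OF _ _ _ R(1)[OF s(1)] _ _ _ R(1)[OF s(2)] e(2)] S[OF s(1)] S[OF s(2)] by blast
    moreover have "T (A c) = T (A c') \<and> T (V c) = T (V c')"
      using jet_inj S[OF s(1)] S[OF s(2)] e(1) unfolding J_def by blast
    then have "A c = A c'" "V c = V c'" using injT by blast+
    then have "c = c'" using AV(1) S[OF s(1)] S[OF s(2)] by metis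
    ultimately show "p = p' \<and> c = c'" using injT by blast
  qed
  have finB: "finite B" and finJ: "finite (J ` C)" using P C by (simp_all add: B_def)
  have "?F ` S \<subseteq> {(j, b). j \<in> J ` C \<and> b \<in> B \<and> quad_graph b (fst j) = j}"
  proof (rule image_subsetI)
    fix y assume "y \<in> S"
    then obtain p c where y: "y = (p, c)" and s: "(p, c) \<in> S" by (cases y) auto
    have "horizon_quad (T p) (R p c) \<in> B" using R(1)[OF s] S[OF s] by (auto simp: B_def)
    then show "?F y \<in> {(j, b). j \<in> J ` C \<and> b \<in> B \<and> quad_graph b (fst j) = j}"
      unfolding y using R(2)[OF s] S[OF s] by simp
  qed
  moreover have "finite {(j, b). j \<in> J ` C \<and> b \<in> B \<and> quad_graph b (fst j) = j}"
    by (rule finite_subset[of _ "J ` C \<times> B"]) (use finB finJ in auto)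
  ultimately have cardS: "card S \<le> incidence_count (\<lambda>p c. quad_graph c (fst p) = p) (J ` C) B"
    unfolding incidence_count_def by (intro card_inj_on_le[OF inj])
  \<comment> \<open>The origin has no horizon circle and is set aside; it contributes at most one
    incidence per circle.\<close>
  have "{(p, c). p \<in> P \<and> c \<in> C \<and> p \<in> c} \<subseteq> S \<union> {0} \<times> C" by (auto simp: S_def)
  moreover have "finite S" by (rule finite_subset[of _ "P \<times> C"]) (use P C in \<open>auto simp: S_def\<close>)
  ultimately have "incidences P C \<le> card (S \<union> {0} \<times> C)"
    unfolding incidences_def using C by (intro card_mono) auto
  also have "\<dots> \<le> card S + card C"
    by (rule order_trans[OF card_Un_le]) (simp add: card_cartesian_product)
  finally have "real (incidences P C) \<le> real (incidence_count (\<lambda>p c. quad_graph c (fst p) = p) (J ` C) B) + real (card C)"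
    using cardS by linarith
  also have "\<dots> \<le> 988 * (real (card (J ` C)) powr (3/5) * real (card B) powr (3/5) + real (card (J ` C)) + real (card B)) + real (card C)"
    by (intro add_right_mono jet_quadratic_incidences finJ finB)
  also have "\<dots> \<le> 988 * (real (card C) powr (3/5) * (2 * real (card P) powr (3/5)) + real (card C) + 2 * real (card P)) + real (card C)"
  proof -
    have JC: "real (card (J ` C)) \<le> real (card C)" using card_image_le[OF C] by simp
    have "card B \<le> card P + card P"
      unfolding B_def by (intro order_trans[OF card_Un_le] add_mono card_image_le P)
    then have BP: "real (card B) \<le> 2 * real (card P)" by simp
    have "real (card B) powr (3/5) \<le> (2 * real (card P)) powr (3/5)" using BP by (intro powr_mono2) auto
    also have "\<dots> = 2 powr (3/5) * real (card P) powr (3/5)" by (simp add: powr_mult)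
    also have "\<dots> \<le> 2 * real (card P) powr (3/5)"
    proof (rule mult_right_mono)
      have "2 powr (3/5) \<le> (2::real) powr 1" by (rule powr_mono) auto
      then show "2 powr (3/5) \<le> (2::real)" by simp
    qed simp
    finally have B35: "real (card B) powr (3/5) \<le> 2 * real (card P) powr (3/5)" .
    have J35: "real (card (J ` C)) powr (3/5) \<le> real (card C) powr (3/5)" using JC by (intro powr_mono2) auto
    show ?thesis
      by (intro add_mono mult_left_mono mult_mono B35 J35 JC BP) simp_all
  qed
  also have "\<dots> \<le> 2000 * (real (card P) powr (3/5) * real (card C) powr (3/5) + real (card P) + real (card C))"
  proof -
    have "0 \<le> real (card P) powr (3/5) * real (card C) powr (3/5)" by simp
    then show ?thesis by (simp add: algebra_simps)
  qed
  finally show ?thesis .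
qed

theorem theorem2p1:
  shows "\<exists>K::real. K > 0 \<and>
    (\<forall>(m::nat) (n::nat) (P::(real^3) set) (C::(real^3) set set).
       finite P \<and> card P = m \<and> finite C \<and> card C = n \<and>
       (\<forall>c\<in>C. anchored_unit_circle c) \<longrightarrow>
       real (incidences P C)
         \<le> K * (real m powr (3/5) * real n powr (3/5) + real m + real n))"
proof (intro exI[of _ 2000] conjI allI impI)
  fix m n :: nat and P :: "(real^3) set" and C :: "(real^3) set set"
  assume "finite P \<and> card P = m \<and> finite C \<and> card C = n \<and> (\<forall>c\<in>C. anchored_unit_circle c)"
  then show "real (incidences P C) \<le> 2000 * (real m powr (3/5) * real n powr (3/5) + real m + real n)"
    using anchored_circle_incidences[of P C] by blast
qed simp

end
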